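(* Let $(\mathbf E,\mathbf H,\mathbf u,\xi,p)$ be a sufficiently regular solution on $[0,T_f]$ of the weak five-field electroporoelasticity problem described in the context, with initial values $(\mathbf E^0,\mathbf H^0,\mathbf u^0,\xi^0,p^0)$. Then there is a constant $C>0$, independent of $\lambda$ (and of $t$, of the solution and of the data $\mathbf f,\mathbf h,g$ and the initial values), such that for all $t\in[0,T_f]$ $$\mathcal E(\mathbf E(t),\mathbf H(t),\mathbf u(t),\xi(t),p(t))+\Big(1-\frac{L}{\sqrt{\sigma\kappa}}\Big)\int_0^t\mathcal V(\mathbf E(s),p(s))\,ds$$ $$\le C\Big(\mathcal E(\mathbf E^0,\mathbf H^0,\mathbf u^0,\xi^0,p^0)+\|\mathbf f\|_{H^1(0,T_f;\mathbf L^2)}^2+\|\mathbf h\|_{L^2(0,T_f;\mathbf L^2)}^2+\|g\|_{L^2(0,T_f;L^2)}^2\Big).$$ Moreover, $$\|\xi(t)\|_{L^2}\le C\big(G\|\nabla\mathbf u(t)\|_{L^2}+\|\mathbf f(t)\|_{L^2}\big).$$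
   Context: Setting. $\Omega\subset\mathbb R^3$ is a bounded Lipschitz polyhedron with outward unit normal $\mathbf n$; $T_f>0$; $\partial\Omega=\overline{\Gamma_D^u}\cup\overline{\Gamma_N^u}$ with $\Gamma_D^u,\Gamma_N^u$ non-empty, disjoint boundary parts (relatively open in $\partial\Omega$). $(\cdot,\cdot)$ is the $L^2(\Omega)$ inner product (scalar, vector or matrix valued), $\|\cdot\|_{L^2}$ its norm; $\mathbf L^2=[L^2(\Omega)]^3$, $\mathbf H^1=[H^1(\Omega)]^3$. Spaces. $\mathbb E=\{\mathbf v\in\mathbf L^2(\Omega):\nabla\times\mathbf v\in\mathbf L^2(\Omega),\ \mathbf v\times\mathbf n=\mathbf 0\text{ on }\partial\Omega\}$, $\mathbb H=\mathbf L^2(\Omega)$, $\mathbb U=\{\mathbf v\in\mathbf H^1(\Omega):\mathbf v=\mathbf 0\text{ on }\Gamma_D^u\}$, $\mathbb W=L^2(\Omega)$, $\mathbb P=H^1_0(\Omega)$, and $\mathbb S=\mathbb E\times\mathbb H\times\mathbb U\times\mathbb W\times\mathbb P$. Standing assumptions. The real parameters $\epsilon,\sigma,\mu,G,\lambda,\alpha,\kappa,c_0$ are positive and $0<L<\sqrt{\sigma\kappa}$. The sources satisfy $\mathbf f\in H^1(0,T_f;\mathbf L^2(\Omega))$, $\mathbf h\in L^2(0,T_f;\mathbf L^2(\Omega))$, $g\in L^2(0,T_f;L^2(\Omega))$. The pair $(\mathbb U,\mathbb W)$ satisfies the inf-sup condition: there is $\beta>0$, depending only on $\Omega$ and the boundary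 decomposition, with $\beta\|w\|_{L^2}\le\sup_{\mathbf 0\ne\mathbf v\in\mathbb U}(\nabla\cdot\mathbf v,w)/\|\mathbf v\|_{H^1}$ for all $w\in\mathbb W$. Weak problem. For almost every $t\in(0,T_f]$, $(\mathbf E(t),\mathbf H(t),\mathbf u(t),\xi(t),p(t))\in\mathbb S$ and, for all $(\mathbf D,\mathbf B,\mathbf v,w,q)\in\mathbb S$, $$\epsilon(\partial_t\mathbf E,\mathbf D)+\sigma(\mathbf E,\mathbf D)-(\mathbf H,\nabla\times\mathbf D)-L(\nabla p,\mathbf D)=(\mathbf h,\mathbf D),$$ $$\mu(\partial_t\mathbf H,\mathbf B)+(\nabla\times\mathbf E,\mathbf B)=0,$$ $$G(\nabla\mathbf u,\nabla\mathbf v)-(\xi,\nabla\cdot\mathbf v)=(\mathbf f,\mathbf v),$$ $$(\nabla\cdot\mathbf u,w)+\lambda^{-1}(\xi,w)-\alpha\lambda^{-1}(p,w)=0,$$ $$(c_0+\alpha^2\lambda^{-1})(\partial_tp,q)-\alpha\lambda^{-1}(\partial_t\xi,q)+\kappa(\nabla p,\nabla q)-L(\mathbf E,\nabla q)=(g,q),$$ with $\mathbf E(0)=\mathbf E^0$, $\mathbf H(0)=\mathbf H^0$, $\mathbf u(0)=\mathbf u^0$, $p(0)=p^0$ and $\xi(0)=\xi^0:=\alpha p^0-\lambda\nabla\cdot\mathbf u^0$. "Sufficiently regular" means regular enough in time that all time derivatives are defined and admissible, e.g. $(\mathbf E,\mathbf H,\mathbf u,\xi,p)\in H^1(0,T_f;\mathbb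 S)$. Functionals. For $(\mathbf D,\mathbf B,\mathbf v,w,q)\in\mathbb S$, $$\mathcal E(\mathbf D,\mathbf B,\mathbf v,w,q)=\epsilon\|\mathbf D\|_{L^2}^2+\mu\|\mathbf B\|_{L^2}^2+G\|\nabla\mathbf v\|_{L^2}^2+\lambda^{-1}\|w-\alpha q\|_{L^2}^2+c_0\|q\|_{L^2}^2,\qquad \mathcal V(\mathbf D,q)=\sigma\|\mathbf D\|_{L^2}^2+\kappa\|\nabla q\|_{L^2}^2.$$ The constant $C$ may depend on $\Omega$, the boundary decomposition, $T_f$ and the parameters other than $\lambda$. *)

theory Defs
  imports "HOL-Analysis.Analysis"
begin

definition sq_integrable :: "('a::euclidean_space \<Rightarrow> 'b::euclidean_space) \<Rightarrow> bool" where
  "sq_integrable f \<longleftrightarrow> f \<in> borel_measurable lborel \<and> integrable lborel (\<lambda>x. (norm (f x))\<^sup>2)"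

definition l2_eq :: "('a::euclidean_space \<Rightarrow> 'b::euclidean_space) \<Rightarrow> ('a \<Rightarrow> 'b) \<Rightarrow> bool" where
  "l2_eq f g \<longleftrightarrow> sq_integrable f \<and> sq_integrable g \<and> (AE x in lborel. f x = g x)"

lemma sq_integrable_measurable [measurable_dest]: "sq_integrable f \<Longrightarrow> f \<in> borel_measurable lborel"
  by (simp add: sq_integrable_def)

lemma sq_integrable_zero [simp]: "sq_integrable (\<lambda>x. 0)"
  by (simp add: sq_integrable_def)

lemma norm_add_sq_le: "(norm (x + y))\<^sup>2 \<le> 2 * (norm x)\<^sup>2 + 2 * (norm (y::'b::real_normed_vector))\<^sup>2"
proof -
  have "(norm (x + y))\<^sup>2 \<le> (norm x + norm y)\<^sup>2"
    by (intro power_mono norm_triangle_ineq) simp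
  also have "\<dots> \<le> 2 * (norm x)\<^sup>2 + 2 * (norm y)\<^sup>2"
    using sum_squares_bound[of "norm x" "norm y"] by (simp add: power2_sum)
  finally show ?thesis .
qed

lemma sq_integrable_dominated:
  assumes "f \<in> borel_measurable lborel" "integrable lborel g" "\<And>x. (norm (f x))\<^sup>2 \<le> (g x :: real)"
  shows "sq_integrable f"
  unfolding sq_integrable_def
proof (intro conjI assms(1))
  have [measurable]: "f \<in> borel_measurable borel" using assms(1) by simp
  show "integrable lborel (\<lambda>x. (norm (f x))\<^sup>2)"
  proof (rule Bochner_Integration.integrable_bound[OF assms(2)])
    show "AE x in lborel. norm ((norm (f x))\<^sup>2) \<le> norm (g x)"
      using assms(3) by (auto intro!: AE_I2 order_trans[OF _ abs_ge_self])
  qed simp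
qed

lemma sq_integrable_add:
  assumes "sq_integrable f" "sq_integrable g"
  shows "sq_integrable (\<lambda>x. f x + g x)"
  using assms norm_add_sq_le
  by (intro sq_integrable_dominated[where g = "\<lambda>x. 2 * (norm (f x))\<^sup>2 + 2 * (norm (g x))\<^sup>2"])
     (auto simp: sq_integrable_def)

lemma sq_integrable_scaleR:
  assumes "sq_integrable f"
  shows "sq_integrable (\<lambda>x. c *\<^sub>R f x)"
  using assms
  by (intro sq_integrable_dominated[where g = "\<lambda>x. c\<^sup>2 * (norm (f x))\<^sup>2"])
     (auto simp: sq_integrable_def power_mult_distrib)

lemma sq_integrable_uminus: "sq_integrable f \<Longrightarrow> sq_integrable (\<lambda>x. - f x)"
  using sq_integrable_scaleR[of f "-1"] by simp

lemma sq_integrable_diff: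
  assumes "sq_integrable f" "sq_integrable g"
  shows "sq_integrable (\<lambda>x. f x - g x)"
  using sq_integrable_add[OF assms(1) sq_integrable_uminus[OF assms(2)]] by simp

lemma integrable_inner_sq:
  assumes "sq_integrable f" "sq_integrable g"
  shows "integrable lborel (\<lambda>x. f x \<bullet> g x)"
proof (rule Bochner_Integration.integrable_bound)
  show "integrable lborel (\<lambda>x. (norm (f x))\<^sup>2 + (norm (g x))\<^sup>2)"
    using assms by (auto simp: sq_integrable_def)
  show "(\<lambda>x. f x \<bullet> g x) \<in> borel_measurable lborel"
    using assms by (auto simp: sq_integrable_def)
  have "norm (f x \<bullet> g x) \<le> norm ((norm (f x))\<^sup>2 + (norm (g x))\<^sup>2)" for x
  proof -
    have "\<bar>f x \<bullet> g x\<bar> \<le> norm (f x) * norm (g x)" by (rule Cauchy_Schwarz_ineq2)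
    also have "\<dots> \<le> 2 * norm (f x) * norm (g x)" by simp
    also have "\<dots> \<le> (norm (f x))\<^sup>2 + (norm (g x))\<^sup>2" by (rule sum_squares_bound)
    finally show ?thesis by simp
  qed
  then show "AE x in lborel. norm (f x \<bullet> g x) \<le> norm ((norm (f x))\<^sup>2 + (norm (g x))\<^sup>2)"
    by (intro AE_I2)
qed

text \<open>The Hilbert space of square-integrable functions modulo equality almost everywhere; its
  completeness and separability make the Bochner integral available for functions of time with
  values in it.\<close>

quotient_type (overloaded) ('a, 'b) l2 =
  "'a::euclidean_space \<Rightarrow> 'b::euclidean_space" / partial: l2_eq
  morphisms rep_l2 l2_class
proof (rule part_equivpI)
  show "\<exists>f::'a \<Rightarrow> 'b. l2_eq f f"
    by (intro exI[of _ "\<lambda>x. 0"]) (simp add: l2_eq_def)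
  show "symp (l2_eq :: ('a \<Rightarrow> 'b) \<Rightarrow> _)"
    by (auto simp: symp_def l2_eq_def elim!: eventually_mono)
  show "transp (l2_eq :: ('a \<Rightarrow> 'b) \<Rightarrow> _)"
    unfolding transp_def
  proof (intro allI impI)
    fix f g h :: "'a \<Rightarrow> 'b" assume *: "l2_eq f g" "l2_eq g h"
    then have "AE x in lborel. f x = g x" "AE x in lborel. g x = h x"
      by (simp_all add: l2_eq_def)
    then have "AE x in lborel. f x = h x" by eventually_elim simp
    with * show "l2_eq f h" by (simp add: l2_eq_def)
  qed
qed

instantiation l2 :: (euclidean_space, euclidean_space) real_vector
begin

lift_definition zero_l2 :: "('a, 'b) l2" is "\<lambda>x. 0"
  by (simp add: l2_eq_def)

lift_definition plus_l2 :: "('a, 'b) l2 \<Rightarrow> ('a, 'b) l2 \<Rightarrow> ('a, 'b) l2" is "\<lambda>f g x. f x + g x"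
  by (auto simp: l2_eq_def intro!: sq_integrable_add)

lift_definition minus_l2 :: "('a, 'b) l2 \<Rightarrow> ('a, 'b) l2 \<Rightarrow> ('a, 'b) l2" is "\<lambda>f g x. f x - g x"
  by (auto simp: l2_eq_def intro!: sq_integrable_diff)

lift_definition uminus_l2 :: "('a, 'b) l2 \<Rightarrow> ('a, 'b) l2" is "\<lambda>f x. - f x"
  by (auto simp: l2_eq_def intro!: sq_integrable_uminus)

lift_definition scaleR_l2 :: "real \<Rightarrow> ('a, 'b) l2 \<Rightarrow> ('a, 'b) l2" is "\<lambda>c f x. c *\<^sub>R f x"
  by (auto simp: l2_eq_def intro!: sq_integrable_scaleR)

instance
proof
  fix u v w :: "('a, 'b) l2" and a b :: real
  show "u + v + w = u + (v + w)"
    by transfer (auto simp: l2_eq_def add.assoc intro!: sq_integrable_add)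
  show "u + v = v + u"
    by transfer (auto simp: l2_eq_def add.commute intro!: sq_integrable_add)
  show "0 + u = u"
    by transfer (auto simp: l2_eq_def)
  show "- u + u = 0"
    by transfer (auto simp: l2_eq_def)
  show "u - v = u + - v"
    by transfer (auto simp: l2_eq_def intro!: sq_integrable_diff)
  show "a *\<^sub>R (u + v) = a *\<^sub>R u + a *\<^sub>R v"
    by transfer (auto simp: l2_eq_def algebra_simps intro!: sq_integrable_add sq_integrable_scaleR)
  show "(a + b) *\<^sub>R u = a *\<^sub>R u + b *\<^sub>R u"
    by transfer (auto simp: l2_eq_def algebra_simps intro!: sq_integrable_add sq_integrable_scaleR)
  show "a *\<^sub>R b *\<^sub>R u = (a * b) *\<^sub>R u"
    by transfer (auto simp: l2_eq_def intro!: sq_integrable_scaleR)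
  show "1 *\<^sub>R u = u"
    by transfer (auto simp: l2_eq_def)
qed

end

instantiation l2 :: (euclidean_space, euclidean_space) real_inner
begin

lift_definition inner_l2 :: "('a, 'b) l2 \<Rightarrow> ('a, 'b) l2 \<Rightarrow> real" is
  "\<lambda>f g. \<integral>x. f x \<bullet> g x \<partial>lborel"
  by (auto simp: l2_eq_def sq_integrable_def intro!: integral_cong_AE)

definition norm_l2 :: "('a, 'b) l2 \<Rightarrow> real" where "norm_l2 u = sqrt (u \<bullet> u)"
definition sgn_l2 :: "('a, 'b) l2 \<Rightarrow> ('a, 'b) l2" where "sgn_l2 u = u /\<^sub>R norm u"
definition dist_l2 :: "('a, 'b) l2 \<Rightarrow> ('a, 'b) l2 \<Rightarrow> real" where "dist_l2 u v = norm (u - v)"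
definition uniformity_l2 :: "(('a, 'b) l2 \<times> ('a, 'b) l2) filter"
  where "uniformity_l2 = (INF e\<in>{0<..}. principal {(x, y). dist x y < e})"
definition open_l2 :: "('a, 'b) l2 set \<Rightarrow> bool"
  where "open_l2 S = (\<forall>x\<in>S. \<forall>\<^sub>F (x', y) in uniformity. x' = x \<longrightarrow> y \<in> S)"

instance
proof
  fix u v w :: "('a, 'b) l2" and a :: real
  show "u \<bullet> v = v \<bullet> u"
    by transfer (simp add: inner_commute)
  show "(u + v) \<bullet> w = u \<bullet> w + v \<bullet> w"
    by transfer (auto simp: l2_eq_def inner_add_left intro!: Bochner_Integration.integral_add integrable_inner_sq)
  show "(a *\<^sub>R u) \<bullet> v = a * (u \<bullet> v)"
    by transfer simp
  show "0 \<le> u \<bullet> u"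
    by transfer simp
  show "u \<bullet> u = 0 \<longleftrightarrow> u = 0"
  proof transfer
    fix u :: "'a \<Rightarrow> 'b" assume u: "l2_eq u u"
    then have "(\<integral>x. u x \<bullet> u x \<partial>lborel) = 0 \<longleftrightarrow> (AE x in lborel. u x \<bullet> u x = 0)"
      by (intro integral_nonneg_eq_0_iff_AE integrable_inner_sq) (auto simp: l2_eq_def)
    with u show "(\<integral>x. u x \<bullet> u x \<partial>lborel) = 0 \<longleftrightarrow> l2_eq u (\<lambda>x. 0)"
      by (simp add: l2_eq_def)
  qed
qed (rule norm_l2_def sgn_l2_def dist_l2_def uniformity_l2_def open_l2_def)+

end

lemma l2_eq_refl: "l2_eq f f \<longleftrightarrow> sq_integrable f"
  by (simp add: l2_eq_def)

lemma l2_class_eq_iff: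
  assumes "sq_integrable f" "sq_integrable g"
  shows "l2_class f = l2_class g \<longleftrightarrow> (AE x in lborel. f x = g x)"
  using Quotient3_rel[OF Quotient3_l2, of f g] assms by (auto simp: l2_eq_def)

lemma sq_integrable_rep: "sq_integrable (rep_l2 u)"
  using Quotient3_rep_reflp[OF Quotient3_l2, of u] by (simp add: l2_eq_def)

lemma l2_class_rep [simp]: "l2_class (rep_l2 u) = u"
  by (rule Quotient3_abs_rep[OF Quotient3_l2])

lemma l2_class_cases: obtains f where "sq_integrable f" "u = l2_class f"
  using sq_integrable_rep[of u] l2_class_rep[of u] by metis

lemma l2_class_zero: "l2_class (\<lambda>x. 0) = 0"
  by (simp add: zero_l2_def)

lemma l2_class_add:
  "sq_integrable f \<Longrightarrow> sq_integrable g \<Longrightarrow> l2_class (\<lambda>x. f x + g x) = l2_class f + l2_class g"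
  by (simp add: plus_l2.abs_eq l2_eq_refl)

lemma l2_class_diff:
  "sq_integrable f \<Longrightarrow> sq_integrable g \<Longrightarrow> l2_class (\<lambda>x. f x - g x) = l2_class f - l2_class g"
  by (simp add: minus_l2.abs_eq l2_eq_refl)

lemma l2_class_scaleR: "sq_integrable f \<Longrightarrow> l2_class (\<lambda>x. c *\<^sub>R f x) = c *\<^sub>R l2_class f"
  by (simp add: scaleR_l2.abs_eq l2_eq_refl)

lemma inner_l2_class:
  "sq_integrable f \<Longrightarrow> sq_integrable g \<Longrightarrow> l2_class f \<bullet> l2_class g = (\<integral>x. f x \<bullet> g x \<partial>lborel)"
  by (simp add: inner_l2.abs_eq l2_eq_refl)

lemma norm_l2_class_sq:
  assumes "sq_integrable f"
  shows "(norm (l2_class f))\<^sup>2 = (\<integral>x. (norm (f x))\<^sup>2 \<partial>lborel)"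
  using inner_l2_class[OF assms assms] by (simp add: power2_norm_eq_inner)

lemma nn_integral_l2_class:
  assumes "sq_integrable f"
  shows "(\<integral>\<^sup>+x. ennreal ((norm (f x))\<^sup>2) \<partial>lborel) = ennreal ((norm (l2_class f))\<^sup>2)"
  using assms unfolding norm_l2_class_sq[OF assms]
  by (intro nn_integral_eq_integral) (auto simp: sq_integrable_def)

lemma sq_integrable_imp_borel: "sq_integrable f \<Longrightarrow> f \<in> borel_measurable borel"
  by (simp add: sq_integrable_def)

instance l2 :: (euclidean_space, euclidean_space) banach
proof
  fix X :: "nat \<Rightarrow> ('a, 'b) l2"
  assume "Cauchy X"
  define f where "f = (\<lambda>n. rep_l2 (X n))"
  have sq: "sq_integrable (f n)" for n by (simp add: f_def sq_integrable_rep)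
  have [measurable]: "f n \<in> borel_measurable borel" for n
    using sq by (rule sq_integrable_imp_borel)
  have cls: "l2_class (f n) = X n" for n by (simp add: f_def)
  have nnd: "(\<integral>\<^sup>+x. ennreal ((norm (f m x - f n x))\<^sup>2) \<partial>lborel) = ennreal ((norm (X m - X n))\<^sup>2)" for m n
    using nn_integral_l2_class[OF sq_integrable_diff[OF sq sq], of m n] l2_class_diff[OF sq sq, of m n] cls
    by simp
  have "\<exists>N. \<forall>m\<ge>N. \<forall>n\<ge>N. norm (X m - X n) < (1/2) ^ k" for k
    using \<open>Cauchy X\<close> unfolding Cauchy_iff by (meson zero_less_divide_1_iff zero_less_numeral zero_less_power)
  then obtain N where N: "\<And>k m n. m \<ge> N k \<Longrightarrow> n \<ge> N k \<Longrightarrow> norm (X m - X n) < (1/2) ^ k"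
    by metis
  define r where "r = (\<lambda>k. (\<Sum>j\<le>k. N j) + k)"
  have rN: "N k \<le> r k" for k
    unfolding r_def by (rule trans_le_add1) (auto intro!: member_le_sum)
  have rS: "r k \<le> r (Suc k)" for k by (simp add: r_def)
  have rk: "k \<le> r k" for k by (simp add: r_def)
  have step: "norm (X (r (Suc k)) - X (r k)) \<le> (1/2) ^ k" for k
    using N[of k "r (Suc k)" "r k"] rN[of k] rS[of k] by simp
  define a where "a = (\<lambda>k x. (norm (f (r (Suc k)) x - f (r k) x))\<^sup>2)"
  have "(\<integral>\<^sup>+x. (\<Sum>k. ennreal (2 ^ k * a k x)) \<partial>lborel) = (\<Sum>k. \<integral>\<^sup>+x. ennreal (2 ^ k * a k x) \<partial>lborel)"
    by (rule nn_integral_suminf) (simp add: a_def)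
  also have "\<dots> = (\<Sum>k. ennreal (2 ^ k * (norm (X (r (Suc k)) - X (r k)))\<^sup>2))"
    by (simp add: a_def ennreal_mult nn_integral_cmult nnd)
  also have "\<dots> \<le> (\<Sum>k. ennreal ((1/2) ^ k))"
  proof (intro suminf_le ennreal_leI)
    fix k
    have "(norm (X (r (Suc k)) - X (r k)))\<^sup>2 \<le> ((1/2) ^ k)\<^sup>2"
      by (intro power_mono step) simp
    then have "2 ^ k * (norm (X (r (Suc k)) - X (r k)))\<^sup>2 \<le> 2 ^ k * ((1/2) ^ k)\<^sup>2"
      by simp
    also have "\<dots> = (1/2) ^ k"
      by (simp add: power2_eq_square power_divide)
    finally show "2 ^ k * (norm (X (r (Suc k)) - X (r k)))\<^sup>2 \<le> (1/2) ^ k" .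
  qed auto
  also have "\<dots> < \<infinity>"
    by (subst suminf_ennreal2) (auto intro!: summable_geometric)
  finally have "(\<integral>\<^sup>+x. (\<Sum>k. ennreal (2 ^ k * a k x)) \<partial>lborel) \<noteq> \<infinity>" by simp
  then have "AE x in lborel. (\<Sum>k. ennreal (2 ^ k * a k x)) \<noteq> \<infinity>"
    by (intro nn_integral_noteq_infinite) (auto simp: a_def)
  then have conv: "AE x in lborel. convergent (\<lambda>k. f (r k) x)"
  proof eventually_elim
    fix x assume "(\<Sum>k. ennreal (2 ^ k * a k x)) \<noteq> \<infinity>"
    then have "summable (\<lambda>k. 2 ^ k * a k x)"
      by (intro summable_suminf_not_top) (auto simp: a_def)
    then have "(\<lambda>k. 2 ^ k * a k x) \<longlonglongrightarrow> 0" by (rule summable_LIMSEQ_zero)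
    then have "Bseq (\<lambda>k. 2 ^ k * a k x)" by (simp add: convergent_imp_Bseq convergentI)
    then obtain K where K0: "0 < K" "\<forall>k. norm (2 ^ k * a k x) \<le> K"
      by (rule BseqE)
    have K: "2 ^ k * a k x \<le> K" for k
      using order_trans[OF abs_ge_self K0(2)[rule_format, of k, unfolded real_norm_def]] .
    have bd: "norm (f (r (Suc k)) x - f (r k) x) \<le> sqrt K * (1 / sqrt 2) ^ k" for k
    proof -
      have "(norm (f (r (Suc k)) x - f (r k) x))\<^sup>2 \<le> K / 2 ^ k"
        using K[of k] by (simp add: a_def field_simps)
      then have "norm (f (r (Suc k)) x - f (r k) x) \<le> sqrt (K / 2 ^ k)"
        by (rule real_le_rsqrt)
      also have "\<dots> = sqrt K * (1 / sqrt 2) ^ k"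
        by (simp add: real_sqrt_divide real_sqrt_power power_divide)
      finally show ?thesis .
    qed
    have "summable (\<lambda>k. f (r (Suc k)) x - f (r k) x)"
      by (rule summable_comparison_test'[where N = 0 and g = "\<lambda>k. sqrt K * (1 / sqrt 2) ^ k"])
         (auto intro!: summable_mult summable_geometric bd)
    then have "convergent (\<lambda>n. \<Sum>k<n. f (r (Suc k)) x - f (r k) x)"
      by (simp add: summable_iff_convergent)
    moreover have "(\<Sum>k<n. f (r (Suc k)) x - f (r k) x) = f (r n) x - f (r 0) x" for n
      by (rule sum_lessThan_telescope[where f = "\<lambda>k. f (r k) x"])
    ultimately have "convergent (\<lambda>n. f (r n) x - f (r 0) x)" by simp
    then have "convergent (\<lambda>n. (f (r n) x - f (r 0) x) + f (r 0) x)"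
      by (intro convergent_add convergent_const)
    then show "convergent (\<lambda>k. f (r k) x)" by simp
  qed
  define g where "g = (\<lambda>x. if convergent (\<lambda>k. f (r k) x) then lim (\<lambda>k. f (r k) x) else 0)"
  have [measurable]: "g \<in> borel_measurable borel"
  proof -
    have [measurable]: "Measurable.pred borel (\<lambda>x. convergent (\<lambda>k. f (r k) x))"
      unfolding Cauchy_convergent_iff[symmetric] by measurable
    show ?thesis
    proof (rule borel_measurable_LIMSEQ_metric)
      show "(\<lambda>x. if convergent (\<lambda>k. f (r k) x) then f (r k) x else 0) \<in> borel_measurable borel" for k
        by measurable
      show "(\<lambda>k. if convergent (\<lambda>k. f (r k) x) then f (r k) x else 0) \<longlonglongrightarrow> g x" for x
        by (auto simp: g_def convergent_LIMSEQ_iff)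
    qed
  qed
  have lim: "AE x in lborel. (\<lambda>k. f (r k) x) \<longlonglongrightarrow> g x"
    using conv by eventually_elim (simp add: g_def convergent_LIMSEQ_iff)
  have fatou: "(\<integral>\<^sup>+x. ennreal ((norm (g x - f n x))\<^sup>2) \<partial>lborel) \<le> ennreal (((1/2) ^ k)\<^sup>2)"
    if "n \<ge> N k" for n k
  proof -
    have "(\<integral>\<^sup>+x. ennreal ((norm (g x - f n x))\<^sup>2) \<partial>lborel)
        = (\<integral>\<^sup>+x. liminf (\<lambda>j. ennreal ((norm (f (r j) x - f n x))\<^sup>2)) \<partial>lborel)"
    proof (rule nn_integral_cong_AE)
      show "AE x in lborel. ennreal ((norm (g x - f n x))\<^sup>2)
          = liminf (\<lambda>j. ennreal ((norm (f (r j) x - f n x))\<^sup>2))"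
        using lim
      proof eventually_elim
        fix x assume "(\<lambda>k. f (r k) x) \<longlonglongrightarrow> g x"
        then have "(\<lambda>j. ennreal ((norm (f (r j) x - f n x))\<^sup>2)) \<longlonglongrightarrow> ennreal ((norm (g x - f n x))\<^sup>2)"
          by (intro tendsto_ennrealI tendsto_intros)
        then show "ennreal ((norm (g x - f n x))\<^sup>2) = liminf (\<lambda>j. ennreal ((norm (f (r j) x - f n x))\<^sup>2))"
          by (intro lim_imp_Liminf[symmetric]) auto
      qed
    qed
    also have "\<dots> \<le> liminf (\<lambda>j. \<integral>\<^sup>+x. ennreal ((norm (f (r j) x - f n x))\<^sup>2) \<partial>lborel)"
      by (rule nn_integral_liminf) simp
    also have "\<dots> = liminf (\<lambda>j. ennreal ((norm (X (r j) - X n))\<^sup>2))"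
      by (simp only: nnd)
    also have "\<dots> \<le> ennreal (((1/2) ^ k)\<^sup>2)"
    proof -
      have "\<forall>\<^sub>F j in sequentially. ennreal ((norm (X (r j) - X n))\<^sup>2) \<le> ennreal (((1/2) ^ k)\<^sup>2)"
        using eventually_ge_at_top[of "N k"]
      proof eventually_elim
        fix j assume "N k \<le> j"
        then have "N k \<le> r j" using rk[of j] by simp
        then show "ennreal ((norm (X (r j) - X n))\<^sup>2) \<le> ennreal (((1/2) ^ k)\<^sup>2)"
          using N[of k "r j" n] that by (intro ennreal_leI power_mono) auto
      qed
      from Liminf_mono[OF this] show ?thesis by (simp add: Liminf_const)
    qed
    finally show ?thesis .
  qed
  have sqd: "sq_integrable (\<lambda>x. g x - f n x)" if "n \<ge> N k" for n k
    unfolding sq_integrable_def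
  proof
    show "integrable lborel (\<lambda>x. (norm (g x - f n x))\<^sup>2)"
      using fatou[OF that] by (intro integrableI_nonneg) (auto simp: le_less_trans)
  qed simp
  have sqg: "sq_integrable g"
    using sq_integrable_add[OF sqd[OF order_refl] sq, of 0 "N 0"] by simp
  have "X \<longlonglongrightarrow> l2_class g"
  proof (rule LIMSEQ_I)
    fix e :: real assume "0 < e"
    then obtain k where k: "(1/2::real) ^ k < e"
      using real_arch_pow_inv[of e "1/2"] by auto
    show "\<exists>no. \<forall>n\<ge>no. norm (X n - l2_class g) < e"
    proof (intro exI allI impI)
      fix n assume n: "N k \<le> n"
      have "ennreal ((norm (l2_class g - X n))\<^sup>2) \<le> ennreal (((1/2) ^ k)\<^sup>2)"
        using fatou[OF n] nn_integral_l2_class[OF sqd[OF n]] l2_class_diff[OF sqg sq, of n] cls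
        by simp
      then have "(norm (l2_class g - X n))\<^sup>2 \<le> ((1/2) ^ k)\<^sup>2"
        by simp
      then have "norm (l2_class g - X n) \<le> (1/2) ^ k"
        by (rule power2_le_imp_le) simp
      with k show "norm (X n - l2_class g) < e" by (simp add: norm_minus_commute)
    qed
  qed
  then show "convergent X" by (rule convergentI)
qed

lemma countable_subbasis_of_dense:
  fixes D :: "'a::metric_space set"
  assumes "countable D" "closure D = UNIV"
  shows "\<exists>B::'a set set. countable B \<and> open = generate_topology B"
proof -
  define B where "B = (\<lambda>(d, n). ball d (1 / real (Suc n))) ` (D \<times> (UNIV :: nat set))"
  have "countable B" unfolding B_def using assms(1) by auto
  moreover have "topological_basis B"
  proof (rule topological_basisI)
    show "open U" if "U \<in> B" for U using that by (auto simp: B_def)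
    fix O' :: "'a set" and x assume O: "open O'" "x \<in> O'"
    then obtain e where e: "0 < e" "ball x e \<subseteq> O'" by (auto simp: open_contains_ball)
    obtain n where n: "1 / real (Suc n) < e / 2"
      using nat_approx_posE[of "e / 2"] e(1) by auto
    have "x \<in> closure D" using assms(2) by simp
    then obtain d where d: "d \<in> D" "dist d x < 1 / real (Suc n)"
      using closure_approachable[of x D] by (metis of_nat_0_less_iff zero_less_Suc zero_less_divide_1_iff)
    have "ball d (1 / real (Suc n)) \<subseteq> ball x e"
    proof
      fix y assume "y \<in> ball d (1 / real (Suc n))"
      then have "dist d y < 1 / real (Suc n)" by simp
      with d(2) n dist_triangle[of x y d] show "y \<in> ball x e" by (simp add: dist_commute)
    qed
    with d e show "\<exists>B'\<in>B. x \<in> B' \<and> B' \<subseteq> O'"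
      by (intro bexI[of _ "ball d (1 / real (Suc n))"]) (auto simp: B_def dist_commute)
  qed
  ultimately show ?thesis using topological_basis_imp_subbasis by blast
qed

lemma span_subset_closure_rat_combinations:
  fixes C :: "'a::real_normed_vector set"
  shows "span C \<subseteq> closure ((\<lambda>l. sum_list (map (\<lambda>(q, c). of_rat q *\<^sub>R c) l)) ` lists (UNIV \<times> C))"
    (is "_ \<subseteq> closure ?D")
proof
  fix x assume "x \<in> span C"
  then show "x \<in> closure ?D"
  proof (induction rule: span_induct_alt)
    case base
    have "0 \<in> ?D" by (rule image_eqI[of _ _ "[]"]) auto
    then show ?case by (rule subsetD[OF closure_subset])
  next
    case (step c a y)
    show ?case unfolding closure_approachable
    proof (intro allI impI)
      fix e :: real assume "0 < e"
      obtain d where d: "d \<in> ?D" "dist d y < e / 2"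
        using step.IH \<open>0 < e\<close> unfolding closure_approachable by (meson half_gt_zero)
      then obtain l where l: "l \<in> lists (UNIV \<times> C)" "d = sum_list (map (\<lambda>(q, c). of_rat q *\<^sub>R c) l)"
        by auto
      define \<delta> where "\<delta> = e / (2 * (norm a + 1))"
      have "0 < \<delta>" using \<open>0 < e\<close> by (auto simp: \<delta>_def intro!: divide_pos_pos add_nonneg_pos)
      then obtain q where q: "c < of_rat q" "of_rat q < c + \<delta>"
        using of_rat_dense[of c "c + \<delta>"] by auto
      have "\<bar>of_rat q - c\<bar> * norm a \<le> \<delta> * (norm a + 1)"
        using q by (intro mult_mono) auto
      also have "\<dots> = e / 2"
        using add_nonneg_pos[OF norm_ge_zero[of a] zero_less_one] by (simp add: \<delta>_def field_simps)
      finally have "norm ((of_rat q - c) *\<^sub>R a) \<le> e / 2" by simp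
      moreover have "norm (d - y) < e / 2" using d(2) by (simp add: dist_norm)
      moreover have "dist (of_rat q *\<^sub>R a + d) (c *\<^sub>R a + y) \<le> norm ((of_rat q - c) *\<^sub>R a) + norm (d - y)"
        unfolding dist_norm
        by (rule order_trans[OF eq_refl norm_triangle_ineq]) (simp add: algebra_simps)
      ultimately have "dist (of_rat q *\<^sub>R a + d) (c *\<^sub>R a + y) < e" by linarith
      moreover have "of_rat q *\<^sub>R a + d \<in> ?D"
        using l step.hyps by (intro image_eqI[of _ _ "(q, a) # l"]) auto
      ultimately show "\<exists>y'\<in>?D. dist y' (c *\<^sub>R a + y) < e" by blast
    qed
  qed
qed

lemma sq_integrable_indicator:
  fixes y :: "'b::euclidean_space" and A :: "'a::euclidean_space set"
  assumes "A \<in> sets borel" "bounded A"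
  shows "sq_integrable (\<lambda>x. indicator A x *\<^sub>R y)"
  unfolding sq_integrable_def
proof
  have "emeasure lborel A < \<infinity>" using emeasure_bounded_finite[OF assms(2)] .
  then have "integrable lborel (\<lambda>x. indicator A x *\<^sub>R (norm y)\<^sup>2 :: real)"
    using assms by (intro integrable_scaleR_left integrable_real_indicator) auto
  moreover have "(norm (indicator A x *\<^sub>R y))\<^sup>2 = indicator A x *\<^sub>R (norm y)\<^sup>2" for x
    by (simp add: indicator_def)
  ultimately show "integrable lborel (\<lambda>x. (norm (indicator A x *\<^sub>R y))\<^sup>2)" by simp
  show "(\<lambda>x. indicator A x *\<^sub>R y) \<in> borel_measurable lborel" using assms by simp
qed

lemma l2_class_tendsto:
  assumes "\<And>n. sq_integrable (f n)" "sq_integrable g"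
    and "(\<lambda>n. \<integral>x. (norm (f n x - g x))\<^sup>2 \<partial>lborel) \<longlonglongrightarrow> 0"
  shows "(\<lambda>n. l2_class (f n)) \<longlonglongrightarrow> l2_class g"
proof -
  have "(\<integral>x. (norm (f n x - g x))\<^sup>2 \<partial>lborel) = (norm (l2_class (f n) - l2_class g))\<^sup>2" for n
    using norm_l2_class_sq[OF sq_integrable_diff[OF assms(1,2)], of n] l2_class_diff[OF assms(1,2), of n]
    by simp
  with assms(3) have "(\<lambda>n. (norm (l2_class (f n) - l2_class g))\<^sup>2) \<longlonglongrightarrow> 0" by simp
  then have "(\<lambda>n. sqrt ((norm (l2_class (f n) - l2_class g))\<^sup>2)) \<longlonglongrightarrow> sqrt 0"
    by (rule tendsto_real_sqrt)
  then have "(\<lambda>n. norm (l2_class (f n) - l2_class g)) \<longlonglongrightarrow> 0" by simp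
  then show ?thesis by (simp add: tendsto_norm_zero_iff LIM_zero_iff)
qed

lemma l2_class_dominated_tendsto:
  fixes f :: "nat \<Rightarrow> 'a::euclidean_space \<Rightarrow> 'b::euclidean_space"
  assumes [measurable]: "\<And>n. f n \<in> borel_measurable borel" and "sq_integrable h"
    and bd: "\<And>n x. norm (f n x) \<le> c * norm (h x :: 'c::euclidean_space)"
    and lim: "\<And>x. (\<lambda>n. f n x) \<longlonglongrightarrow> g x"
  shows "\<And>n. sq_integrable (f n)" "sq_integrable g" "(\<lambda>n. l2_class (f n)) \<longlonglongrightarrow> l2_class g"
proof -
  have [measurable]: "g \<in> borel_measurable borel"
    by (rule borel_measurable_LIMSEQ_metric[OF assms(1) lim])
  have inth: "integrable lborel (\<lambda>x. c\<^sup>2 * (norm (h x))\<^sup>2)" "integrable lborel (\<lambda>x. 4 * (c\<^sup>2 * (norm (h x))\<^sup>2))"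
    using \<open>sq_integrable h\<close> by (auto simp: sq_integrable_def)
  have bd2: "(norm (f n x))\<^sup>2 \<le> c\<^sup>2 * (norm (h x))\<^sup>2" for n x
    using power_mono[OF bd[of n x], of 2] by (simp add: power_mult_distrib)
  have bg: "(norm (g x))\<^sup>2 \<le> c\<^sup>2 * (norm (h x))\<^sup>2" for x
    using lim[of x] by (intro LIMSEQ_le_const2[of "\<lambda>n. (norm (f n x))\<^sup>2"] tendsto_intros)
      (use bd2 in auto)
  show f: "sq_integrable (f n)" for n
    by (rule sq_integrable_dominated[OF _ inth(1) bd2]) simp
  show g: "sq_integrable g"
    by (rule sq_integrable_dominated[OF _ inth(1) bg]) simp
  have "(\<lambda>n. \<integral>x. (norm (f n x - g x))\<^sup>2 \<partial>lborel) \<longlonglongrightarrow> (\<integral>(x::'a). 0 \<partial>lborel)"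
  proof (rule integral_dominated_convergence[where w = "\<lambda>x. 4 * (c\<^sup>2 * (norm (h x))\<^sup>2)"])
    have "(\<lambda>n. (norm (f n x - g x))\<^sup>2) \<longlonglongrightarrow> (norm (g x - g x))\<^sup>2" for x
      by (intro tendsto_intros lim)
    then show "AE x in lborel. (\<lambda>n. (norm (f n x - g x))\<^sup>2) \<longlonglongrightarrow> 0"
      by simp
    have "(norm (f n x - g x))\<^sup>2 \<le> 4 * (c\<^sup>2 * (norm (h x))\<^sup>2)" for n x
      using norm_add_sq_le[of "f n x" "- g x"] bd2[of n x] bg[of x] by simp
    then show "AE x in lborel. norm ((norm (f n x - g x))\<^sup>2) \<le> 4 * (c\<^sup>2 * (norm (h x))\<^sup>2)" for n
      by simp
  qed (use inth in simp_all)
  then show "(\<lambda>n. l2_class (f n)) \<longlonglongrightarrow> l2_class g"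
    by (intro l2_class_tendsto f g) simp
qed

lemma l2_class_sum:
  assumes "\<And>i. i \<in> I \<Longrightarrow> sq_integrable (f i)"
  shows "sq_integrable (\<lambda>x. \<Sum>i\<in>I. f i x) \<and> l2_class (\<lambda>x. \<Sum>i\<in>I. f i x) = (\<Sum>i\<in>I. l2_class (f i))"
  using assms
  by (induction I rule: infinite_finite_induct) (auto simp: l2_class_zero l2_class_add sq_integrable_add)

lemma subspace_closure_normed:
  fixes S :: "'a::real_normed_vector set"
  assumes "subspace S"
  shows "subspace (closure S)"
  unfolding subspace_def
proof (intro conjI ballI allI)
  show "0 \<in> closure S" using subspace_0[OF assms] closure_subset by blast
next
  fix x y assume "x \<in> closure S" "y \<in> closure S"
  then obtain a b where "\<And>n. a n \<in> S" "a \<longlonglongrightarrow> x" "\<And>n. b n \<in> S" "b \<longlonglongrightarrow> y"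
    unfolding closure_sequential by metis
  then show "x + y \<in> closure S" unfolding closure_sequential
    by (intro exI[of _ "\<lambda>n. a n + b n"]) (auto intro: subspace_add[OF assms] tendsto_add)
next
  fix c x assume "x \<in> closure S"
  then obtain a where "\<And>n. a n \<in> S" "a \<longlonglongrightarrow> x"
    unfolding closure_sequential by metis
  then show "c *\<^sub>R x \<in> closure S" unfolding closure_sequential
    by (intro exI[of _ "\<lambda>n. c *\<^sub>R a n"]) (auto intro: subspace_scale[OF assms] tendsto_scaleR)
qed

lemma l2_separable: "\<exists>D :: ('a::euclidean_space, 'b::euclidean_space) l2 set. countable D \<and> closure D = UNIV"
proof -
  obtain B :: "'a set set" where B: "countable B" "topological_basis B"
    using ex_countable_basis by blast
  define G where "G = (\<lambda>F. \<Inter>F) ` {F. finite F \<and> F \<subseteq> B}"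
  have cG: "countable G" unfolding G_def using B(1) by (auto intro: countable_Collect_finite_subset)
  have oB: "open U" if "U \<in> B" for U using that B(2) by (rule topological_basis_open[rotated])
  have oG: "open U" if "U \<in> G" for U using that oB by (auto simp: G_def)
  have BG: "B \<subseteq> G" by (auto simp: G_def intro!: image_eqI[of _ _ "{_}"])
  have "topological_basis G"
    using B(2) BG oG unfolding topological_basis_def by (meson subset_trans)
  then have borelG: "(borel :: 'a measure) = sigma UNIV G"
    using borel_eq_countable_basis[OF cG] by blast
  have ISG: "Int_stable G"
  proof (rule Int_stableI)
    fix a b assume "a \<in> G" "b \<in> G"
    then obtain F F' where "finite F" "F \<subseteq> B" "a = \<Inter>F" "finite F'" "F' \<subseteq> B" "b = \<Inter>F'"
      by (auto simp: G_def)
    then show "a \<inter> b \<in> G" unfolding G_def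
      by (intro image_eqI[of _ _ "F \<union> F'"]) auto
  qed
  have UG: "UNIV \<in> G" unfolding G_def by (intro image_eqI[of _ _ "{}"]) auto
  define C :: "('a, 'b) l2 set" where
    "C = (\<lambda>(S, n, e). l2_class (\<lambda>x. indicator (S \<inter> ball 0 (real n)) x *\<^sub>R e)) ` (G \<times> (UNIV :: nat set) \<times> Basis)"
  have cC: "countable C"
    unfolding C_def by (intro countable_image countable_SIGMA cG countable_finite[OF finite_Basis]) auto
  define D where "D = (\<lambda>l. sum_list (map (\<lambda>(q, c). of_rat q *\<^sub>R c) l)) ` lists ((UNIV :: rat set) \<times> C)"
  have cD: "countable D"
    unfolding D_def by (intro countable_image countable_lists countable_SIGMA cC) auto
  define M where "M = closure (span C)"
  have MD: "M \<subseteq> closure D"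
    unfolding M_def D_def
    using closure_mono[OF span_subset_closure_rat_combinations[of C]] by (simp only: closure_closure)
  have Msub: "subspace M" unfolding M_def by (intro subspace_closure_normed subspace_span)
  have Mclosed: "closed M" by (simp add: M_def)
  have CM: "C \<subseteq> M" unfolding M_def using span_superset closure_subset by blast

  have ind: "l2_class (\<lambda>x. indicator (A \<inter> ball 0 (real n)) x *\<^sub>R e) \<in> M"
    if "A \<in> sets borel" "e \<in> Basis" for A :: "'a set" and n and e :: 'b
  proof -
    have sq: "sq_integrable (\<lambda>x. indicator (A' \<inter> ball 0 (real n)) x *\<^sub>R e)" if "A' \<in> sets borel" for A' :: "'a set"
      using that by (intro sq_integrable_indicator) (auto intro: bounded_Int)
    have sG: "sigma_sets UNIV G = sets borel" by (simp add: borelG)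
    have "A \<in> sigma_sets UNIV G" using that(1) by (simp add: sG)
    have GP: "G \<subseteq> Pow UNIV" by simp
    from ISG GP \<open>A \<in> sigma_sets UNIV G\<close> show ?thesis
    proof (induction rule: sigma_sets_induct_disjoint)
      case (basic A)
      then show ?case using \<open>e \<in> Basis\<close> by (intro subsetD[OF CM]) (force simp: C_def)
    next
      case empty
      show ?case using subspace_0[OF Msub] by (simp add: l2_class_zero)
    next
      case (compl A)
      then have [measurable]: "A \<in> sets borel" by (simp add: sG)
      have "(\<lambda>x. indicator ((UNIV - A) \<inter> ball 0 (real n)) x *\<^sub>R e)
          = (\<lambda>x. indicator (UNIV \<inter> ball 0 (real n)) x *\<^sub>R e - indicator (A \<inter> ball 0 (real n)) x *\<^sub>R e)"
        by (auto simp: fun_eq_iff indicator_def)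
      then have "l2_class (\<lambda>x. indicator ((UNIV - A) \<inter> ball 0 (real n)) x *\<^sub>R e)
          = l2_class (\<lambda>x. indicator (UNIV \<inter> ball 0 (real n)) x *\<^sub>R e)
            - l2_class (\<lambda>x. indicator (A \<inter> ball 0 (real n)) x *\<^sub>R e)"
        using sq[of UNIV] sq[of A] by (simp add: l2_class_diff)
      moreover have "l2_class (\<lambda>x. indicator (UNIV \<inter> ball 0 (real n)) x *\<^sub>R e) \<in> M"
        using \<open>e \<in> Basis\<close> UG by (intro subsetD[OF CM]) (force simp: C_def)
      ultimately show ?case using compl by (simp add: subspace_diff[OF Msub])
    next
      case (union A)
      then have A[measurable]: "A i \<in> sets borel" for i by (auto simp: sG)
      define S where "S k = (\<Union>i<k. A i)" for k
      have [measurable]: "S k \<in> sets borel" for k by (auto simp: S_def)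
      have Seq: "indicator (S k \<inter> ball 0 (real n)) x *\<^sub>R e
          = (\<Sum>i<k. indicator (A i \<inter> ball 0 (real n)) x *\<^sub>R e)" for k x
      proof -
        have "disjoint_family_on A {..<k}" using union(1) by (rule disjoint_family_on_mono[rotated]) simp
        then have "indicator (S k) x = (\<Sum>i<k. indicator (A i) x :: real)"
          unfolding S_def by (intro indicator_UN_disjoint) auto
        then show ?thesis by (simp add: indicator_inter_arith scaleR_sum_left[symmetric] sum_distrib_right)
      qed
      have "l2_class (\<lambda>x. indicator (S k \<inter> ball 0 (real n)) x *\<^sub>R e) \<in> M" for k
      proof -
        have "l2_class (\<lambda>x. indicator (S k \<inter> ball 0 (real n)) x *\<^sub>R e)
            = (\<Sum>i<k. l2_class (\<lambda>x. indicator (A i \<inter> ball 0 (real n)) x *\<^sub>R e))"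
          unfolding Seq by (rule conjunct2[OF l2_class_sum]) (rule sq[OF A])
        then show ?thesis by (simp only:) (intro subspace_sum[OF Msub] union(3))
      qed
      moreover have "(\<lambda>k. l2_class (\<lambda>x. indicator (S k \<inter> ball 0 (real n)) x *\<^sub>R e))
          \<longlonglongrightarrow> l2_class (\<lambda>x. indicator ((\<Union>i. A i) \<inter> ball 0 (real n)) x *\<^sub>R e)"
      proof (rule l2_class_dominated_tendsto(3)[where c = 1, OF _ sq[of UNIV]])
        show "(\<lambda>k. indicator (S k \<inter> ball 0 (real n)) x *\<^sub>R e)
            \<longlonglongrightarrow> indicator ((\<Union>i. A i) \<inter> ball 0 (real n)) x *\<^sub>R e" for x
        proof -
          have "(\<lambda>k. indicator (S k) x :: real) \<longlonglongrightarrow> indicator (\<Union>i. A i) x"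
            unfolding S_def by (rule LIMSEQ_indicator_UN)
          then show ?thesis unfolding indicator_inter_arith by (intro tendsto_intros)
        qed
      qed (auto simp: indicator_def)
      ultimately show ?case
        by (rule closed_sequentially[OF Mclosed])
    qed
  qed

  have indy: "l2_class (\<lambda>x. indicator (A \<inter> ball 0 (real n)) x *\<^sub>R y) \<in> M"
    if A: "A \<in> sets borel" for A :: "'a set" and n and y :: 'b
  proof -
    have sq: "sq_integrable (\<lambda>x. indicator (A \<inter> ball 0 (real n)) x *\<^sub>R e)" for e :: 'b
      using that by (intro sq_integrable_indicator) (auto intro: bounded_Int)
    have "(\<lambda>x. indicator (A \<inter> ball 0 (real n)) x *\<^sub>R y)
        = (\<lambda>x. \<Sum>e\<in>Basis. (y \<bullet> e) *\<^sub>R (indicator (A \<inter> ball 0 (real n)) x *\<^sub>R e))"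
    proof
      fix x
      have "indicator (A \<inter> ball 0 (real n)) x *\<^sub>R y
          = indicator (A \<inter> ball 0 (real n)) x *\<^sub>R (\<Sum>e\<in>Basis. (y \<bullet> e) *\<^sub>R e)"
        by (simp add: euclidean_representation)
      then show "indicator (A \<inter> ball 0 (real n)) x *\<^sub>R y
          = (\<Sum>e\<in>Basis. (y \<bullet> e) *\<^sub>R (indicator (A \<inter> ball 0 (real n)) x *\<^sub>R e))"
        by (simp add: scaleR_sum_right mult.commute)
    qed
    moreover have "l2_class (\<lambda>x. \<Sum>e\<in>Basis. (y \<bullet> e) *\<^sub>R (indicator (A \<inter> ball 0 (real n)) x *\<^sub>R e))
        = (\<Sum>e\<in>Basis. l2_class (\<lambda>x. (y \<bullet> e) *\<^sub>R (indicator (A \<inter> ball 0 (real n)) x *\<^sub>R e)))"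
      by (rule conjunct2[OF l2_class_sum]) (rule sq_integrable_scaleR[OF sq])
    moreover have "l2_class (\<lambda>x. (y \<bullet> e) *\<^sub>R (indicator (A \<inter> ball 0 (real n)) x *\<^sub>R e)) \<in> M"
      if "e \<in> Basis" for e
      unfolding l2_class_scaleR[OF sq] by (intro subspace_scale[OF Msub] ind A that)
    ultimately show ?thesis by (simp only:) (intro subspace_sum[OF Msub])
  qed

  have "u \<in> M" for u :: "('a, 'b) l2"
  proof -
    obtain f where f: "sq_integrable f" "u = l2_class f" by (rule l2_class_cases)
    have fm: "f \<in> borel_measurable borel" using f(1) by (rule sq_integrable_imp_borel)
    obtain s :: "nat \<Rightarrow> 'a \<Rightarrow> 'b" where s: "\<And>i. simple_function borel (s i)"
        "\<And>x. (\<lambda>i. s i x) \<longlonglongrightarrow> f x" "\<And>i x. dist (s i x) 0 \<le> 2 * dist (f x) 0"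
      using borel_measurable_implies_sequence_metric[OF fm, of 0] by auto
    have sm[measurable]: "s i \<in> borel_measurable borel" for i
      using s(1) by (rule borel_measurable_simple_function)
    define t where "t i x = indicator (ball 0 (real i)) x *\<^sub>R s i x" for i x
    have "l2_class (t i) \<in> M" for i
    proof -
      have fin: "finite (range (s i))" using simple_functionD(1)[OF s(1)[of i]] by simp
      have "t i = (\<lambda>x. \<Sum>y\<in>range (s i). indicator (s i -` {y} \<inter> ball 0 (real i)) x *\<^sub>R y)"
      proof
        fix x
        have "(\<Sum>y\<in>range (s i). indicator (s i -` {y} \<inter> ball 0 (real i)) x *\<^sub>R y)
            = (\<Sum>y\<in>range (s i). if y = s i x then t i x else 0)"
          by (intro sum.cong) (auto simp: t_def indicator_def)
        then show "t i x = (\<Sum>y\<in>range (s i). indicator (s i -` {y} \<inter> ball 0 (real i)) x *\<^sub>R y)"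
          using fin by simp
      qed
      moreover have mb: "s i -` {y} \<in> sets borel" for y
        using measurable_sets_borel[OF sm[of i], of "{y}"] by simp
      moreover have "l2_class (\<lambda>x. \<Sum>y\<in>range (s i). indicator (s i -` {y} \<inter> ball 0 (real i)) x *\<^sub>R y)
          = (\<Sum>y\<in>range (s i). l2_class (\<lambda>x. indicator (s i -` {y} \<inter> ball 0 (real i)) x *\<^sub>R y))"
        by (rule conjunct2[OF l2_class_sum]) (intro sq_integrable_indicator bounded_Int sets.Int mb; simp)
      ultimately show ?thesis
        by (simp only:) (intro subspace_sum[OF Msub] indy mb)
    qed
    moreover have "(\<lambda>i. l2_class (t i)) \<longlonglongrightarrow> u"
      unfolding f(2)
    proof (rule l2_class_dominated_tendsto(3)[where c = 2, OF _ f(1)])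
      show "t i \<in> borel_measurable borel" for i unfolding t_def
        by (intro borel_measurable_scaleR borel_measurable_indicator sm borel_open open_ball)
      show "norm (t i x) \<le> 2 * norm (f x)" for i x
        using s(3)[of i x] by (auto simp: t_def indicator_def)
      show "(\<lambda>i. t i x) \<longlonglongrightarrow> f x" for x
      proof (rule Lim_transform_eventually[OF s(2)])
        show "\<forall>\<^sub>F i in sequentially. s i x = t i x"
          using eventually_gt_at_top[of "nat \<lceil>norm x\<rceil>"]
        proof eventually_elim
          fix i assume "nat \<lceil>norm x\<rceil> < i"
          then have "norm x < real i" by linarith
          then show "s i x = t i x" by (simp add: t_def)
        qed
      qed
    qed
    ultimately show "u \<in> M" by (rule closed_sequentially[OF Mclosed])
  qed
  then have "closure D = UNIV" using MD by auto
  with cD show ?thesis by blast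
qed

instance l2 :: (euclidean_space, euclidean_space) second_countable_topology
proof
  show "\<exists>B :: ('a, 'b) l2 set set. countable B \<and> open = generate_topology B"
    using l2_separable countable_subbasis_of_dense by metis
qed

primrec C_k :: "nat \<Rightarrow> ('a::euclidean_space \<Rightarrow> 'b::real_normed_vector) \<Rightarrow> bool" where
  "C_k 0 f \<longleftrightarrow> continuous_on UNIV f"
| "C_k (Suc k) f \<longleftrightarrow>
     (\<forall>x. f differentiable (at x)) \<and> (\<forall>v. C_k k (\<lambda>x. frechet_derivative f (at x) v))"

definition smooth :: "('a::euclidean_space \<Rightarrow> 'b::real_normed_vector) \<Rightarrow> bool" where
  "smooth f \<longleftrightarrow> (\<forall>k. C_k k f)"

definition test_functions :: "'a::euclidean_space set \<Rightarrow> ('a \<Rightarrow> 'b::real_normed_vector) set" where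
  "test_functions \<Omega> =
     {\<phi>. smooth \<phi> \<and> compact (closure {x. \<phi> x \<noteq> 0}) \<and> closure {x. \<phi> x \<noteq> 0} \<subseteq> \<Omega>}"

type_synonym space = "real ^ 3"
type_synonym scalar_field = "(space, real) l2"
type_synonym vector_field = "(space, space) l2"
type_synonym matrix_field = "(space, real ^ 3 ^ 3) l2"

text \<open>Functions on \<open>\<Omega>\<close> are extended by zero to the whole space, so the norm and the inner
  product of \<^typ>\<open>('a, 'b) l2\<close> are those of \<open>L\<^sup>2(\<Omega>)\<close> on the following subspace.\<close>

definition L2 :: "'a::euclidean_space set \<Rightarrow> ('a, 'b::euclidean_space) l2 set" where
  "L2 \<Omega> = l2_class ` {f. sq_integrable f \<and> (\<forall>x. x \<notin> \<Omega> \<longrightarrow> f x = 0)}"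

definition l2_restrict :: "'a::euclidean_space set \<Rightarrow> ('a \<Rightarrow> 'b::euclidean_space) \<Rightarrow> ('a, 'b) l2" where
  "l2_restrict \<Omega> f = l2_class (\<lambda>x. indicator \<Omega> x *\<^sub>R f x)"

definition pd :: "3 \<Rightarrow> (space \<Rightarrow> 'b::real_normed_vector) \<Rightarrow> space \<Rightarrow> 'b" where
  "pd j \<phi> x = frechet_derivative \<phi> (at x) (axis j 1)"

definition grad_fun :: "(space \<Rightarrow> real) \<Rightarrow> space \<Rightarrow> space" where
  "grad_fun \<phi> x = (\<chi> j. pd j \<phi> x)"

definition vgrad_fun :: "(space \<Rightarrow> space) \<Rightarrow> space \<Rightarrow> real ^ 3 ^ 3" where
  "vgrad_fun \<phi> x = (\<chi> i j. pd j \<phi> x $ i)"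

definition div_fun :: "(space \<Rightarrow> space) \<Rightarrow> space \<Rightarrow> real" where
  "div_fun \<phi> x = (\<Sum>j\<in>UNIV. pd j \<phi> x $ j)"

definition row_div_fun :: "(space \<Rightarrow> real ^ 3 ^ 3) \<Rightarrow> space \<Rightarrow> space" where
  "row_div_fun \<Phi> x = (\<chi> i. div_fun (\<lambda>y. \<Phi> y $ i) x)"

definition curl_fun :: "(space \<Rightarrow> space) \<Rightarrow> space \<Rightarrow> space" where
  "curl_fun \<phi> x = vector [pd 2 \<phi> x $ 3 - pd 3 \<phi> x $ 2,
                          pd 3 \<phi> x $ 1 - pd 1 \<phi> x $ 3,
                          pd 1 \<phi> x $ 2 - pd 2 \<phi> x $ 1]"

definition is_grad :: "space set \<Rightarrow> scalar_field \<Rightarrow> vector_field \<Rightarrow> bool" where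
  "is_grad \<Omega> q g \<longleftrightarrow> q \<in> L2 \<Omega> \<and> g \<in> L2 \<Omega> \<and>
     (\<forall>\<phi>\<in>test_functions \<Omega>. g \<bullet> l2_restrict \<Omega> \<phi> = - (q \<bullet> l2_restrict \<Omega> (div_fun \<phi>)))"

definition is_vgrad :: "space set \<Rightarrow> vector_field \<Rightarrow> matrix_field \<Rightarrow> bool" where
  "is_vgrad \<Omega> v g \<longleftrightarrow> v \<in> L2 \<Omega> \<and> g \<in> L2 \<Omega> \<and>
     (\<forall>\<Phi>\<in>test_functions \<Omega>. g \<bullet> l2_restrict \<Omega> \<Phi> = - (v \<bullet> l2_restrict \<Omega> (row_div_fun \<Phi>)))"

definition is_div :: "space set \<Rightarrow> vector_field \<Rightarrow> scalar_field \<Rightarrow> bool" where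
  "is_div \<Omega> v d \<longleftrightarrow> v \<in> L2 \<Omega> \<and> d \<in> L2 \<Omega> \<and>
     (\<forall>\<phi>\<in>test_functions \<Omega>. d \<bullet> l2_restrict \<Omega> \<phi> = - (v \<bullet> l2_restrict \<Omega> (grad_fun \<phi>)))"

definition is_curl :: "space set \<Rightarrow> vector_field \<Rightarrow> vector_field \<Rightarrow> bool" where
  "is_curl \<Omega> v c \<longleftrightarrow> v \<in> L2 \<Omega> \<and> c \<in> L2 \<Omega> \<and>
     (\<forall>\<phi>\<in>test_functions \<Omega>. c \<bullet> l2_restrict \<Omega> \<phi> = v \<bullet> l2_restrict \<Omega> (curl_fun \<phi>))"

definition grad :: "space set \<Rightarrow> scalar_field \<Rightarrow> vector_field" where
  "grad \<Omega> q = (THE g. is_grad \<Omega> q g)"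

definition vgrad :: "space set \<Rightarrow> vector_field \<Rightarrow> matrix_field" where
  "vgrad \<Omega> v = (THE g. is_vgrad \<Omega> v g)"

definition wdiv :: "space set \<Rightarrow> vector_field \<Rightarrow> scalar_field" where
  "wdiv \<Omega> v = (THE d. is_div \<Omega> v d)"

definition curl :: "space set \<Rightarrow> vector_field \<Rightarrow> vector_field" where
  "curl \<Omega> v = (THE c. is_curl \<Omega> v c)"

text \<open>A Lipschitz domain lies, near each boundary point and in suitable Cartesian coordinates, below
  the graph of a Lipschitz function.  A polyhedron need not be convex: its closure is a finite union
  of convex polytopes.\<close>

definition lipschitz_boundary :: "space set \<Rightarrow> bool" where
  "lipschitz_boundary \<Omega> \<longleftrightarrow>
     (\<forall>x\<in>frontier \<Omega>. \<exists>U (Q :: space \<Rightarrow> space) (\<gamma> :: real ^ 2 \<Rightarrow> real) K.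
        open U \<and> x \<in> U \<and> orthogonal_transformation Q \<and> K-lipschitz_on UNIV \<gamma> \<and>
        \<Omega> \<inter> U = {y\<in>U. Q y $ 3 < \<gamma> (vector [Q y $ 1, Q y $ 2])})"

definition lipschitz_polyhedron :: "space set \<Rightarrow> bool" where
  "lipschitz_polyhedron \<Omega> \<longleftrightarrow>
     \<Omega> \<noteq> {} \<and> open \<Omega> \<and> bounded \<Omega> \<and> lipschitz_boundary \<Omega> \<and>
     (\<exists>\<F>. finite \<F> \<and> (\<forall>P\<in>\<F>. polytope P) \<and> closure \<Omega> = \<Union>\<F>)"

definition boundary_decomposition :: "space set \<Rightarrow> space set \<Rightarrow> space set \<Rightarrow> bool" where
  "boundary_decomposition \<Omega> \<Gamma>D \<Gamma>N \<longleftrightarrow>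
     openin (top_of_set (frontier \<Omega>)) \<Gamma>D \<and> openin (top_of_set (frontier \<Omega>)) \<Gamma>N \<and>
     \<Gamma>D \<noteq> {} \<and> \<Gamma>N \<noteq> {} \<and> \<Gamma>D \<inter> \<Gamma>N = {} \<and> frontier \<Omega> = closure \<Gamma>D \<union> closure \<Gamma>N"

text \<open>Surface measure is the two-dimensional Hausdorff measure, normalised by the area
  \<open>\<pi>/4 d\<^sup>2\<close> of a disc of diameter \<open>d\<close>.  As a metric outer measure it is countably additive on the
  Borel sets, so that \<^const>\<open>measure_of\<close> does not degenerate to the zero measure.\<close>

definition hausdorff2 :: "space set \<Rightarrow> ennreal" where
  "hausdorff2 A =
     (SUP \<delta>\<in>{0<..}. INF U\<in>{U :: nat \<Rightarrow> space set.
          A \<subseteq> (\<Union>i. U i) \<and> (\<forall>i. bounded (U i) \<and> diameter (U i) \<le> \<delta>)}.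
        \<Sum>i. ennreal (pi / 4 * (diameter (U i))\<^sup>2))"

definition surface_measure :: "space measure" where
  "surface_measure = measure_of UNIV (sets borel) hausdorff2"

definition VH1 :: "space set \<Rightarrow> vector_field set" where
  "VH1 \<Omega> = {v. \<exists>g. is_vgrad \<Omega> v g}"

definition H1_norm :: "space set \<Rightarrow> vector_field \<Rightarrow> real" where
  "H1_norm \<Omega> v = sqrt ((norm v)\<^sup>2 + (norm (vgrad \<Omega> v))\<^sup>2)"

text \<open>The trace operator \<open>H\<^sup>1(\<Omega>) \<rightarrow> L\<^sup>2(\<partial>\<Omega>)\<close> is the continuous extension of the restriction of smooth
  functions to the boundary; \<open>has_trace \<Omega> v w\<close> describes its graph.\<close>

definition has_trace :: "space set \<Rightarrow> vector_field \<Rightarrow> (space \<Rightarrow> space) \<Rightarrow> bool" where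
  "has_trace \<Omega> v w \<longleftrightarrow> v \<in> VH1 \<Omega> \<and> w \<in> borel_measurable borel \<and>
     (\<exists>\<phi> :: nat \<Rightarrow> space \<Rightarrow> space. (\<forall>n. smooth (\<phi> n)) \<and>
        (\<lambda>n. (l2_restrict \<Omega> (\<phi> n), l2_restrict \<Omega> (vgrad_fun (\<phi> n)))) \<longlonglongrightarrow> (v, vgrad \<Omega> v) \<and>
        (\<lambda>n. \<integral>\<^sup>+x\<in>frontier \<Omega>. ennreal ((norm (\<phi> n x - w x))\<^sup>2) \<partial>surface_measure) \<longlonglongrightarrow> 0)"

definition sp_U :: "space set \<Rightarrow> space set \<Rightarrow> vector_field set" where
  "sp_U \<Omega> \<Gamma>D =
     {v\<in>VH1 \<Omega>. \<exists>w. has_trace \<Omega> v w \<and> (AE x in surface_measure. x \<in> \<Gamma>D \<longrightarrow> w x = 0)}"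

text \<open>For \<open>v\<close> in \<open>H(curl)\<close> the tangential trace \<open>v \<times> n\<close> is the functional
  \<open>\<phi> \<mapsto> (v, curl \<phi>) - (curl v, \<phi>)\<close> on (the traces of) \<open>[H\<^sup>1(\<Omega>)]\<^sup>3\<close>, by Green's formula.\<close>

definition sp_E :: "space set \<Rightarrow> vector_field set" where
  "sp_E \<Omega> = {v. (\<exists>c. is_curl \<Omega> v c) \<and> (\<forall>\<phi>\<in>VH1 \<Omega>. v \<bullet> curl \<Omega> \<phi> - curl \<Omega> v \<bullet> \<phi> = 0)}"

definition sp_H :: "space set \<Rightarrow> vector_field set" where
  "sp_H \<Omega> = L2 \<Omega>"

definition sp_W :: "space set \<Rightarrow> scalar_field set" where
  "sp_W \<Omega> = L2 \<Omega>"

definition sp_P :: "space set \<Rightarrow> scalar_field set" where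
  "sp_P \<Omega> = {q. (\<exists>g. is_grad \<Omega> q g) \<and>
     (q, grad \<Omega> q) \<in> closure {(l2_restrict \<Omega> \<phi>, l2_restrict \<Omega> (grad_fun \<phi>)) |\<phi>. \<phi> \<in> test_functions \<Omega>}}"

definition inf_sup_condition :: "space set \<Rightarrow> space set \<Rightarrow> bool" where
  "inf_sup_condition \<Omega> \<Gamma>D \<longleftrightarrow>
     (\<exists>\<beta>>0. \<forall>w\<in>sp_W \<Omega>. \<beta> * norm w \<le> (SUP v\<in>sp_U \<Omega> \<Gamma>D - {0}. (wdiv \<Omega> v \<bullet> w) / H1_norm \<Omega> v))"

definition L2_time :: "real \<Rightarrow> 'h set \<Rightarrow> (real \<Rightarrow> 'h::{banach, second_countable_topology}) set" where
  "L2_time T X = {f. f \<in> borel_measurable (lebesgue_on {0<..<T}) \<and>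
     integrable (lebesgue_on {0<..<T}) (\<lambda>t. (norm (f t))\<^sup>2) \<and>
     (AE t in lebesgue_on {0<..<T}. f t \<in> X)}"

definition is_time_deriv ::
  "real \<Rightarrow> (real \<Rightarrow> 'h::{banach, second_countable_topology}) \<Rightarrow> (real \<Rightarrow> 'h) \<Rightarrow> bool" where
  "is_time_deriv T f g \<longleftrightarrow>
     (\<forall>\<phi>\<in>test_functions {0<..<T}.
        (\<integral>t. deriv \<phi> t *\<^sub>R f t \<partial>lebesgue_on {0<..<T}) = - (\<integral>t. \<phi> t *\<^sub>R g t \<partial>lebesgue_on {0<..<T}))"

text \<open>Elements of \<open>H\<^sup>1(0,T;X)\<close> are identified with their continuous representatives on \<open>[0,T]\<close>,
  which gives meaning to their values at each time and in particular to initial values.\<close>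

definition H1_time :: "real \<Rightarrow> 'h set \<Rightarrow> (real \<Rightarrow> 'h::{banach, second_countable_topology}) set" where
  "H1_time T X = {f\<in>L2_time T X. continuous_on {0..T} f \<and> (\<forall>t\<in>{0..T}. f t \<in> X) \<and>
     (\<exists>g\<in>L2_time T X. is_time_deriv T f g)}"

definition dt ::
  "real \<Rightarrow> (real \<Rightarrow> 'h::{banach, second_countable_topology}) \<Rightarrow> real \<Rightarrow> 'h" where
  "dt T f = (SOME g. g \<in> L2_time T UNIV \<and> is_time_deriv T f g)"

definition L2_time_norm :: "real \<Rightarrow> (real \<Rightarrow> 'h::{banach, second_countable_topology}) \<Rightarrow> real" where
  "L2_time_norm T f = sqrt (\<integral>t. (norm (f t))\<^sup>2 \<partial>lebesgue_on {0<..<T})"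

definition H1_time_norm :: "real \<Rightarrow> (real \<Rightarrow> 'h::{banach, second_countable_topology}) \<Rightarrow> real" where
  "H1_time_norm T f = sqrt ((L2_time_norm T f)\<^sup>2 + (L2_time_norm T (dt T f))\<^sup>2)"

text \<open>A space normed by a graph norm embeds isometrically into a product of \<open>L\<^sup>2\<close> spaces through
  \<open>v \<mapsto> (v, A v)\<close>; Bochner spaces over it are Bochner spaces over the graph.\<close>

definition H1_time_graph ::
  "real \<Rightarrow> ('h \<Rightarrow> 'k::{banach, second_countable_topology}) \<Rightarrow> 'h set \<Rightarrow>
   (real \<Rightarrow> 'h::{banach, second_countable_topology}) set" where
  "H1_time_graph T A X =
     {f. (\<lambda>t. (f t, A (f t))) \<in> H1_time T ((\<lambda>v. (v, A v)) ` X)}"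

definition regular_in_time ::
  "space set \<Rightarrow> space set \<Rightarrow> real \<Rightarrow> (real \<Rightarrow> vector_field) \<Rightarrow> (real \<Rightarrow> vector_field) \<Rightarrow>
   (real \<Rightarrow> vector_field) \<Rightarrow> (real \<Rightarrow> scalar_field) \<Rightarrow> (real \<Rightarrow> scalar_field) \<Rightarrow> bool" where
  "regular_in_time \<Omega> \<Gamma>D T E H u \<xi> p \<longleftrightarrow>
     E \<in> H1_time_graph T (curl \<Omega>) (sp_E \<Omega>) \<and>
     H \<in> H1_time T (sp_H \<Omega>) \<and>
     u \<in> H1_time_graph T (vgrad \<Omega>) (sp_U \<Omega> \<Gamma>D) \<and>
     \<xi> \<in> H1_time T (sp_W \<Omega>) \<and>
     p \<in> H1_time_graph T (grad \<Omega>) (sp_P \<Omega>)"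

definition weak_solution ::
  "space set \<Rightarrow> space set \<Rightarrow> real \<Rightarrow>
   real \<Rightarrow> real \<Rightarrow> real \<Rightarrow> real \<Rightarrow> real \<Rightarrow> real \<Rightarrow> real \<Rightarrow> real \<Rightarrow> real \<Rightarrow>
   (real \<Rightarrow> vector_field) \<Rightarrow> (real \<Rightarrow> vector_field) \<Rightarrow> (real \<Rightarrow> scalar_field) \<Rightarrow>
   (real \<Rightarrow> vector_field) \<Rightarrow> (real \<Rightarrow> vector_field) \<Rightarrow> (real \<Rightarrow> vector_field) \<Rightarrow>
   (real \<Rightarrow> scalar_field) \<Rightarrow> (real \<Rightarrow> scalar_field) \<Rightarrow>
   vector_field \<Rightarrow> vector_field \<Rightarrow> vector_field \<Rightarrow> scalar_field \<Rightarrow> scalar_field \<Rightarrow> bool" where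
  "weak_solution \<Omega> \<Gamma>D T \<epsilon> \<sigma> \<mu> G lam \<alpha> \<kappa> c0 L f h g E H u \<xi> p E0 H0 u0 \<xi>0 p0 \<longleftrightarrow>
     (AE t in lebesgue_on {0<..T}.
        E t \<in> sp_E \<Omega> \<and> H t \<in> sp_H \<Omega> \<and> u t \<in> sp_U \<Omega> \<Gamma>D \<and> \<xi> t \<in> sp_W \<Omega> \<and> p t \<in> sp_P \<Omega> \<and>
        (\<forall>D\<in>sp_E \<Omega>. \<forall>B\<in>sp_H \<Omega>. \<forall>v\<in>sp_U \<Omega> \<Gamma>D. \<forall>w\<in>sp_W \<Omega>. \<forall>q\<in>sp_P \<Omega>.
           \<epsilon> * (dt T E t \<bullet> D) + \<sigma> * (E t \<bullet> D) - H t \<bullet> curl \<Omega> D - L * (grad \<Omega> (p t) \<bullet> D) = h t \<bullet> D \<and>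
           \<mu> * (dt T H t \<bullet> B) + curl \<Omega> (E t) \<bullet> B = 0 \<and>
           G * (vgrad \<Omega> (u t) \<bullet> vgrad \<Omega> v) - \<xi> t \<bullet> wdiv \<Omega> v = f t \<bullet> v \<and>
           wdiv \<Omega> (u t) \<bullet> w + (1 / lam) * (\<xi> t \<bullet> w) - (\<alpha> / lam) * (p t \<bullet> w) = 0 \<and>
           (c0 + \<alpha>\<^sup>2 / lam) * (dt T p t \<bullet> q) - (\<alpha> / lam) * (dt T \<xi> t \<bullet> q)
             + \<kappa> * (grad \<Omega> (p t) \<bullet> grad \<Omega> q) - L * (E t \<bullet> grad \<Omega> q) = g t \<bullet> q)) \<and>
     E 0 = E0 \<and> H 0 = H0 \<and> u 0 = u0 \<and> p 0 = p0 \<and> \<xi> 0 = \<xi>0"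

definition energy ::
  "space set \<Rightarrow> real \<Rightarrow> real \<Rightarrow> real \<Rightarrow> real \<Rightarrow> real \<Rightarrow> real \<Rightarrow>
   vector_field \<Rightarrow> vector_field \<Rightarrow> vector_field \<Rightarrow> scalar_field \<Rightarrow> scalar_field \<Rightarrow> real" where
  "energy \<Omega> \<epsilon> \<mu> G lam \<alpha> c0 D B v w q =
     \<epsilon> * (norm D)\<^sup>2 + \<mu> * (norm B)\<^sup>2 + G * (norm (vgrad \<Omega> v))\<^sup>2
       + (1 / lam) * (norm (w - \<alpha> *\<^sub>R q))\<^sup>2 + c0 * (norm q)\<^sup>2"

definition dissipation :: "space set \<Rightarrow> real \<Rightarrow> real \<Rightarrow> vector_field \<Rightarrow> scalar_field \<Rightarrow> real" where
  "dissipation \<Omega> \<sigma> \<kappa> D q = \<sigma> * (norm D)\<^sup>2 + \<kappa> * (norm (grad \<Omega> q))\<^sup>2"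

end

theory Submission
  imports Defs
begin

text \<open>
  Testing the weak problem with \<open>(E, H, \<partial>\<^sub>t u, \<xi>, p)\<close>, with the fourth equation differentiated in time,
  makes the curl terms cancel and yields
  \<open>1/2 d/dt \<E> + \<V> - 2 L (E, \<nabla>p) = (h, E) + (g, p) + (f, \<partial>\<^sub>t u)\<close>.
  Since \<open>2 L (E, \<nabla>p) \<le> L / sqrt (\<sigma> \<kappa>) \<V>\<close>, and \<open>(f, \<partial>\<^sub>t u)\<close> is integrated by parts in time, the right-hand side
  is bounded by the square root of \<open>max \<E>\<close> times the norm of the data, and the maximum is absorbed.
  The bound on \<open>\<xi>\<close> is the inf-sup condition applied to the third equation.

  The term \<open>(f, u)\<close> requires a Poincare inequality on \<open>\<U>\<close>.  No trace theorem is needed for it, and \<open>\<Omega>\<close> may be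
  disconnected: the third equation says that \<open>f\<close> is orthogonal to all \<open>k\<close> that are limits of elements of the
  span of \<open>\<U>\<close> with gradients tending to \<open>0\<close>, so it suffices to bound \<open>u\<close> modulo such \<open>k\<close>.
  This follows by a compactness argument from \<open>\<parallel>u\<parallel>\<^sup>2 \<le> C (\<parallel>\<nabla>u\<parallel>\<^sup>2 + finitely many squared functionals of u)\<close>,
  which is the sum of Poincare inequalities on the convex polytopes that make up \<open>\<Omega>\<close>.
\<close>

section \<open>Smooth functions\<close>

text \<open>Independence of \<open>lam\<close> rests on which parts of the energy are used as
  bounds: only \<open>E\<close>, \<open>p\<close> and the gradient of \<open>u\<close> are ever
  estimated by it, and their weights \<open>\<epsilon>\<close>, \<open>c0\<close> and
  \<open>G\<close> are free of \<open>lam\<close>; the term with \<open>1 / lam\<close> is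
  reproduced exactly by the energy identity and otherwise only kept nonnegative. All time
  derivatives are weak, so the fourth equation is not differentiated pointwise. It yields a second
  representation of the trace of the gradient of \<open>u\<close> as an integral in time, and
  integration by parts against \<open>\<xi>\<close> makes the two derivatives interchangeable. On a
  convex piece a weakly differentiable function cannot be differentiated along segments. The scaling
  towards a point is therefore carried out on smooth test functions, and the weak gradient is
  recovered by duality and Fubini. The space \<open>sp_U\<close> enters through the closed linear
  span of the pairs \<open>(v, vgrad \<Omega> v)\<close>: the identities and inequalities used for
  it survive sums and limits, which makes the compactness argument applicable to a set described by
  traces.\<close>

lemma C_k_SucI:
  assumes "\<And>x. (f has_derivative f' x) (at x)" "\<And>v. C_k k (\<lambda>x. f' x v)"
  shows "C_k (Suc k) f"
proof -
  have "frechet_derivative f (at x) = f' x" for x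
    using frechet_derivative_at[OF assms(1)] by simp
  with assms show ?thesis by (auto simp: differentiable_def)
qed

lemma C_k_SucD:
  assumes "C_k (Suc k) f"
  shows "(f has_derivative frechet_derivative f (at x)) (at x)"
    and "C_k k (\<lambda>x. frechet_derivative f (at x) v)"
  using assms frechet_derivative_works by (simp_all, blast)

lemma C_k_Suc_imp: "C_k (Suc k) f \<Longrightarrow> C_k k f"
proof (induction k arbitrary: f)
  case 0
  then show ?case
    by (auto simp: continuous_on_eq_continuous_at differentiable_imp_continuous_within)
next
  case (Suc k)
  from Suc.prems show ?case by (subst C_k.simps, subst (asm) C_k.simps) (blast intro: Suc.IH)
qed

lemma C_k_const: "C_k k (\<lambda>x. c)"
proof (induction k arbitrary: c)
  case (Suc k) show ?case by (rule C_k_SucI[OF has_derivative_const Suc])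
qed simp

lemma C_k_add:
  "C_k k f \<Longrightarrow> C_k k g \<Longrightarrow> C_k k (\<lambda>x. f x + g x)"
proof (induction k arbitrary: f g)
  case 0 then show ?case by (simp add: continuous_on_add)
next
  case (Suc k)
  note f = C_k_SucD[OF Suc.prems(1)]
  note g = C_k_SucD[OF Suc.prems(2)]
  show ?case
    by (rule C_k_SucI[OF has_derivative_add[OF f(1) g(1)]]) (rule Suc.IH[OF f(2) g(2)])
qed

lemma C_k_scaleR:
  "C_k k f \<Longrightarrow> C_k k g \<Longrightarrow> C_k k (\<lambda>x. f x *\<^sub>R g x)"
proof (induction k arbitrary: f g)
  case 0 then show ?case by (simp add: continuous_on_scaleR)
next
  case (Suc k)
  note f = C_k_SucD[OF Suc.prems(1)]
  note g = C_k_SucD[OF Suc.prems(2)]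
  show ?case
    by (rule C_k_SucI[OF has_derivative_scaleR[OF f(1) g(1)]])
      (rule C_k_add[OF Suc.IH[OF C_k_Suc_imp[OF Suc.prems(1)] g(2)]
          Suc.IH[OF f(2) C_k_Suc_imp[OF Suc.prems(2)]]])
qed

lemma C_k_affine:
  fixes f :: "'b::euclidean_space \<Rightarrow> 'c::real_normed_vector" and A :: "'a::euclidean_space \<Rightarrow> 'b"
  assumes "bounded_linear A"
  shows "C_k k f \<Longrightarrow> C_k k (\<lambda>x. f (a + A x))"
proof (induction k arbitrary: f)
  case 0
  have "continuous_on UNIV (\<lambda>x. a + A x)"
    by (rule continuous_on_add[OF continuous_on_const linear_continuous_on[OF assms]])
  then show ?case using 0 by (auto intro: continuous_on_compose2)
next
  case (Suc k)
  note f = C_k_SucD[OF Suc.prems(1)]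
  have "((\<lambda>x. a + A x) has_derivative A) (at x)" for x
    using has_derivative_add[OF has_derivative_const bounded_linear_imp_has_derivative[OF assms], of a "at x"]
    by simp
  from has_derivative_compose[OF this f(1)]
  have "((\<lambda>x. f (a + A x)) has_derivative (\<lambda>v. frechet_derivative f (at (a + A x)) (A v))) (at x)" for x .
  then show ?case by (rule C_k_SucI) (rule Suc.IH[OF f(2)])
qed

lemma C_k_bounded_linear:
  assumes "bounded_linear A"
  shows "C_k k f \<Longrightarrow> C_k k (\<lambda>x. A (f x))"
proof (induction k arbitrary: f)
  case 0
  then show ?case using assms by (auto intro: bounded_linear.continuous_on)
next
  case (Suc k)
  note f = C_k_SucD[OF Suc.prems(1)]
  show ?case
    by (rule C_k_SucI[OF bounded_linear.has_derivative[OF assms f(1)]]) (rule Suc.IH[OF f(2)])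
qed

lemma C_k_linear:
  assumes "bounded_linear f"
  shows "C_k k f"
proof (cases k)
  case 0 then show ?thesis using assms by (simp add: linear_continuous_on)
next
  case (Suc l)
  show ?thesis unfolding Suc
    by (rule C_k_SucI[OF bounded_linear_imp_has_derivative[OF assms] C_k_const])
qed

lemma C_k_antiderivative:
  fixes f :: "real \<Rightarrow> real"
  assumes "\<And>x. (f has_real_derivative f' x) (at x)" "C_k k f'"
  shows "C_k (Suc k) f"
proof (rule C_k_SucI)
  show "(f has_derivative (*) (f' x)) (at x)" for x
    using assms(1) by (simp add: has_field_derivative_def)
  show "C_k k (\<lambda>x. f' x * v)" for v
    using C_k_scaleR[OF assms(2) C_k_const[of k v]] by simp
qed

lemma smooth_const: "smooth (\<lambda>x. c)"
  and smooth_add: "smooth f \<Longrightarrow> smooth g \<Longrightarrow> smooth (\<lambda>x. f x + g x)"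
  and smooth_scaleR: "smooth r \<Longrightarrow> smooth f \<Longrightarrow> smooth (\<lambda>x. r x *\<^sub>R f x)"
  and smooth_bounded_linear: "bounded_linear A \<Longrightarrow> smooth f \<Longrightarrow> smooth (\<lambda>x. A (f x))"
  and smooth_linear: "bounded_linear B \<Longrightarrow> smooth B"
  by (simp_all add: smooth_def C_k_const C_k_add C_k_scaleR C_k_bounded_linear C_k_linear)

lemma smooth_affine:
  fixes f :: "'b::euclidean_space \<Rightarrow> 'c::real_normed_vector" and A :: "'a::euclidean_space \<Rightarrow> 'b"
  shows "bounded_linear A \<Longrightarrow> smooth f \<Longrightarrow> smooth (\<lambda>x. f (a + A x))"
  by (simp add: smooth_def C_k_affine)

lemma smooth_mult:
  fixes f g :: "'a::euclidean_space \<Rightarrow> real"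
  shows "smooth f \<Longrightarrow> smooth g \<Longrightarrow> smooth (\<lambda>x. f x * g x)"
  using smooth_scaleR[of f g] by simp

lemma smooth_diff: "smooth f \<Longrightarrow> smooth g \<Longrightarrow> smooth (\<lambda>x. f x - g x)"
  using smooth_add[of f "\<lambda>x. - g x"] smooth_bounded_linear[of uminus g]
  by (simp add: bounded_linear_minus bounded_linear_ident)

lemma smooth_power:
  fixes f :: "'a::euclidean_space \<Rightarrow> real"
  shows "smooth f \<Longrightarrow> smooth (\<lambda>x. f x ^ n)"
  by (induction n) (simp_all add: smooth_const smooth_mult)

lemma smooth_prod:
  fixes f :: "'i \<Rightarrow> 'a::euclidean_space \<Rightarrow> real"
  shows "(\<And>i. i \<in> I \<Longrightarrow> smooth (f i)) \<Longrightarrow> smooth (\<lambda>x. \<Prod>i\<in>I. f i x)"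
  by (induction I rule: infinite_finite_induct) (simp_all add: smooth_const smooth_mult)

lemma smooth_sum:
  shows "(\<And>i. i \<in> I \<Longrightarrow> smooth (f i)) \<Longrightarrow> smooth (\<lambda>x. \<Sum>i\<in>I. f i x)"
  by (induction I rule: infinite_finite_induct) (simp_all add: smooth_const smooth_add)

lemma smooth_continuous: "smooth f \<Longrightarrow> continuous_on S f"
  unfolding smooth_def using C_k.simps(1) continuous_on_subset by blast

lemma smooth_has_derivative: "smooth f \<Longrightarrow> (f has_derivative frechet_derivative f (at x)) (at x)"
  unfolding smooth_def using C_k.simps(2) frechet_derivative_works by blast

lemma smooth_frechet_derivative: "smooth f \<Longrightarrow> smooth (\<lambda>x. frechet_derivative f (at x) v)"
  unfolding smooth_def using C_k.simps(2) by blast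

section \<open>Functions flat at 0, and smooth bumps on boxes\<close>

definition flat_exp :: "nat \<Rightarrow> real \<Rightarrow> real" where
  "flat_exp n t = (if 0 < t then exp (- (1 / t)) / t ^ n else 0)"

lemma flat_exp_tendsto_0: "(flat_exp n \<longlongrightarrow> 0) (at_right 0)"
proof -
  have "((\<lambda>t. inverse t ^ n / exp (inverse t)) \<longlongrightarrow> (0::real)) (at_right 0)"
    by (rule filterlim_compose[OF tendsto_power_div_exp_0 filterlim_inverse_at_top_right])
  moreover have "\<forall>\<^sub>F t in at_right 0. inverse t ^ n / exp (inverse t) = flat_exp n t"
    using eventually_at_right_less[of 0]
    by eventually_elim (simp add: flat_exp_def exp_minus field_simps)
  ultimately show ?thesis by (rule Lim_transform_eventually)
qed

text \<open>The powers of \<open>t\<close> in the denominator make the family closed under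
  differentiation, up to linear combinations, so that one induction for all \<open>n\<close> at once
  proves smoothness. At 0 the difference quotient of \<open>flat_exp n\<close> is
  \<open>flat_exp (n + 1)\<close> on the right and 0 on the left.\<close>

lemma flat_exp_deriv:
  "(flat_exp n has_real_derivative (flat_exp (n + 2) t - real n * flat_exp (n + 1) t)) (at t)"
proof (cases t "0::real" rule: linorder_cases)
  case less
  have "((\<lambda>t. 0) has_real_derivative (flat_exp (n + 2) t - real n * flat_exp (n + 1) t)) (at t)"
    using less by (simp add: flat_exp_def)
  then show ?thesis
    by (rule has_field_derivative_transform_within_open[where S = "{..<0}"])
      (use less in \<open>auto simp: flat_exp_def\<close>)
next
  case equal
  have "((\<lambda>h. flat_exp n h / h) \<longlongrightarrow> 0) (at 0)"
  proof (rule filterlim_split_at)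
    have "\<forall>\<^sub>F h in at_left (0::real). 0 = flat_exp n h / h"
      by (auto simp: eventually_at_filter flat_exp_def)
    then show "((\<lambda>h. flat_exp n h / h) \<longlongrightarrow> 0) (at_left 0)"
      by (rule Lim_transform_eventually[OF tendsto_const])
    have "\<forall>\<^sub>F h in at_right (0::real). flat_exp (n + 1) h = flat_exp n h / h"
      by (auto simp: eventually_at_filter flat_exp_def)
    then show "((\<lambda>h. flat_exp n h / h) \<longlongrightarrow> 0) (at_right 0)"
      by (rule Lim_transform_eventually[OF flat_exp_tendsto_0])
  qed
  moreover have "flat_exp m 0 = 0" for m by (simp add: flat_exp_def)
  ultimately show ?thesis
    using equal by (simp add: DERIV_def)
next
  case greater
  \<comment> \<open>The power rule leaves the truncated exponent \<open>n - Suc 0\<close>; for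
    \<open>n = 0\<close> the factor \<open>real n\<close> saves the identity.\<close>
  have y: "real n * y ^ (n - Suc 0) * y\<^sup>2 = real n * y ^ (n + 1)" for y :: real
    by (cases n) (auto simp: power2_eq_square)
  have "((\<lambda>t. exp (- (1 / t)) * inverse t ^ n) has_real_derivative
      exp (- (1 / t)) * (inverse t)\<^sup>2 * inverse t ^ n
        - exp (- (1 / t)) * (real n * inverse t ^ (n - Suc 0) * (inverse t)\<^sup>2)) (at t)"
    using greater by (auto intro!: derivative_eq_intros simp: power2_eq_square divide_inverse)
  then have "((\<lambda>t. exp (- (1 / t)) * inverse t ^ n) has_real_derivative
      (flat_exp (n + 2) t - real n * flat_exp (n + 1) t)) (at t)"
    unfolding y using greater
    by (simp add: flat_exp_def divide_inverse power_inverse power_add power2_eq_square mult_ac)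
  then show ?thesis
    by (rule has_field_derivative_transform_within_open[where S = "{0<..}"])
      (use greater in \<open>auto simp: flat_exp_def field_simps\<close>)
qed

lemma smooth_flat_exp: "smooth (flat_exp n)"
  unfolding smooth_def
proof
  fix k show "C_k k (flat_exp n)"
  proof (induction k arbitrary: n)
    case 0
    then show ?case
      using flat_exp_deriv[of n] by (auto simp: continuous_on_eq_continuous_at intro!: DERIV_isCont)
  next
    case (Suc k)
    have "C_k k (\<lambda>t. flat_exp (n + 2) t + (- real n) *\<^sub>R flat_exp (n + 1) t)"
      by (intro C_k_add C_k_scaleR C_k_const Suc.IH)
    then show ?case
      by (intro C_k_antiderivative[OF flat_exp_deriv]) simp
  qed
qed

lemma flat_exp_0: "0 \<le> flat_exp 0 t" "flat_exp 0 t \<le> 1" "flat_exp 0 t = 0 \<longleftrightarrow> t \<le> 0"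
  by (auto simp: flat_exp_def)

text \<open>Positive exactly on the open box and at most 1, so that
  \<open>1 - (1 - box_bump a b x) ^ n\<close> increases to the indicator of the box. The same
  function later serves as the density of the smooth step.\<close>

definition box_bump :: "'a::euclidean_space \<Rightarrow> 'a \<Rightarrow> 'a \<Rightarrow> real" where
  "box_bump a b x = (\<Prod>e\<in>Basis. flat_exp 0 ((x - a) \<bullet> e) * flat_exp 0 ((b - x) \<bullet> e))"

lemma smooth_box_bump: "smooth (box_bump a b)"
proof -
  have 1: "smooth (\<lambda>x. flat_exp 0 ((x - a) \<bullet> e))" for e
    using smooth_affine[OF bounded_linear_inner_left smooth_flat_exp[of 0], of "- (a \<bullet> e)" e]
    by (simp add: algebra_simps)
  have 2: "smooth (\<lambda>x. flat_exp 0 ((b - x) \<bullet> e))" for e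
    using smooth_affine[OF bounded_linear_minus[OF bounded_linear_inner_left] smooth_flat_exp[of 0], of "(b \<bullet> e)" e]
    by (simp add: algebra_simps)
  show ?thesis
    unfolding box_bump_def[abs_def] by (intro smooth_prod smooth_mult 1 2)
qed

lemma box_bump_bounds: "0 \<le> box_bump a b x" "box_bump a b x \<le> 1"
  unfolding box_bump_def by (auto intro!: prod_nonneg prod_le_1 mult_nonneg_nonneg mult_le_one flat_exp_0)

lemma box_bump_eq_0_iff: "box_bump a b x = 0 \<longleftrightarrow> x \<notin> box a b"
  by (simp add: box_bump_def flat_exp_0 mem_box inner_diff_left) (meson not_less)

section \<open>Density of test functions\<close>

lemma test_functions_zero: "(\<lambda>x. 0) \<in> test_functions O'"
  by (simp add: test_functions_def smooth_const)

lemma test_functions_combine: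
  assumes "\<phi> \<in> test_functions S" "\<psi> \<in> test_functions S" "smooth \<eta>"
    and "\<And>x. \<phi> x = 0 \<Longrightarrow> \<psi> x = 0 \<Longrightarrow> \<eta> x = 0"
  shows "\<eta> \<in> test_functions S"
proof -
  have "{x. \<eta> x \<noteq> 0} \<subseteq> {x. \<phi> x \<noteq> 0} \<union> {x. \<psi> x \<noteq> 0}" using assms(4) by auto
  then have sub: "closure {x. \<eta> x \<noteq> 0} \<subseteq> closure {x. \<phi> x \<noteq> 0} \<union> closure {x. \<psi> x \<noteq> 0}"
    unfolding closure_Un[symmetric] by (rule closure_mono)
  have "compact (closure {x. \<phi> x \<noteq> 0} \<union> closure {x. \<psi> x \<noteq> 0})"
    using assms by (auto simp: test_functions_def intro: compact_Un)
  then have "compact (closure {x. \<eta> x \<noteq> 0})"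
    using sub by (meson bounded_subset closed_closure compact_eq_bounded_closed)
  with sub assms show ?thesis by (auto simp: test_functions_def)
qed

lemma test_functions_supported:
  assumes "smooth \<phi>" "compact K" "K \<subseteq> S" "\<And>x. x \<notin> K \<Longrightarrow> \<phi> x = 0"
  shows "\<phi> \<in> test_functions S"
proof -
  have "{x. \<phi> x \<noteq> 0} \<subseteq> K" using assms(4) by auto
  then have sub: "closure {x. \<phi> x \<noteq> 0} \<subseteq> K"
    by (rule closure_minimal) (rule compact_imp_closed[OF assms(2)])
  then have "compact (closure {x. \<phi> x \<noteq> 0})"
    using assms(2) by (meson bounded_subset closed_closure compact_eq_bounded_closed)
  with sub assms show ?thesis by (auto simp: test_functions_def)
qed

lemma test_functions_support:
  assumes "\<phi> \<in> test_functions S"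
  obtains K where "compact K" "K \<subseteq> S" "\<And>x. x \<notin> K \<Longrightarrow> \<phi> x = 0"
proof (rule that)
  show "compact (closure {x. \<phi> x \<noteq> 0})" "closure {x. \<phi> x \<noteq> 0} \<subseteq> S"
    using assms by (auto simp: test_functions_def)
  show "\<phi> x = 0" if "x \<notin> closure {x. \<phi> x \<noteq> 0}" for x
    using that closure_subset[of "{x. \<phi> x \<noteq> 0}"] by auto
qed

lemma test_functions_smooth: "\<phi> \<in> test_functions S \<Longrightarrow> smooth \<phi>"
  by (simp add: test_functions_def)

lemma sq_integrable_compact_support:
  fixes \<phi> :: "'a::euclidean_space \<Rightarrow> 'b::euclidean_space"
  assumes "continuous_on UNIV \<phi>" "compact K" "\<And>x. x \<notin> K \<Longrightarrow> \<phi> x = 0"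
  shows "sq_integrable \<phi>"
proof -
  have "compact (\<phi> ` K)"
    using assms(2) by (intro compact_continuous_image continuous_on_subset[OF assms(1)]) auto
  then obtain M where M: "\<And>x. x \<in> K \<Longrightarrow> norm (\<phi> x) \<le> M"
    using compact_imp_bounded bounded_iff by (metis image_eqI)
  show ?thesis
  proof (rule sq_integrable_dominated[where g = "\<lambda>x. indicator K x *\<^sub>R M\<^sup>2"])
    show "\<phi> \<in> borel_measurable lborel"
      using borel_measurable_continuous_onI[OF assms(1)] by simp
    have "emeasure lborel K < \<infinity>" using assms(2) compact_imp_bounded emeasure_bounded_finite by blast
    then show "integrable lborel (\<lambda>x. indicator K x *\<^sub>R M\<^sup>2)"
      using assms(2) by (intro integrable_scaleR_left integrable_real_indicator) (auto simp: borel_compact)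
    show "(norm (\<phi> x))\<^sup>2 \<le> indicator K x *\<^sub>R M\<^sup>2" for x
      using M[of x] assms(3)[of x] by (cases "x \<in> K") (auto intro: power_mono)
  qed
qed

lemma sq_integrable_test:
  fixes \<phi> :: "'a::euclidean_space \<Rightarrow> 'b::euclidean_space"
  assumes "\<phi> \<in> test_functions S"
  shows "sq_integrable \<phi>"
proof -
  obtain K where "compact K" "\<And>x. x \<notin> K \<Longrightarrow> \<phi> x = 0"
    using test_functions_support[OF assms] by metis
  then show ?thesis
    using sq_integrable_compact_support smooth_continuous[OF test_functions_smooth[OF assms]] by blast
qed

lemma l2_restrict_supported:
  assumes "\<And>x. x \<notin> S \<Longrightarrow> \<phi> x = 0"
  shows "l2_restrict S \<phi> = l2_class \<phi>"
proof -
  have "(\<lambda>x. indicator S x *\<^sub>R \<phi> x) = \<phi>"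
    using assms by (auto simp: fun_eq_iff indicator_def)
  then show ?thesis by (simp add: l2_restrict_def)
qed

lemma l2_restrict_test:
  assumes "\<phi> \<in> test_functions S"
  shows "l2_restrict S \<phi> = l2_class \<phi>"
  using test_functions_support[OF assms] by (metis l2_restrict_supported subsetD)

lemma subspace_test_functions:
  "subspace (l2_restrict S ` (test_functions S :: ('a::euclidean_space \<Rightarrow> 'b::euclidean_space) set))"
proof -
  have eq: "l2_restrict S ` test_functions S = (l2_class :: ('a \<Rightarrow> 'b) \<Rightarrow> _) ` test_functions S"
    by (intro image_cong refl l2_restrict_test)
  show ?thesis
    unfolding eq
  proof (rule subspaceI)
    show "0 \<in> (l2_class :: ('a \<Rightarrow> 'b) \<Rightarrow> _) ` test_functions S"
      using l2_class_zero by (intro image_eqI[OF _ test_functions_zero]) simp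
  next
    fix u v :: "('a, 'b) l2" assume "u \<in> l2_class ` test_functions S" "v \<in> l2_class ` test_functions S"
    then obtain f g where fg: "u = l2_class f" "f \<in> test_functions S" "v = l2_class g" "g \<in> test_functions S"
      by auto
    have "(\<lambda>x. f x + g x) \<in> test_functions S"
      using fg by (intro test_functions_combine[OF fg(2,4)] smooth_add test_functions_smooth) auto
    then show "u + v \<in> l2_class ` test_functions S"
      using fg by (auto simp: l2_class_add[symmetric] sq_integrable_test)
  next
    fix c and u :: "('a, 'b) l2" assume "u \<in> l2_class ` test_functions S"
    then obtain f where fg: "u = l2_class f" "f \<in> test_functions S"
      by auto
    have "(\<lambda>x. c *\<^sub>R f x) \<in> test_functions S"
      using fg by (intro test_functions_combine[OF fg(2,2)] smooth_scaleR smooth_const test_functions_smooth) auto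
    then show "c *\<^sub>R u \<in> l2_class ` test_functions S"
      using fg by (auto simp: l2_class_scaleR[symmetric] sq_integrable_test)
  qed
qed

lemma L2I: "sq_integrable f \<Longrightarrow> (\<And>x. x \<notin> S \<Longrightarrow> f x = 0) \<Longrightarrow> l2_class f \<in> L2 S"
  by (auto simp: L2_def)

lemma L2E:
  assumes "u \<in> L2 S"
  obtains f where "sq_integrable f" "\<And>x. x \<notin> S \<Longrightarrow> f x = 0" "u = l2_class f"
  using assms by (auto simp: L2_def)

text \<open>The closure of the test functions is a closed subspace, so ever larger classes can be
  put into it: indicators of boxes, of Borel subsets of a box, of Borel subsets of finite unions of
  boxes in \<open>S\<close>, truncated simple functions, and their dominated limits.\<close>

theorem test_functions_dense:
  fixes w :: "('a::euclidean_space, 'b::euclidean_space) l2"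
  assumes "open S" "w \<in> L2 S"
  shows "w \<in> closure (l2_restrict S ` test_functions S)"
proof -
  define M :: "('a, 'b) l2 set" where "M = closure (l2_restrict S ` test_functions S)"
  have Msub: "subspace M" unfolding M_def by (intro subspace_closure_normed subspace_test_functions)
  have Mcl: "closed M" by (simp add: M_def)
  have box: "l2_class (\<lambda>x. indicator (box a b) x *\<^sub>R y) \<in> M" if ab: "cbox a b \<subseteq> S" for a b y
  proof -
    \<comment> \<open>Powers of \<open>1 - box_bump\<close> tend to 0 inside the box and stay 1
      outside. Hence these smooth functions, all supported in the one compact set
      \<open>cbox a b\<close>, converge to the indicator and are dominated by it.\<close>
    define \<phi> :: "nat \<Rightarrow> 'a \<Rightarrow> 'b" where "\<phi> n x = (1 - (1 - box_bump a b x) ^ n) *\<^sub>R y" for n x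
    have sm: "smooth (\<phi> n)" for n
      unfolding \<phi>_def[abs_def] by (intro smooth_scaleR smooth_diff smooth_power smooth_const smooth_box_bump)
    have "\<phi> n \<in> test_functions S" for n
      by (rule test_functions_supported[OF sm compact_cbox ab])
        (use box_subset_cbox[of a b] in \<open>auto simp: \<phi>_def dest: box_bump_eq_0_iff[THEN iffD2, rotated]
           simp: box_bump_eq_0_iff[THEN iffD2, OF contra_subsetD[OF box_subset_cbox]]\<close>)
    then have "l2_class (\<phi> n) \<in> M" for n
      unfolding M_def using closure_subset l2_restrict_test[of "\<phi> n" S] by (metis image_eqI subsetD)
    moreover have "(\<lambda>n. l2_class (\<phi> n)) \<longlonglongrightarrow> l2_class (\<lambda>x. indicator (box a b) x *\<^sub>R y)"
    proof (rule l2_class_dominated_tendsto(3)[where c = 1])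
      show "\<phi> n \<in> borel_measurable borel" for n
        by (rule borel_measurable_continuous_onI[OF smooth_continuous[OF sm]])
      show "sq_integrable (\<lambda>x. indicator (box a b) x *\<^sub>R y)"
        by (rule sq_integrable_indicator) auto
      show "norm (\<phi> n x) \<le> 1 * norm (indicator (box a b) x *\<^sub>R y)" for n x
      proof (cases "x \<in> box a b")
        case True
        have "0 \<le> (1 - box_bump a b x) ^ n" "(1 - box_bump a b x) ^ n \<le> 1"
          using box_bump_bounds[of a b x] by (auto intro: power_le_one)
        then show ?thesis using True by (simp add: \<phi>_def mult_left_le_one_le)
      qed (simp add: \<phi>_def box_bump_eq_0_iff[THEN iffD2])
      show "(\<lambda>n. \<phi> n x) \<longlonglongrightarrow> indicator (box a b) x *\<^sub>R y" for x
      proof (cases "x \<in> box a b")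
        case True
        then have "0 < box_bump a b x" using box_bump_bounds[of a b x] box_bump_eq_0_iff[of a b x] by auto
        then have "(\<lambda>n. (1 - (1 - box_bump a b x) ^ n) *\<^sub>R y) \<longlonglongrightarrow> (1 - 0) *\<^sub>R y"
          using box_bump_bounds[of a b x] by (intro tendsto_intros LIMSEQ_power_zero) auto
        then show ?thesis using True by (simp add: \<phi>_def)
      qed (simp add: \<phi>_def box_bump_eq_0_iff[THEN iffD2])
    qed
    ultimately show ?thesis by (rule closed_sequentially[OF Mcl])
  qed

  \<comment> \<open>The sets \<open>A\<close> with this property form a Dynkin system containing the
    boxes, which are stable under intersection and generate the Borel sets.\<close>
  have borel_box: "l2_class (\<lambda>x. indicator (A \<inter> box a b) x *\<^sub>R y) \<in> M"
    if ab: "cbox a b \<subseteq> S" and A: "A \<in> sets borel" for A a b y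
  proof -
    define G where "G = range (\<lambda>(a, b). box a b :: 'a set)"
    have sq: "sq_integrable (\<lambda>x. indicator (A' \<inter> box a b) x *\<^sub>R y)" if "A' \<in> sets borel" for A' :: "'a set"
      using that by (intro sq_integrable_indicator) (auto intro: bounded_Int)
    have sG: "sigma_sets UNIV G = sets borel" by (simp add: borel_eq_box G_def)
    have ISG: "Int_stable G"
      unfolding G_def by (rule Int_stableI) (auto simp: box_Int_box intro!: rangeI[of "\<lambda>(a, b). box a b" "(_, _)", simplified])
    have "G \<subseteq> Pow UNIV" "A \<in> sigma_sets UNIV G" using A by (simp_all add: sG)
    with ISG show ?thesis
    proof (induction rule: sigma_sets_induct_disjoint)
      case (basic A)
      then obtain c d where "A = box c d" by (auto simp: G_def)
      define c' d' where "c' = (\<Sum>i\<in>Basis. max (c \<bullet> i) (a \<bullet> i) *\<^sub>R i)"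
        and "d' = (\<Sum>i\<in>Basis. min (d \<bullet> i) (b \<bullet> i) *\<^sub>R i)"
      have "A \<inter> box a b = box c' d'" "cbox c' d' \<subseteq> cbox a b"
        using \<open>A = box c d\<close> by (auto simp: box_Int_box c'_def d'_def mem_box)
      then show ?case using box[of c' d' y] ab by simp
    next
      case empty
      show ?case using subspace_0[OF Msub] by (simp add: l2_class_zero)
    next
      case (compl A)
      then have [measurable]: "A \<in> sets borel" by (simp add: sG)
      have "(\<lambda>x. indicator ((UNIV - A) \<inter> box a b) x *\<^sub>R y)
          = (\<lambda>x. indicator (UNIV \<inter> box a b) x *\<^sub>R y - indicator (A \<inter> box a b) x *\<^sub>R y)"
        by (auto simp: fun_eq_iff indicator_def)
      then have "l2_class (\<lambda>x. indicator ((UNIV - A) \<inter> box a b) x *\<^sub>R y)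
          = l2_class (\<lambda>x. indicator (UNIV \<inter> box a b) x *\<^sub>R y)
            - l2_class (\<lambda>x. indicator (A \<inter> box a b) x *\<^sub>R y)"
        using sq[of UNIV] sq[of A] by (simp add: l2_class_diff)
      then show ?case using compl box[OF ab] by (simp add: subspace_diff[OF Msub])
    next
      case (union A)
      then have A[measurable]: "A i \<in> sets borel" for i by (auto simp: sG)
      define U where "U k = (\<Union>i<k. A i)" for k
      have [measurable]: "U k \<in> sets borel" for k by (auto simp: U_def)
      have Ueq: "indicator (U k \<inter> box a b) x *\<^sub>R y = (\<Sum>i<k. indicator (A i \<inter> box a b) x *\<^sub>R y)" for k x
      proof -
        have "disjoint_family_on A {..<k}" using union(1) by (rule disjoint_family_on_mono[rotated]) simp
        then have "indicator (U k) x = (\<Sum>i<k. indicator (A i) x :: real)"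
          unfolding U_def by (intro indicator_UN_disjoint) auto
        then show ?thesis by (simp add: indicator_inter_arith scaleR_sum_left[symmetric] sum_distrib_right)
      qed
      have "l2_class (\<lambda>x. indicator (U k \<inter> box a b) x *\<^sub>R y) \<in> M" for k
      proof -
        have "l2_class (\<lambda>x. indicator (U k \<inter> box a b) x *\<^sub>R y)
            = (\<Sum>i<k. l2_class (\<lambda>x. indicator (A i \<inter> box a b) x *\<^sub>R y))"
          unfolding Ueq by (rule conjunct2[OF l2_class_sum]) (rule sq[OF A])
        then show ?thesis by (simp only:) (intro subspace_sum[OF Msub] union(3))
      qed
      moreover have "(\<lambda>k. l2_class (\<lambda>x. indicator (U k \<inter> box a b) x *\<^sub>R y))
          \<longlonglongrightarrow> l2_class (\<lambda>x. indicator ((\<Union>i. A i) \<inter> box a b) x *\<^sub>R y)"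
      proof (rule l2_class_dominated_tendsto(3)[where c = 1, OF _ sq[of UNIV]])
        show "(\<lambda>k. indicator (U k \<inter> box a b) x *\<^sub>R y) \<longlonglongrightarrow> indicator ((\<Union>i. A i) \<inter> box a b) x *\<^sub>R y" for x
        proof -
          have "(\<lambda>k. indicator (U k) x :: real) \<longlonglongrightarrow> indicator (\<Union>i. A i) x"
            unfolding U_def by (rule LIMSEQ_indicator_UN)
          then show ?thesis unfolding indicator_inter_arith by (intro tendsto_intros)
        qed
      qed (auto simp: indicator_def)
      ultimately show ?case by (rule closed_sequentially[OF Mcl])
    qed
  qed

  obtain B :: "nat \<Rightarrow> 'a set" where B: "\<And>k. \<exists>a b. B k = cbox a b" "(\<Union>k. B k) = S"
  proof -
    obtain D where D: "countable D" "\<And>X. X \<in> D \<Longrightarrow> \<exists>a b. X = cbox a b" "\<Union>D = S"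
      using open_countable_Union_open_cbox[OF assms(1)] by metis
    show ?thesis
    proof (cases "D = {}")
      case True
      then show ?thesis using that[of "\<lambda>_. {}"] D(3) empty_as_interval by (metis Sup_empty UN_constant)
    next
      case False
      then show ?thesis using that[of "from_nat_into D"] D by (simp add: from_nat_into)
    qed
  qed
  define U where "U n = (\<Union>k<n. B k)" for n
  have Bm[measurable]: "B k \<in> sets borel" for k using B(1)[of k] by auto
  have Um[measurable]: "U n \<in> sets borel" for n by (simp add: U_def)
  have Ub: "bounded (U n)" for n
    unfolding U_def using B(1) by (intro bounded_UN) (auto, metis bounded_cbox)
  \<comment> \<open>The covering boxes may overlap, so each step adds only the part of
    \<open>A\<close> in the new box that lies outside \<open>U n\<close>; the closed box and the
    open box differ by a null set.\<close>
  have AU: "l2_class (\<lambda>x. indicator (A \<inter> U n) x *\<^sub>R y) \<in> M" if A[measurable]: "A \<in> sets borel" for A n y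
  proof (induction n)
    case 0
    then show ?case using subspace_0[OF Msub] by (simp add: U_def l2_class_zero)
  next
    case (Suc n)
    obtain a b where ab: "B n = cbox a b" using B(1) by blast
    have "cbox a b \<subseteq> S" using B(2) ab by blast
    have sq: "sq_integrable (\<lambda>x. indicator (A \<inter> U n) x *\<^sub>R y)"
      "sq_integrable (\<lambda>x. indicator (A \<inter> U (Suc n)) x *\<^sub>R y)"
      "sq_integrable (\<lambda>x. indicator ((A - U n) \<inter> box a b) x *\<^sub>R y)"
      by (intro sq_integrable_indicator; measurable; simp add: Ub bounded_Int)+
    have "negligible (cbox a b - box a b)" by (rule negligible_frontier_interval)
    then have "cbox a b - box a b \<in> null_sets lborel"
      unfolding negligible_iff_null_sets by (simp add: null_sets_completion_iff)
    then have "AE x in lborel. x \<notin> cbox a b - box a b" by (rule AE_not_in)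
    then have "AE x in lborel. indicator (A \<inter> U (Suc n)) x *\<^sub>R y
        = indicator (A \<inter> U n) x *\<^sub>R y + indicator ((A - U n) \<inter> box a b) x *\<^sub>R y"
      by eventually_elim (use box_subset_cbox[of a b] in \<open>auto simp: U_def lessThan_Suc ab indicator_def\<close>)
    then have "l2_class (\<lambda>x. indicator (A \<inter> U (Suc n)) x *\<^sub>R y)
        = l2_class (\<lambda>x. indicator (A \<inter> U n) x *\<^sub>R y) + l2_class (\<lambda>x. indicator ((A - U n) \<inter> box a b) x *\<^sub>R y)"
      using sq by (simp add: l2_class_add[symmetric] l2_class_eq_iff sq_integrable_add)
    then show ?case
      using Suc borel_box[OF \<open>cbox a b \<subseteq> S\<close>, of "A - U n" y] by (simp add: subspace_add[OF Msub])
  qed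

  obtain f where f: "sq_integrable f" "\<And>x. x \<notin> S \<Longrightarrow> f x = 0" "w = l2_class f"
    using L2E[OF assms(2)] by metis
  have fm: "f \<in> borel_measurable borel" using f(1) by (rule sq_integrable_imp_borel)
  obtain s :: "nat \<Rightarrow> 'a \<Rightarrow> 'b" where s: "\<And>i. simple_function borel (s i)"
      "\<And>x. (\<lambda>i. s i x) \<longlonglongrightarrow> f x" "\<And>i x. dist (s i x) 0 \<le> 2 * dist (f x) 0"
    using borel_measurable_implies_sequence_metric[OF fm, of 0] by auto
  have sm[measurable]: "s i \<in> borel_measurable borel" for i
    using s(1) by (rule borel_measurable_simple_function)
  define t where "t i x = indicator (U i) x *\<^sub>R s i x" for i x
  have "l2_class (t i) \<in> M" for i
  proof -
    have fin: "finite (range (s i))" using simple_functionD(1)[OF s(1)[of i]] by simp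
    have teq: "t i = (\<lambda>x. \<Sum>y\<in>range (s i). indicator (s i -` {y} \<inter> U i) x *\<^sub>R y)"
    proof
      fix x
      have "(\<Sum>y\<in>range (s i). indicator (s i -` {y} \<inter> U i) x *\<^sub>R y)
          = (\<Sum>y\<in>range (s i). if y = s i x then t i x else 0)"
        by (intro sum.cong) (auto simp: t_def indicator_def)
      then show "t i x = (\<Sum>y\<in>range (s i). indicator (s i -` {y} \<inter> U i) x *\<^sub>R y)"
        using fin by simp
    qed
    have mb: "s i -` {y} \<in> sets borel" for y
      using measurable_sets_borel[OF sm[of i], of "{y}"] by simp
    have "l2_class (\<lambda>x. \<Sum>y\<in>range (s i). indicator (s i -` {y} \<inter> U i) x *\<^sub>R y)
        = (\<Sum>y\<in>range (s i). l2_class (\<lambda>x. indicator (s i -` {y} \<inter> U i) x *\<^sub>R y))"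
      by (rule conjunct2[OF l2_class_sum])
        (intro sq_integrable_indicator sets.Int mb Um bounded_Int disjI2 Ub)
    then show ?thesis
      unfolding teq by (simp only:) (intro subspace_sum[OF Msub] AU mb)
  qed
  moreover have "(\<lambda>i. l2_class (t i)) \<longlonglongrightarrow> w"
    unfolding f(3)
  proof (rule l2_class_dominated_tendsto(3)[where c = 2, OF _ f(1)])
    show "t i \<in> borel_measurable borel" for i unfolding t_def by measurable
    show "norm (t i x) \<le> 2 * norm (f x)" for i x
      using s(3)[of i x] by (auto simp: t_def indicator_def)
    show "(\<lambda>i. t i x) \<longlonglongrightarrow> f x" for x
    proof (cases "x \<in> S")
      case True
      then obtain k where k: "x \<in> B k" using B(2) by auto
      show ?thesis
      proof (rule Lim_transform_eventually[OF s(2)])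
        show "\<forall>\<^sub>F i in sequentially. s i x = t i x"
          using eventually_gt_at_top[of k]
          by eventually_elim (use k in \<open>auto simp: t_def U_def indicator_def\<close>)
      qed
    next
      case False
      \<comment> \<open>Outside \<open>S\<close> the domination of \<open>s i\<close> by twice the
        norm of \<open>f\<close> forces the simple functions to vanish.\<close>
      then have "s i x = 0" for i using s(3)[of i x] f(2)[of x] by simp
      then show ?thesis using f(2)[OF False] by (simp add: t_def)
    qed
  qed
  ultimately show ?thesis unfolding M_def[symmetric] by (rule closed_sequentially[OF Mcl])
qed

text \<open>By density, test functions converge to \<open>w\<close> itself, and in the limit the
  hypothesis reads \<open>w \<bullet> w \<le> c * norm w\<close>.\<close>

lemma L2_le_by_test_functions:
  fixes w :: "('a::euclidean_space, 'b::euclidean_space) l2"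
  assumes "open S" "w \<in> L2 S" "0 \<le> c"
    and "\<And>\<phi>. \<phi> \<in> test_functions S \<Longrightarrow> w \<bullet> l2_class \<phi> \<le> c * norm (l2_class \<phi>)"
  shows "norm w \<le> c"
proof (cases "w = 0")
  case False
  obtain v where v: "\<And>n. v n \<in> l2_restrict S ` test_functions S" "v \<longlonglongrightarrow> w"
    using test_functions_dense[OF assms(1,2)] unfolding closure_sequential by blast
  have "w \<bullet> v n \<le> c * norm (v n)" for n
    using v(1)[of n] assms(4) by (auto simp: l2_restrict_test)
  moreover have "(\<lambda>n. w \<bullet> v n) \<longlonglongrightarrow> w \<bullet> w" "(\<lambda>n. c * norm (v n)) \<longlonglongrightarrow> c * norm w"
    using v(2) by (auto intro!: tendsto_intros)
  ultimately have "w \<bullet> w \<le> c * norm w" by (meson LIMSEQ_le)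
  with False show ?thesis by (simp add: power2_norm_eq_inner[symmetric] power2_eq_square)
qed (use assms in simp)

lemma L2_eq_0_by_test_functions:
  fixes w :: "('a::euclidean_space, 'b::euclidean_space) l2"
  assumes "open S" "w \<in> L2 S" "\<And>\<phi>. \<phi> \<in> test_functions S \<Longrightarrow> w \<bullet> l2_class \<phi> = 0"
  shows "w = 0"
  using L2_le_by_test_functions[OF assms(1,2), of 0] assms(3) by simp

section \<open>Poincare inequalities\<close>

lemma
  fixes f :: "'a::euclidean_space \<Rightarrow> 'b::{banach, second_countable_topology}"
  assumes [measurable]: "f \<in> borel_measurable borel" and r: "0 < r"
  shows lborel_integrable_affine_iff: "integrable lborel (\<lambda>x. f (t + r *\<^sub>R x)) \<longleftrightarrow> integrable lborel f"
    and lborel_integral_affine: "(\<integral>x. f x \<partial>lborel) = r ^ DIM('a) *\<^sub>R (\<integral>x. f (t + r *\<^sub>R x) \<partial>lborel)"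
proof -
  have [simp]: "r \<noteq> 0" "\<bar>r\<bar> = r" using r by auto
  have L: "(lborel :: 'a measure) = density (distr lborel borel (\<lambda>x. t + r *\<^sub>R x)) (\<lambda>_. ennreal (r ^ DIM('a)))"
    using lborel_affine[of r t] by simp
  have "integrable lborel f \<longleftrightarrow> integrable lborel (\<lambda>x. r ^ DIM('a) *\<^sub>R f (t + r *\<^sub>R x))"
    using r by (subst L) (simp add: integrable_density integrable_distr_eq)
  then show "integrable lborel (\<lambda>x. f (t + r *\<^sub>R x)) \<longleftrightarrow> integrable lborel f"
    using r integrable_scaleR_right[of "1 / r ^ DIM('a)" lborel "\<lambda>x. r ^ DIM('a) *\<^sub>R f (t + r *\<^sub>R x)"]
    by (auto intro: integrable_scaleR_right)
  show "(\<integral>x. f x \<partial>lborel) = r ^ DIM('a) *\<^sub>R (\<integral>x. f (t + r *\<^sub>R x) \<partial>lborel)"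
    using r by (subst L) (simp add: integral_density integral_distr)
qed

lemma sq_integrable_affine:
  assumes "sq_integrable f" "0 < r"
  shows "sq_integrable (\<lambda>x. f (t + r *\<^sub>R x))"
proof -
  have [measurable]: "f \<in> borel_measurable borel" using assms(1) by (rule sq_integrable_imp_borel)
  show ?thesis
    using assms lborel_integrable_affine_iff[of "\<lambda>x. (norm (f x))\<^sup>2" r t] by (simp add: sq_integrable_def)
qed

lemma pd_eq: "(\<phi> has_derivative D) (at x) \<Longrightarrow> pd j \<phi> x = D (axis j 1)"
  unfolding pd_def using frechet_derivative_at by metis

text \<open>The product rule for the rows; 3 is the divergence of the field \<open>x - c\<close>. Up
  to sign, the right-hand side is the rate of change at \<open>s = 1\<close> of the field obtained
  from \<open>\<phi>\<close> by the mass-preserving homothety with centre \<open>c\<close> and ratio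
  \<open>s\<close>.\<close>

lemma row_div_fun_outer:
  fixes \<phi> :: "space \<Rightarrow> space"
  assumes "smooth \<phi>"
  shows "row_div_fun (\<lambda>x. \<chi> i. \<phi> x $ i *\<^sub>R (x - c)) x = 3 *\<^sub>R \<phi> x + frechet_derivative \<phi> (at x) (x - c)"
proof -
  let ?D = "frechet_derivative \<phi> (at x)"
  have lin: "linear ?D" using smooth_has_derivative[OF assms] by (rule has_derivative_linear)
  have hd: "((\<lambda>y. \<phi> y $ i *\<^sub>R (y - c)) has_derivative (\<lambda>h. \<phi> x $ i *\<^sub>R h + (?D h $ i) *\<^sub>R (x - c))) (at x)" for i
    using has_derivative_scaleR[OF
        bounded_linear.has_derivative[OF bounded_linear_vec_nth smooth_has_derivative[OF assms]]
        has_derivative_diff[OF has_derivative_ident has_derivative_const]] by simp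
  then have pd: "pd j (\<lambda>y. \<phi> y $ i *\<^sub>R (y - c)) x $ j = \<phi> x $ i + ?D (axis j 1) $ i * (x - c) $ j" for i j
    by (simp only: pd_eq[OF hd]) simp
  have sum: "(\<Sum>j\<in>UNIV. ?D (axis j 1) $ i * (x - c) $ j) = ?D (x - c) $ i" for i
  proof -
    have "?D (\<Sum>j\<in>UNIV. (x - c) $ j *\<^sub>R axis j 1) = (\<Sum>j\<in>UNIV. (x - c) $ j *\<^sub>R ?D (axis j 1))"
      by (simp only: linear_sum[OF lin] linear_scale[OF lin])
    moreover have "(\<Sum>j\<in>UNIV. (x - c) $ j *\<^sub>R axis j 1) = x - c"
      using basis_expansion[of "x - c"] by (simp add: scalar_mult_eq_scaleR)
    ultimately have "?D (x - c) = (\<Sum>j\<in>UNIV. (x - c) $ j *\<^sub>R ?D (axis j 1))" by simp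
    then show ?thesis by (simp add: mult.commute)
  qed
  show ?thesis
    unfolding row_div_fun_def div_fun_def vec_eq_iff
    by (simp only: vec_lambda_beta pd sum.distrib sum) simp
qed

lemma row_div_fun_affine:
  fixes \<Psi> :: "space \<Rightarrow> real ^ 3 ^ 3"
  assumes "smooth \<Psi>"
  shows "row_div_fun (\<lambda>x. \<Psi> (t + r *\<^sub>R x)) x = r *\<^sub>R row_div_fun \<Psi> (t + r *\<^sub>R x)"
proof -
  let ?D = "\<lambda>x. frechet_derivative \<Psi> (at x)"
  have 1: "((\<lambda>y. \<Psi> y $ i) has_derivative (\<lambda>h. ?D x h $ i)) (at x)" for i x
    by (rule bounded_linear.has_derivative[OF bounded_linear_vec_nth smooth_has_derivative[OF assms]])
  have "((\<lambda>y. t + r *\<^sub>R y) has_derivative (\<lambda>h. r *\<^sub>R h)) (at x)"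
    by (auto intro!: derivative_eq_intros)
  from has_derivative_compose[OF this 1]
  have 2: "((\<lambda>y. \<Psi> (t + r *\<^sub>R y) $ i) has_derivative (\<lambda>h. ?D (t + r *\<^sub>R x) (r *\<^sub>R h) $ i)) (at x)" for i .
  have "linear (?D y)" for y using smooth_has_derivative[OF assms] by (rule has_derivative_linear)
  then show ?thesis
    by (simp add: row_div_fun_def div_fun_def vec_eq_iff pd_eq[OF 2] pd_eq[OF 1] linear_scale sum_distrib_left)
qed

lemma smooth_outer:
  fixes \<phi> :: "space \<Rightarrow> space"
  assumes "smooth \<phi>"
  shows "smooth (\<lambda>x. \<chi> i. \<phi> x $ i *\<^sub>R (x - c))"
proof -
  \<comment> \<open>\<open>T k\<close> places a vector in row \<open>k\<close> of a zero matrix,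
    which writes the outer product as a finite sum of smooth scalars times smooth matrix
    fields.\<close>
  define T :: "3 \<Rightarrow> space \<Rightarrow> real ^ 3 ^ 3" where "T k h = (\<chi> i. if i = k then h else 0)" for k h
  have "linear (T k)" for k by (rule linearI) (auto simp: T_def vec_eq_iff)
  then have T: "bounded_linear (T k)" for k by (simp add: linear_conv_bounded_linear)
  have "(\<lambda>x. \<chi> i. \<phi> x $ i *\<^sub>R (x - c)) = (\<lambda>x. \<Sum>k\<in>UNIV. (\<phi> x $ k) *\<^sub>R T k (x - c))"
    by (simp add: fun_eq_iff vec_eq_iff T_def if_distrib[of "\<lambda>u. (_ *\<^sub>R u) $ _"] if_distrib[of "\<lambda>u. _ * u $ _"]
        cong: if_cong)
  moreover have "smooth (\<lambda>x. x - c)"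
    by (intro smooth_diff smooth_const smooth_linear bounded_linear_ident)
  ultimately show ?thesis
    using assms by (auto intro!: smooth_sum smooth_scaleR smooth_bounded_linear[OF T]
        smooth_bounded_linear[OF bounded_linear_vec_nth])
qed

lemma test_functions_outer:
  fixes \<phi> :: "space \<Rightarrow> space"
  assumes "\<phi> \<in> test_functions S"
  shows "(\<lambda>x. \<chi> i. \<phi> x $ i *\<^sub>R (x - c)) \<in> test_functions S"
proof -
  obtain K where "compact K" "K \<subseteq> S" "\<And>x. x \<notin> K \<Longrightarrow> \<phi> x = 0"
    using test_functions_support[OF assms] by metis
  then show ?thesis
    by (intro test_functions_supported[of _ K] smooth_outer test_functions_smooth[OF assms])
      (auto simp: vec_eq_iff)
qed

text \<open>The support is shrunk towards \<open>c\<close> by the factor \<open>s\<close>, and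
  convexity keeps the shrunken set inside \<open>P\<close>.\<close>

lemma test_functions_homothety:
  fixes \<psi> :: "'a::euclidean_space \<Rightarrow> 'b::real_normed_vector"
  assumes "\<psi> \<in> test_functions P" "convex P" "c \<in> P" "0 < s" "s \<le> 1"
  shows "(\<lambda>z. \<psi> (c + (1 / s) *\<^sub>R (z - c))) \<in> test_functions P"
proof -
  obtain K where K: "compact K" "K \<subseteq> P" "\<And>x. x \<notin> K \<Longrightarrow> \<psi> x = 0"
    using test_functions_support[OF assms(1)] by metis
  let ?K = "(\<lambda>x. c + s *\<^sub>R (x - c)) ` K"
  show ?thesis
  proof (rule test_functions_supported[of _ ?K])
    have "smooth (\<lambda>z. \<psi> ((c - (1 / s) *\<^sub>R c) + (1 / s) *\<^sub>R z))"
      by (rule smooth_affine[OF bounded_linear_scaleR_right test_functions_smooth[OF assms(1)]])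
    then show "smooth (\<lambda>z. \<psi> (c + (1 / s) *\<^sub>R (z - c)))"
      by (simp add: algebra_simps)
    show "compact ?K"
      by (intro compact_continuous_image K(1) continuous_intros)
    show "?K \<subseteq> P"
    proof
      fix y assume "y \<in> ?K"
      then obtain x where x: "x \<in> P" "y = (1 - s) *\<^sub>R c + s *\<^sub>R x"
        using K(2) by (auto simp: algebra_simps)
      then show "y \<in> P" using assms by (auto intro!: convexD)
    qed
    fix z assume "z \<notin> ?K"
    then have "c + (1 / s) *\<^sub>R (z - c) \<notin> K"
      using assms(4) by (auto simp: image_iff algebra_simps)
    then show "\<psi> (c + (1 / s) *\<^sub>R (z - c)) = 0" by (rule K(3))
  qed
qed

lemma integrable_bounded_support:
  fixes f :: "'a::euclidean_space \<Rightarrow> 'b::euclidean_space"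
  assumes "sq_integrable f" "bounded P" "P \<in> sets borel"
  shows "integrable lborel (\<lambda>x. indicator P x *\<^sub>R f x)"
proof (rule Bochner_Integration.integrable_bound)
  have [measurable]: "f \<in> borel_measurable borel" using assms(1) by (rule sq_integrable_imp_borel)
  have "integrable lborel (indicator P :: 'a \<Rightarrow> real)"
    using assms(2,3) emeasure_bounded_finite by (intro integrable_real_indicator) auto
  then show "integrable lborel (\<lambda>x. indicator P x + (norm (f x))\<^sup>2)"
    using assms(1) by (auto simp: sq_integrable_def)
  show "(\<lambda>x. indicator P x *\<^sub>R f x) \<in> borel_measurable lborel" using assms(3) by measurable
  have "norm (f x) \<le> 1 + (norm (f x))\<^sup>2" for x
    using sum_squares_bound[of "norm (f x)" 1] by (smt (verit) norm_ge_zero one_power2)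
  then show "AE x in lborel. norm (indicator P x *\<^sub>R f x) \<le> norm (indicator P x + (norm (f x))\<^sup>2)"
    by (intro AE_I2) (auto simp: indicator_def)
qed

lemma row_div_fun_scaleR:
  fixes \<Psi> :: "space \<Rightarrow> real ^ 3 ^ 3"
  assumes "smooth \<Psi>"
  shows "row_div_fun (\<lambda>x. a *\<^sub>R \<Psi> x) x = a *\<^sub>R row_div_fun \<Psi> x"
proof -
  let ?D = "frechet_derivative \<Psi> (at x)"
  have 1: "((\<lambda>y. \<Psi> y $ i) has_derivative (\<lambda>h. ?D h $ i)) (at x)" for i
    by (rule bounded_linear.has_derivative[OF bounded_linear_vec_nth smooth_has_derivative[OF assms]])
  have 2: "((\<lambda>y. (a *\<^sub>R \<Psi> y) $ i) has_derivative (\<lambda>h. a *\<^sub>R (?D h $ i))) (at x)" for i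
    using has_derivative_scaleR_right[OF 1] by simp
  show ?thesis
    by (simp only: row_div_fun_def div_fun_def vec_eq_iff pd_eq[OF 2] pd_eq[OF 1])
      (simp add: sum_distrib_left)
qed

text \<open>The norm on nested vectors is the Frobenius norm, for which a matrix of rank one has the
  product of the norms of its factors.\<close>

lemma norm_outer: "norm (\<chi> i. a $ i *\<^sub>R (h :: real ^ 'n)) = norm (a :: real ^ 'm) * norm h"
  by (simp add: norm_vec_def[of "\<chi> i. a $ i *\<^sub>R h"] norm_vec_def[of a] L2_set_left_distrib)

text \<open>The homotheties \<open>\<phi>\<^sub>s(z) = s\<^sup>-\<^sup>3 \<phi>(c + (z - c)/s)\<close> of a test function satisfy the transport
  equation \<open>\<partial>\<^sub>s \<phi>\<^sub>s + div (\<phi>\<^sub>s \<otimes> (z - c)/s) = 0\<close>, so that the weak gradient controls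
  \<open>(v, \<phi>\<^sub>1) - (v, \<phi>\<^sub>1\<^sub>/\<^sub>2)\<close> although \<open>v\<close> itself is not differentiable.\<close>

lemma homothety_test:
  fixes f \<phi> :: "space \<Rightarrow> space"
  assumes A: "is_vgrad \<Omega> v A" and P: "open P" "convex P" "bounded P" "P \<subseteq> \<Omega>" "c \<in> P"
    and d: "\<And>x. x \<in> P \<Longrightarrow> norm (x - c) \<le> d"
    and f: "sq_integrable f" "v = l2_class f" and \<phi>: "\<phi> \<in> test_functions P"
  shows "(\<integral>x. (f x - f (c + (1/2) *\<^sub>R (x - c))) \<bullet> \<phi> x \<partial>lborel) \<le> 2 * d * norm A * norm (l2_class \<phi>)"
proof -
  \<comment> \<open>\<open>W s\<close> undoes the contraction towards \<open>c\<close> by the factor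
    \<open>s\<close>, so composing with it contracts a test function. \<open>\<Psi>\<close> is the
    outer product of \<open>\<phi>\<close> with \<open>x - c\<close>, and \<open>\<rho>\<close> its
    divergence by rows.\<close>
  define W where "W s z = c + (1 / s) *\<^sub>R (z - c)" for s :: real and z :: space
  define \<Psi> :: "space \<Rightarrow> real ^ 3 ^ 3" where "\<Psi> = (\<lambda>x. \<chi> i. \<phi> x $ i *\<^sub>R (x - c))"
  define \<rho> where "\<rho> = row_div_fun \<Psi>"
  have sm: "smooth \<phi>" using \<phi> by (rule test_functions_smooth)
  have \<Psi>: "\<Psi> \<in> test_functions P" unfolding \<Psi>_def by (rule test_functions_outer[OF \<phi>])
  have \<rho>_eq: "\<rho> x = 3 *\<^sub>R \<phi> x + frechet_derivative \<phi> (at x) (x - c)" for x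
    unfolding \<rho>_def \<Psi>_def by (rule row_div_fun_outer[OF sm])
  have lin: "linear (frechet_derivative \<phi> (at x))" for x
    using smooth_has_derivative[OF sm] by (rule has_derivative_linear)
  have "\<rho> x = 3 *\<^sub>R \<phi> x + (\<Sum>b\<in>Basis. ((x - c) \<bullet> b) *\<^sub>R frechet_derivative \<phi> (at x) b)" for x
  proof -
    have "frechet_derivative \<phi> (at x) (x - c) = frechet_derivative \<phi> (at x) (\<Sum>b\<in>Basis. ((x - c) \<bullet> b) *\<^sub>R b)"
      by (simp add: euclidean_representation)
    then show ?thesis by (simp only: \<rho>_eq linear_sum[OF lin] linear_scale[OF lin])
  qed
  then have \<rho>_fun: "\<rho> = (\<lambda>x. 3 *\<^sub>R \<phi> x + (\<Sum>b\<in>Basis. ((x - c) \<bullet> b) *\<^sub>R frechet_derivative \<phi> (at x) b))"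
    by blast
  have \<rho>_cont: "continuous_on UNIV \<rho>"
    unfolding \<rho>_fun by (intro continuous_intros smooth_continuous sm smooth_frechet_derivative)
  obtain K where K: "compact K" "K \<subseteq> P" "\<And>x. x \<notin> K \<Longrightarrow> \<phi> x = 0"
    using test_functions_support[OF \<phi>] by metis
  have \<rho>0: "\<rho> x = 0" if "x \<notin> K" for x
  proof -
    have "(\<phi> has_derivative (\<lambda>h. 0)) (at x)"
      by (rule has_derivative_transform_within_open[OF has_derivative_const, of "- K"])
        (use K that compact_imp_closed in auto)
    from frechet_derivative_at[OF this] show ?thesis
      unfolding \<rho>_eq using K(3)[OF that] by (simp add: fun_eq_iff)
  qed
  have "bounded (\<rho> ` K)"
    by (intro compact_imp_bounded compact_continuous_image K(1) continuous_on_subset[OF \<rho>_cont]) auto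
  then obtain M0 where M0: "\<And>x. x \<in> K \<Longrightarrow> norm (\<rho> x) \<le> M0" by (auto simp: bounded_iff)
  define M where "M = \<bar>M0\<bar>"
  have M: "norm (\<rho> x) \<le> M" for x
    using M0[of x] \<rho>0[of x] by (cases "x \<in> K") (auto simp: M_def)
  have WP: "W s z \<notin> P" if "z \<notin> P" "0 < s" "s \<le> 1" for s z
  proof
    assume "W s z \<in> P"
    then have "(1 - s) *\<^sub>R c + s *\<^sub>R W s z \<in> P" using P that by (intro convexD) auto
    moreover have "(1 - s) *\<^sub>R c + s *\<^sub>R W s z = z" using that by (simp add: W_def algebra_simps)
    ultimately show False using that by simp
  qed
  have [measurable]: "f \<in> borel_measurable borel" "\<phi> \<in> borel_measurable borel" "\<rho> \<in> borel_measurable borel"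
      "\<Psi> \<in> borel_measurable borel" "P \<in> sets borel"
    using P(1) by (intro sq_integrable_imp_borel f(1) borel_measurable_continuous_onI smooth_continuous
        sm \<rho>_cont test_functions_smooth[OF \<Psi>] borel_open)+
  have [measurable]: "(\<lambda>(s, z). W s z) \<in> borel_measurable (lborel \<Otimes>\<^sub>M lborel)"
    unfolding W_def by measurable
  have Wm[measurable]: "(\<lambda>z. W s z) \<in> borel_measurable borel" for s
    unfolding W_def by measurable
  define I where "I s z = indicator {1/2..1} s * (- (1 / s ^ 4) * (f z \<bullet> \<rho> (W s z)))" for s z

  \<comment> \<open>For fixed \<open>z\<close> this is the fundamental theorem in \<open>s\<close>
    for \<open>(1 / s ^ 3) * (f z \<bullet> \<phi> (W s z))\<close>; only the smooth factor is
    differentiated. The weight at \<open>s = 1/2\<close> is 8.\<close>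
  have transport: "(\<integral>s. I s z \<partial>lborel) = f z \<bullet> \<phi> z - f z \<bullet> (8 *\<^sub>R \<phi> (W (1/2) z))" for z
  proof -
    let ?F = "\<lambda>s. (1 / s ^ 3) * (f z \<bullet> \<phi> (W s z))"
    have "(\<integral>s. indicator {1/2..1} s *\<^sub>R (- (1 / s ^ 4) * (f z \<bullet> \<rho> (W s z))) \<partial>lborel) = ?F 1 - ?F (1/2)"
    proof (rule integral_FTC_atLeastAtMost)
      fix s :: real assume s: "1 / 2 \<le> s" "s \<le> 1"
      have "((\<lambda>s. W s z) has_derivative (\<lambda>h. (- h / s\<^sup>2) *\<^sub>R (z - c))) (at s within {1/2..1})"
        unfolding W_def using s
        by (auto intro!: derivative_eq_intros simp: power2_eq_square field_simps)
      from has_derivative_compose[OF this smooth_has_derivative[OF sm]]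
      have "((\<lambda>s. \<phi> (W s z)) has_derivative
          (\<lambda>h. frechet_derivative \<phi> (at (W s z)) ((- h / s\<^sup>2) *\<^sub>R (z - c)))) (at s within {1/2..1})" .
      moreover have "frechet_derivative \<phi> (at (W s z)) ((- h / s\<^sup>2) *\<^sub>R (z - c))
          = h *\<^sub>R (- (1 / s)) *\<^sub>R frechet_derivative \<phi> (at (W s z)) (W s z - c)" for h
      proof -
        have "(- h / s\<^sup>2) *\<^sub>R (z - c) = (h * (- (1 / s))) *\<^sub>R (W s z - c)"
          by (simp add: W_def power2_eq_square)
        then show ?thesis by (simp only: linear_scale[OF lin] scaleR_scaleR)
      qed
      ultimately have "((\<lambda>s. \<phi> (W s z)) has_vector_derivative
          ((- (1 / s)) *\<^sub>R frechet_derivative \<phi> (at (W s z)) (W s z - c))) (at s within {1/2..1})"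
        by (simp add: has_vector_derivative_def)
      then have "((\<lambda>s. f z \<bullet> \<phi> (W s z)) has_real_derivative
          (f z \<bullet> ((- (1 / s)) *\<^sub>R frechet_derivative \<phi> (at (W s z)) (W s z - c)))) (at s within {1/2..1})"
        unfolding has_real_derivative_iff_has_vector_derivative
        by (rule bounded_linear.has_vector_derivative[OF bounded_linear_inner_right])
      then have "(?F has_real_derivative (- (1 / s ^ 4) * (f z \<bullet> \<rho> (W s z)))) (at s within {1/2..1})"
        using s unfolding \<rho>_eq
        by (auto intro!: derivative_eq_intros simp: inner_simps field_simps eval_nat_numeral)
      then show "(?F has_vector_derivative (- (1 / s ^ 4) * (f z \<bullet> \<rho> (W s z)))) (at s within {1/2..1})"
        by (simp add: has_real_derivative_iff_has_vector_derivative)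
    next
      show "continuous_on {1/2..1} (\<lambda>s. - (1 / s ^ 4) * (f z \<bullet> \<rho> (W s z)))"
        unfolding W_def
        by (intro continuous_intros continuous_on_compose2[OF \<rho>_cont]) auto
    qed simp
    moreover have "W 1 z = z" by (simp add: W_def)
    ultimately show ?thesis by (simp add: I_def power_divide)
  qed

  have ind: "integrable lborel (indicator {1/2..1} :: real \<Rightarrow> real)"
    using emeasure_bounded_finite[of "{1/2..1::real}"] by (intro integrable_real_indicator) auto
  \<comment> \<open>For \<open>s \<le> 1\<close> the map \<open>W s\<close> sends the complement of
    \<open>P\<close> into itself, so the integrand vanishes for \<open>z\<close> outside
    \<open>P\<close>; 16 bounds \<open>1 / s ^ 4\<close> on the interval from 1/2 to 1.\<close>
  have fubini: "integrable (lborel \<Otimes>\<^sub>M lborel) (case_prod I)"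
  proof (rule Bochner_Integration.integrable_bound)
    let ?g = "\<lambda>(s::real, z). indicator {1/2..1} s * (16 * M * (indicator P z * norm (f z)))"
    have fP: "integrable lborel (\<lambda>z. indicator P z * norm (f z))"
      using integrable_norm[OF integrable_bounded_support[OF f(1) P(3)]] by simp
    show "integrable (lborel \<Otimes>\<^sub>M lborel) ?g"
    proof (rule lborel_pair.Fubini_integrable)
      show "AE s in lborel. integrable lborel (\<lambda>z. ?g (s, z))"
        using fP by (intro AE_I2) (auto intro!: integrable_mult_right)
      have "(\<lambda>s. \<integral>z. norm (?g (s, z)) \<partial>lborel)
          = (\<lambda>s. indicator {1/2..1} s * (\<integral>z. 16 * M * (indicator P z * norm (f z)) \<partial>lborel))"
        by (auto simp: fun_eq_iff indicator_def M_def abs_mult)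
      then show "integrable lborel (\<lambda>s. \<integral>z. norm (?g (s, z)) \<partial>lborel)"
        by (auto intro!: integrable_mult_left ind)
    qed measurable
    show "case_prod I \<in> borel_measurable (lborel \<Otimes>\<^sub>M lborel)"
      unfolding I_def by measurable
    have "norm (I s z) \<le> norm (?g (s, z))" for s z
    proof (cases "s \<in> {1/2..1} \<and> z \<in> P")
      case True
      have "(1/2) ^ 4 \<le> s ^ 4" using True by (intro power_mono) auto
      then have "1 / s ^ 4 \<le> 16" using True by (simp add: field_simps)
      have "\<bar>f z \<bullet> \<rho> (W s z)\<bar> \<le> norm (f z) * norm (\<rho> (W s z))" by (rule Cauchy_Schwarz_ineq2)
      also have "\<dots> \<le> norm (f z) * M" by (intro mult_left_mono M) auto
      finally have "1 / s ^ 4 * \<bar>f z \<bullet> \<rho> (W s z)\<bar> \<le> 16 * (norm (f z) * M)"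
        using \<open>1 / s ^ 4 \<le> 16\<close> by (intro mult_mono) auto
      then show ?thesis using True by (simp add: I_def abs_mult M_def mult_ac)
    next
      case False
      have "\<rho> (W s z) = 0" if s: "s \<in> {1/2..1}"
      proof -
        have "W s z \<notin> P" using False s by (intro WP) auto
        with K(2) show ?thesis by (intro \<rho>0) auto
      qed
      then have "I s z = 0" by (auto simp: I_def indicator_def)
      then show ?thesis by simp
    qed
    then show "AE x in lborel \<Otimes>\<^sub>M lborel. norm (case_prod I x) \<le> norm (?g x)" by auto
  qed

  \<comment> \<open>For fixed \<open>s\<close> the integral over space is the defining identity of
    the weak gradient, tested with \<open>\<Theta>\<close>: its divergence by rows is
    \<open>(1 / s ^ 4) *\<^sub>R \<rho> (W s z)\<close>.\<close>
  have inner: "(\<integral>z. I s z \<partial>lborel) \<le> indicator {1/2..1} s * (4 * d * norm A * norm (l2_class \<phi>))" for s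
  proof (cases "s \<in> {1/2..1}")
    case True
    then have s: "1/2 \<le> s" "0 < s" "s \<le> 1" by auto
    define \<Theta> where "\<Theta> = (\<lambda>z. (1 / s ^ 3) *\<^sub>R \<Psi> (W s z))"
    have \<Psi>W: "(\<lambda>z. \<Psi> (W s z)) \<in> test_functions P"
      unfolding W_def by (rule test_functions_homothety[OF \<Psi> P(2,5) s(2,3)])
    have "\<Theta> \<in> test_functions P"
      by (rule test_functions_combine[OF \<Psi>W \<Psi>W])
        (auto simp: \<Theta>_def intro!: smooth_scaleR smooth_const test_functions_smooth[OF \<Psi>W])
    then have \<Theta>: "\<Theta> \<in> test_functions \<Omega>"
      using P(4) by (auto simp: test_functions_def)
    have W_aff: "W s z = (c - (1 / s) *\<^sub>R c) + (1 / s) *\<^sub>R z" for z by (simp add: W_def algebra_simps)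
    have "row_div_fun (\<lambda>z. \<Psi> (W s z)) z = (1 / s) *\<^sub>R \<rho> (W s z)" for z
      unfolding \<rho>_def W_aff by (rule row_div_fun_affine[OF test_functions_smooth[OF \<Psi>]])
    then have rd: "row_div_fun \<Theta> z = (1 / s ^ 4) *\<^sub>R \<rho> (W s z)" for z
      unfolding \<Theta>_def row_div_fun_scaleR[OF test_functions_smooth[OF \<Psi>W]]
      by (simp add: eval_nat_numeral)
    have "\<rho> (W s z) = 0" if "z \<notin> \<Omega>" for z
      using WP[of z s] s that P(4) K(2) \<rho>0 by blast
    then have "l2_restrict \<Omega> (row_div_fun \<Theta>) = l2_class (\<lambda>z. (1 / s ^ 4) *\<^sub>R \<rho> (W s z))"
      unfolding ext[of "row_div_fun \<Theta>", OF rd] by (intro l2_restrict_supported) simp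
    moreover have sq: "sq_integrable (\<lambda>z. (1 / s ^ 4) *\<^sub>R \<rho> (W s z))"
      unfolding W_aff using s
      by (intro sq_integrable_scaleR sq_integrable_affine sq_integrable_compact_support[OF \<rho>_cont K(1) \<rho>0]) auto
    ultimately have "(\<integral>z. I s z \<partial>lborel) = - (v \<bullet> l2_restrict \<Omega> (row_div_fun \<Theta>))"
      using True by (simp add: f inner_l2_class I_def)
    also have "\<dots> = A \<bullet> l2_class \<Theta>"
      using A \<Theta> by (simp add: is_vgrad_def l2_restrict_test)
    also have "\<dots> \<le> norm A * norm (l2_class \<Theta>)" by (rule norm_cauchy_schwarz)
    also have "norm A * norm (l2_class \<Theta>) \<le> norm A * (4 * d * norm (l2_class \<phi>))"
    proof (rule mult_left_mono)
      have d0: "0 \<le> d" using d[OF P(5)] by simp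
      have sq\<phi>: "integrable lborel (\<lambda>x. (norm (\<phi> x))\<^sup>2)"
        using sq_integrable_test[OF \<phi>] by (simp add: sq_integrable_def)
      have nP: "norm (\<Psi> x) \<le> d * norm (\<phi> x)" for x
      proof (cases "x \<in> P")
        case True
        then show ?thesis
          using mult_right_mono[OF d[of x] norm_ge_zero[of "\<phi> x"]] by (simp add: \<Psi>_def norm_outer mult.commute)
      next
        case False
        then have "\<phi> x = 0" using K(2) by (intro K(3)) auto
        then show ?thesis unfolding \<Psi>_def norm_outer by simp
      qed
      have "(norm (l2_class \<Theta>))\<^sup>2 = (\<integral>z. (norm (\<Theta> z))\<^sup>2 \<partial>lborel)"
        by (rule norm_l2_class_sq[OF sq_integrable_test[OF \<Theta>]])
      also have "\<dots> = s ^ 3 * (\<integral>x. (norm ((1 / s ^ 3) *\<^sub>R \<Psi> x))\<^sup>2 \<partial>lborel)"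
      proof -
        have "W s ((c - s *\<^sub>R c) + s *\<^sub>R x) = x" for x
          using s by (simp add: W_def algebra_simps)
        then show ?thesis
          using s by (subst lborel_integral_affine[where r = s and t = "c - s *\<^sub>R c"]) (simp_all add: \<Theta>_def)
      qed
      also have "\<dots> \<le> s ^ 3 * (\<integral>x. (1 / s ^ 6 * d\<^sup>2) * (norm (\<phi> x))\<^sup>2 \<partial>lborel)"
      proof (intro mult_left_mono integral_mono_AE' AE_I2)
        fix x
        have "(norm (\<Psi> x))\<^sup>2 \<le> (d * norm (\<phi> x))\<^sup>2" by (intro power_mono nP) simp
        then show "(norm ((1 / s ^ 3) *\<^sub>R \<Psi> x))\<^sup>2 \<le> (1 / s ^ 6 * d\<^sup>2) * (norm (\<phi> x))\<^sup>2"
          using s by (simp add: power_mult_distrib power_divide divide_right_mono flip: power_mult)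
      qed (use s sq\<phi> in auto)
      also have "\<dots> = d\<^sup>2 / s ^ 3 * (norm (l2_class \<phi>))\<^sup>2"
        unfolding norm_l2_class_sq[OF sq_integrable_test[OF \<phi>]] integral_mult_right_zero
        using s by (simp add: field_simps eval_nat_numeral)
      \<comment> \<open>Already 8 bounds \<open>1 / s ^ 3\<close> here; 16 has the round square root
        4, and the length 1/2 of the interval in \<open>s\<close> turns \<open>4 * d\<close> into
        the final \<open>2 * d\<close>.\<close>
      also have "\<dots> \<le> (16 * d\<^sup>2) * (norm (l2_class \<phi>))\<^sup>2"
      proof (rule mult_right_mono)
        have "(1/2) ^ 3 \<le> s ^ 3" using s by (intro power_mono) auto
        then have "1 / s ^ 3 \<le> 16" using s by (simp add: field_simps)
        then show "d\<^sup>2 / s ^ 3 \<le> 16 * d\<^sup>2"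
          using mult_left_mono[of "1 / s ^ 3" 16 "d\<^sup>2"] by (simp add: mult.commute)
      qed simp
      also have "\<dots> = (4 * d * norm (l2_class \<phi>))\<^sup>2" by (simp add: power_mult_distrib)
      finally show "norm (l2_class \<Theta>) \<le> 4 * d * norm (l2_class \<phi>)"
        by (rule power2_le_imp_le) (simp add: d0)
    qed simp
    finally show ?thesis using True by (simp add: mult_ac)
  qed (simp add: I_def)

  \<comment> \<open>The Jacobian \<open>(1/2) ^ 3\<close> of the substitution cancels the weight
    8.\<close>
  have half: "(\<integral>z. f z \<bullet> (8 *\<^sub>R \<phi> (W (1/2) z)) \<partial>lborel) = (\<integral>x. f (c + (1/2) *\<^sub>R (x - c)) \<bullet> \<phi> x \<partial>lborel)"
  proof -
    have W2: "W (1/2) ((c - (1/2) *\<^sub>R c) + (1/2) *\<^sub>R x) = x" for x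
      by (simp add: W_def algebra_simps)
    have eq: "c + (1/2) *\<^sub>R (x - c) = (c - (1/2) *\<^sub>R c) + (1/2) *\<^sub>R x" for x
      by (simp add: algebra_simps)
    show ?thesis
      unfolding eq
      by (subst lborel_integral_affine[where r = "1/2" and t = "c - (1/2) *\<^sub>R c"])
        (simp_all add: W2[simplified] power3_eq_cube)
  qed
  have sqh: "sq_integrable (\<lambda>x. f (c + (1/2) *\<^sub>R (x - c)))"
    using sq_integrable_affine[OF f(1), of "1/2" "c - (1/2) *\<^sub>R c"] by (simp add: algebra_simps)
  have sqW: "sq_integrable (\<lambda>z. 8 *\<^sub>R \<phi> (W (1/2) z))"
    using sq_integrable_affine[OF sq_integrable_test[OF \<phi>], of "2" "c - 2 *\<^sub>R c"]
    by (intro sq_integrable_scaleR) (simp add: W_def algebra_simps)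
  note sq\<phi> = sq_integrable_test[OF \<phi>]
  have "(\<integral>x. (f x - f (c + (1/2) *\<^sub>R (x - c))) \<bullet> \<phi> x \<partial>lborel)
      = (\<integral>x. f x \<bullet> \<phi> x \<partial>lborel) - (\<integral>x. f (c + (1/2) *\<^sub>R (x - c)) \<bullet> \<phi> x \<partial>lborel)"
    unfolding inner_diff_left
    by (intro Bochner_Integration.integral_diff integrable_inner_sq f(1) sqh sq\<phi>)
  also have "\<dots> = (\<integral>z. (\<integral>s. I s z \<partial>lborel) \<partial>lborel)"
    unfolding transport half[symmetric]
    by (intro Bochner_Integration.integral_diff[symmetric] integrable_inner_sq f(1) sqW sq\<phi>)
  also have "\<dots> = (\<integral>s. (\<integral>z. I s z \<partial>lborel) \<partial>lborel)"
    by (rule lborel_pair.Fubini_integral[OF fubini])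
  also have "\<dots> \<le> (\<integral>s. indicator {1/2..1::real} s * (4 * d * norm A * norm (l2_class \<phi>)) \<partial>lborel)"
    by (intro integral_mono lborel_pair.integrable_fst fubini inner integrable_mult_left ind)
  also have "\<dots> = 2 * d * norm A * norm (l2_class \<phi>)" by simp
  finally show ?thesis .
qed

text \<open>Duality: \<open>homothety_test\<close> holds for every test function on \<open>P\<close>
  and therefore bounds the norm over \<open>P\<close>. Contraction by 1/2 sends \<open>x\<close> to
  the midpoint of \<open>x\<close> and \<open>c\<close>, an expression symmetric in both points, and
  \<open>convex_poincare\<close> relies on this symmetry.\<close>

lemma homothety_estimate:
  fixes f :: "space \<Rightarrow> space"
  assumes A: "is_vgrad \<Omega> v A" and P: "open P" "convex P" "bounded P" "P \<subseteq> \<Omega>" "c \<in> P"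
    and d: "\<And>x. x \<in> P \<Longrightarrow> norm (x - c) \<le> d"
    and f: "sq_integrable f" "v = l2_class f"
  shows "(\<integral>\<^sup>+x\<in>P. ennreal ((norm (f x - f ((1/2) *\<^sub>R (x + c))))\<^sup>2) \<partial>lborel) \<le> ennreal ((2 * d * norm A)\<^sup>2)"
proof -
  define g where "g = (\<lambda>x. f x - f (c + (1/2) *\<^sub>R (x - c)))"
  have g_eq: "g x = f x - f ((1/2) *\<^sub>R (x + c))" for x
    unfolding g_def by (simp add: algebra_simps)
      (metis (no_types, lifting) diff_add_cancel scaleR_half_double scaleR_left.add add.commute diff_diff_eq2 add_diff_cancel_left' scaleR_add_right)
  have "sq_integrable (\<lambda>x. f ((c - (1/2) *\<^sub>R c) + (1/2) *\<^sub>R x))"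
    by (rule sq_integrable_affine[OF f(1)]) simp
  then have sqg: "sq_integrable g"
    unfolding g_def by (intro sq_integrable_diff f(1)) (simp add: algebra_simps)
  have [measurable]: "P \<in> sets borel" "g \<in> borel_measurable borel"
    using P(1) sqg by (auto intro: sq_integrable_imp_borel)
  define w where "w = (\<lambda>x. indicator P x *\<^sub>R g x)"
  have sqw: "sq_integrable w"
    unfolding w_def
    by (rule sq_integrable_dominated[where g = "\<lambda>x. (norm (g x))\<^sup>2"])
      (use sqg in \<open>auto simp: sq_integrable_def indicator_def\<close>)
  have d0: "0 \<le> d" using d[OF P(5)] by simp
  have "norm (l2_class w) \<le> 2 * d * norm A"
  proof (rule L2_le_by_test_functions[OF P(1)])
    show "l2_class w \<in> L2 P" using sqw by (intro L2I) (auto simp: w_def)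
    fix \<phi> :: "space \<Rightarrow> space" assume \<phi>: "\<phi> \<in> test_functions P"
    obtain K where K: "K \<subseteq> P" "\<And>x. x \<notin> K \<Longrightarrow> \<phi> x = 0"
      using test_functions_support[OF \<phi>] by metis
    have "w x \<bullet> \<phi> x = g x \<bullet> \<phi> x" for x
      using K(1) K(2)[of x] by (cases "x \<in> P"; cases "x \<in> K") (auto simp: w_def)
    then have "l2_class w \<bullet> l2_class \<phi> = (\<integral>x. g x \<bullet> \<phi> x \<partial>lborel)"
      by (simp add: inner_l2_class sqw sq_integrable_test[OF \<phi>])
    also have "\<dots> \<le> 2 * d * norm A * norm (l2_class \<phi>)"
      unfolding g_def using homothety_test[OF A P d f \<phi>] by simp
    finally show "l2_class w \<bullet> l2_class \<phi> \<le> 2 * d * norm A * norm (l2_class \<phi>)" .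
  qed (use d0 in auto)
  then have "(norm (l2_class w))\<^sup>2 \<le> (2 * d * norm A)\<^sup>2" by (intro power_mono) auto
  then have "(\<integral>\<^sup>+x. ennreal ((norm (w x))\<^sup>2) \<partial>lborel) \<le> ennreal ((2 * d * norm A)\<^sup>2)"
    unfolding nn_integral_l2_class[OF sqw] by (rule ennreal_leI)
  moreover have "(\<integral>\<^sup>+x. ennreal ((norm (w x))\<^sup>2) \<partial>lborel)
      = (\<integral>\<^sup>+x\<in>P. ennreal ((norm (f x - f ((1/2) *\<^sub>R (x + c))))\<^sup>2) \<partial>lborel)"
    by (intro nn_integral_cong) (auto simp: w_def g_eq indicator_def)
  ultimately show ?thesis by simp
qed

text \<open>The square of \<open>norm (f x - f y)\<close>, integrated over both variables in
  \<open>P\<close>, equals \<open>2 * p * (norm (l2_class F))\<^sup>2\<close> minus twice the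
  squared norm of the integral of \<open>F\<close>. Comparing both values with the one at the
  midpoint, and applying \<open>homothety_estimate\<close> once with centre \<open>y\<close> and
  once with centre \<open>x\<close>, bounds it by
  \<open>4 * p * (2 * d * norm A)\<^sup>2\<close>.\<close>

lemma convex_poincare:
  fixes f :: "space \<Rightarrow> space"
  assumes A: "is_vgrad \<Omega> v A" and P: "open P" "convex P" "bounded P" "P \<subseteq> \<Omega>"
    and d: "\<And>x y. x \<in> P \<Longrightarrow> y \<in> P \<Longrightarrow> norm (x - y) \<le> d" "0 \<le> d"
    and f: "sq_integrable f" "v = l2_class f"
  defines "p \<equiv> measure lborel P" and "F \<equiv> \<lambda>x. indicator P x *\<^sub>R f x"
  shows "p * (norm (l2_class F))\<^sup>2 \<le> (norm (\<integral>x. F x \<partial>lborel))\<^sup>2 + p * (8 * d\<^sup>2 * (norm A)\<^sup>2)"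
proof -
  have [measurable]: "f \<in> borel_measurable borel" "P \<in> sets borel"
    using f(1) P(1) by (auto intro: sq_integrable_imp_borel)
  have Pfin: "emeasure lborel P < \<infinity>" using P(3) by (rule emeasure_bounded_finite)
  have p0: "0 \<le> p" "emeasure lborel P = ennreal p"
    using Pfin by (auto simp: p_def emeasure_eq_ennreal_measure)
  have iP: "integrable lborel (indicator P :: space \<Rightarrow> real)"
    using Pfin by (intro integrable_real_indicator) auto
  have pint: "(\<integral>x. indicator P x \<partial>lborel) = p" by (simp add: p_def)
  have iF: "integrable lborel F" unfolding F_def by (rule integrable_bounded_support) (use f P in auto)
  have sqF: "sq_integrable F"
    unfolding F_def
    by (rule sq_integrable_dominated[where g = "\<lambda>x. (norm (f x))\<^sup>2"])
      (use f in \<open>auto simp: sq_integrable_def indicator_def\<close>)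
  then have iF2: "integrable lborel (\<lambda>x. (norm (F x))\<^sup>2)" by (simp add: sq_integrable_def)
  define a where "a = (norm (l2_class F))\<^sup>2"
  have a: "a = (\<integral>x. (norm (F x))\<^sup>2 \<partial>lborel)" unfolding a_def by (rule norm_l2_class_sq[OF sqF])
  define m where "m = (\<integral>x. F x \<partial>lborel)"
  define B where "B = (2 * d * norm A)\<^sup>2"
  have B0: "0 \<le> B" by (simp add: B_def)
  define q where "q x y = indicator P x * (norm (f x - f ((1/2) *\<^sub>R (x + y))))\<^sup>2" for x y
  have [measurable]: "(\<lambda>(x, y). q x y) \<in> borel_measurable (lborel \<Otimes>\<^sub>M lborel)"
    unfolding q_def by measurable
  have q: "(\<integral>\<^sup>+x. ennreal (q x y) \<partial>lborel) \<le> ennreal B" if "y \<in> P" for y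
  proof -
    have "(\<integral>\<^sup>+x. ennreal (q x y) \<partial>lborel)
        = (\<integral>\<^sup>+x\<in>P. ennreal ((norm (f x - f ((1/2) *\<^sub>R (x + y))))\<^sup>2) \<partial>lborel)"
      by (intro nn_integral_cong) (auto simp: q_def indicator_def)
    also have "\<dots> \<le> ennreal B"
      unfolding B_def by (rule homothety_estimate[OF A P that _ f]) (use d that in auto)
    finally show ?thesis .
  qed
  have qq: "(\<integral>\<^sup>+y. \<integral>\<^sup>+x. ennreal (indicator P y * q x y) \<partial>lborel \<partial>lborel) \<le> ennreal (p * B)"
  proof -
    have "(\<integral>\<^sup>+y. \<integral>\<^sup>+x. ennreal (indicator P y * q x y) \<partial>lborel \<partial>lborel)
        \<le> (\<integral>\<^sup>+y. ennreal B * indicator P y \<partial>lborel)"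
      by (intro nn_integral_mono) (use q in \<open>auto simp: indicator_def\<close>)
    also have "\<dots> = ennreal (p * B)"
      using p0 B0 by (simp add: nn_integral_cmult ennreal_mult mult.commute)
    finally show ?thesis .
  qed

  \<comment> \<open>For \<open>y\<close> in \<open>P\<close> this is the expanded integral over
    \<open>x\<close> in \<open>P\<close> of the square of \<open>norm (f x - f y)\<close>; for other
    \<open>y\<close> it is 0.\<close>
  define h where "h y = indicator P y * a - 2 * (m \<bullet> F y) + p * (norm (F y))\<^sup>2" for y
  have h: "ennreal (h y) = (\<integral>\<^sup>+x. ennreal (indicator P y * (indicator P x * (norm (f x - f y))\<^sup>2)) \<partial>lborel)" for y
  proof (cases "y \<in> P")
    case True
    have eq: "indicator P x * (norm (f x - f y))\<^sup>2
        = (norm (F x))\<^sup>2 - 2 * (F x \<bullet> f y) + indicator P x * (norm (f y))\<^sup>2" for x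
      by (simp add: F_def power2_norm_eq_inner inner_diff algebra_simps inner_commute indicator_def)
    have i: "integrable lborel (\<lambda>x. indicator P x * (norm (f x - f y))\<^sup>2)"
      unfolding eq by (intro Bochner_Integration.integrable_add Bochner_Integration.integrable_diff iF2
          integrable_mult_right integrable_inner_left iF integrable_mult_left iP)
    have "(\<integral>x. indicator P x * (norm (f x - f y))\<^sup>2 \<partial>lborel) = a - 2 * (m \<bullet> f y) + p * (norm (f y))\<^sup>2"
      unfolding eq by (simp add: iF2 iF iP a m_def p_def)
    also have "\<dots> = h y" using True by (simp add: h_def F_def)
    finally show ?thesis
      using True nn_integral_eq_integral[OF i] by simp
  qed (simp add: h_def F_def)
  have ih: "integrable lborel h"
    unfolding h_def by (intro Bochner_Integration.integrable_add Bochner_Integration.integrable_diff iF2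
        integrable_mult_right integrable_inner_right iF integrable_mult_left iP)
  have hint: "(\<integral>y. h y \<partial>lborel) = 2 * p * a - 2 * (norm m)\<^sup>2"
  proof -
    have 1: "integrable lborel (\<lambda>y. indicator P y * a)" "integrable lborel (\<lambda>y. 2 * (m \<bullet> F y))"
      "integrable lborel (\<lambda>y. p * (norm (F y))\<^sup>2)"
      by (intro integrable_mult_right integrable_inner_right iF integrable_mult_left iP iF2)+
    have "(\<integral>y. h y \<partial>lborel) = (\<integral>y. indicator P y * a \<partial>lborel) - (\<integral>y. 2 * (m \<bullet> F y) \<partial>lborel)
        + (\<integral>y. p * (norm (F y))\<^sup>2 \<partial>lborel)"
      unfolding h_def
      by (simp only: Bochner_Integration.integral_add[OF Bochner_Integration.integrable_diff[OF 1(1,2)] 1(3)]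
          Bochner_Integration.integral_diff[OF 1(1,2)])
    also have "(\<integral>y. indicator P y * a \<partial>lborel) = p * a"
      by (simp only: integral_mult_left_zero pint)
    also have "(\<integral>y. p * (norm (F y))\<^sup>2 \<partial>lborel) = p * a"
      by (simp only: integral_mult_right_zero a[symmetric])
    also have "(\<integral>y. 2 * (m \<bullet> F y) \<partial>lborel) = 2 * (norm m)\<^sup>2"
      using integral_inner_right[OF iF, of m] by (simp add: m_def[symmetric] power2_norm_eq_inner)
    finally show ?thesis by simp
  qed
  \<comment> \<open>The positive part of \<open>h\<close> gives the inequality without deciding the
    sign of \<open>h\<close> itself.\<close>
  have "ennreal (\<integral>y. h y \<partial>lborel) \<le> (\<integral>\<^sup>+y. ennreal (h y) \<partial>lborel)"
  proof -
    have i: "integrable lborel (\<lambda>y. max 0 (h y))" by (intro integrable_max ih) simp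
    have "(\<integral>y. h y \<partial>lborel) \<le> (\<integral>y. max 0 (h y) \<partial>lborel)" by (intro integral_mono ih i) auto
    then have "ennreal (\<integral>y. h y \<partial>lborel) \<le> (\<integral>\<^sup>+y. ennreal (max 0 (h y)) \<partial>lborel)"
      using nn_integral_eq_integral[OF i] by (simp add: ennreal_leI)
    also have "\<dots> = (\<integral>\<^sup>+y. ennreal (h y) \<partial>lborel)"
      by (intro nn_integral_cong) (simp add: max_def ennreal_neg)
    finally show ?thesis .
  qed
  also have "(\<integral>\<^sup>+y. ennreal (h y) \<partial>lborel)
      = (\<integral>\<^sup>+y. \<integral>\<^sup>+x. ennreal (indicator P y * (indicator P x * (norm (f x - f y))\<^sup>2)) \<partial>lborel \<partial>lborel)"
    by (simp only: h)
  also have "\<dots> \<le> (\<integral>\<^sup>+y. \<integral>\<^sup>+x. 2 * ennreal (indicator P y * q x y) + 2 * ennreal (indicator P x * q y x) \<partial>lborel \<partial>lborel)"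
  proof (intro nn_integral_mono)
    fix x y
    have "(norm (f x - f y))\<^sup>2 \<le> 2 * (norm (f x - f ((1/2) *\<^sub>R (x + y))))\<^sup>2 + 2 * (norm (f y - f ((1/2) *\<^sub>R (y + x))))\<^sup>2"
      using norm_add_sq_le[of "f x - f ((1/2) *\<^sub>R (x + y))" "f ((1/2) *\<^sub>R (y + x)) - f y"]
      by (simp add: add.commute norm_minus_commute)
    then have "indicator P y * (indicator P x * (norm (f x - f y))\<^sup>2)
        \<le> 2 * (indicator P y * q x y) + 2 * (indicator P x * q y x)"
      by (auto simp: q_def indicator_def)
    from ennreal_leI[OF this]
    show "ennreal (indicator P y * (indicator P x * (norm (f x - f y))\<^sup>2))
        \<le> 2 * ennreal (indicator P y * q x y) + 2 * ennreal (indicator P x * q y x)"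
      by (simp add: ennreal_plus ennreal_mult q_def)
  qed
  also have "\<dots> = 2 * (\<integral>\<^sup>+y. \<integral>\<^sup>+x. ennreal (indicator P y * q x y) \<partial>lborel \<partial>lborel)
      + 2 * (\<integral>\<^sup>+y. \<integral>\<^sup>+x. ennreal (indicator P x * q y x) \<partial>lborel \<partial>lborel)"
    by (simp add: nn_integral_add nn_integral_cmult)
  \<comment> \<open>The two halves agree after exchanging the roles of \<open>x\<close> and
    \<open>y\<close>, by Tonelli.\<close>
  also have "(\<integral>\<^sup>+y. \<integral>\<^sup>+x. ennreal (indicator P x * q y x) \<partial>lborel \<partial>lborel)
      = (\<integral>\<^sup>+y. \<integral>\<^sup>+x. ennreal (indicator P y * q x y) \<partial>lborel \<partial>lborel)"
    by (rule lborel_pair.Fubini') measurable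
  also have "2 * (\<integral>\<^sup>+y. \<integral>\<^sup>+x. ennreal (indicator P y * q x y) \<partial>lborel \<partial>lborel)
      + 2 * (\<integral>\<^sup>+y. \<integral>\<^sup>+x. ennreal (indicator P y * q x y) \<partial>lborel \<partial>lborel)
      \<le> 2 * ennreal (p * B) + 2 * ennreal (p * B)"
    by (intro add_mono mult_left_mono qq) auto
  also have "\<dots> = ennreal (4 * (p * B))"
    using p0 B0 by (simp add: ennreal_mult ennreal_plus[symmetric] del: ennreal_plus flip: distrib_right)
  finally have "(\<integral>y. h y \<partial>lborel) \<le> 4 * (p * B)"
    using p0 B0 by (simp add: ennreal_le_iff)
  then show ?thesis
    unfolding hint by (simp add: a_def m_def B_def power_mult_distrib algebra_simps)
qed

section \<open>Decomposition of a Lipschitz polyhedron into convex pieces\<close>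

lemma interior_closure_lipschitz:
  assumes "open \<Omega>" "lipschitz_boundary \<Omega>"
  shows "interior (closure \<Omega>) \<subseteq> \<Omega>"
proof
  fix x assume x: "x \<in> interior (closure \<Omega>)"
  show "x \<in> \<Omega>"
  proof (rule ccontr)
    assume "x \<notin> \<Omega>"
    with x have fr: "x \<in> frontier \<Omega>"
      using assms(1) interior_subset by (auto simp: frontier_def interior_open)
    obtain U and Q :: "space \<Rightarrow> space" and \<gamma> :: "real ^ 2 \<Rightarrow> real" and K where U: "open U" "x \<in> U" "orthogonal_transformation Q" "K-lipschitz_on UNIV \<gamma>"
      "\<Omega> \<inter> U = {y\<in>U. Q y $ 3 < \<gamma> (vector [Q y $ 1, Q y $ 2])}"
      using bspec[OF assms(2)[unfolded lipschitz_boundary_def] fr] by (elim exE conjE) (rule that)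
    \<comment> \<open>\<open>H\<close> is the signed height over the graph: near \<open>x\<close>
      the domain is the set where \<open>H\<close> is negative. Moving from \<open>x\<close> in the
      upward direction \<open>z\<close> raises \<open>H\<close> at unit rate, so points of positive
      height would lie in the closure of the domain, although they have a neighbourhood disjoint
      from it. A slit, for which the claim fails, is ruled out in this way.\<close>
    define H where "H y = Q y $ 3 - \<gamma> (vector [Q y $ 1, Q y $ 2])" for y
    have \<Omega>H: "y \<in> \<Omega> \<longleftrightarrow> H y < 0" if "y \<in> U" for y
      using U(5) that by (auto simp: H_def set_eq_iff)
    have linQ: "linear Q" using U(3) by (rule orthogonal_transformation_linear)
    have contQ: "continuous_on S Q" for S using linQ by (rule linear_continuous_on_compose[OF continuous_on_id, simplified])
    have vec: "(vector [a, b] :: real ^ 2) = a *\<^sub>R axis 1 1 + b *\<^sub>R axis 2 1" for a b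
      by (simp add: vec_eq_iff forall_2 axis_def)
    have contH: "continuous_on UNIV H"
      unfolding H_def vec
      by (intro continuous_intros contQ continuous_on_compose2[OF lipschitz_on_continuous_on[OF U(4)]]) auto
    obtain z where z: "Q z = axis 3 1"
      using orthogonal_transformation_surj[OF U(3)] by (metis surjD)
    have Hz: "H (x + t *\<^sub>R z) = H x + t" for t
      by (simp add: H_def linear_add[OF linQ] linear_scale[OF linQ] z) (simp add: axis_def)
    have "open (U \<inter> interior (closure \<Omega>))" "x \<in> U \<inter> interior (closure \<Omega>)" using x U(1,2) by auto
    then obtain e where e: "0 < e" "ball x e \<subseteq> U \<inter> interior (closure \<Omega>)"
      by (rule openE)
    define t where "t = e / (2 * (norm z + 1))"
    have nz: "0 < norm z + 1" by (simp add: add_nonneg_pos)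
    have t: "0 < t" using e(1) nz by (simp add: t_def)
    have "t * norm z \<le> t * (norm z + 1)" using t by simp
    also have "\<dots> = e / 2" using nz by (simp add: t_def field_simps)
    finally have "x + t *\<^sub>R z \<in> ball x e" using e(1) t by (simp add: dist_norm)
    then have y: "x + t *\<^sub>R z \<in> U" "x + t *\<^sub>R z \<in> closure \<Omega>"
      using subsetD[OF e(2)] subsetD[OF interior_subset, of "x + t *\<^sub>R z" "closure \<Omega>"] by blast+
    have "0 \<le> H x" using \<Omega>H[OF U(2)] \<open>x \<notin> \<Omega>\<close> by simp
    then have "0 < H (x + t *\<^sub>R z)" using t by (simp add: Hz)
    with y have "x + t *\<^sub>R z \<in> (U \<inter> {y. 0 < H y}) \<inter> closure \<Omega>" by blast
    moreover have "open (U \<inter> {y. 0 < H y})"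
      by (intro open_Int U(1) open_Collect_less continuous_on_const contH)
    ultimately obtain y where "y \<in> U" "0 < H y" "y \<in> \<Omega>"
      using open_Int_closure_eq_empty by blast
    then show False using \<Omega>H[of y] by simp
  qed
qed

text \<open>The pieces are the interiors of the polytopes that make up the closure; they lie in
  \<open>\<Omega>\<close> because the domain is on one side of its boundary. What they miss lies in
  frontiers of convex sets, which are null sets. A polytope of lower dimension has empty interior
  and consists of frontier only.\<close>

lemma polyhedron_convex_cover:
  assumes "lipschitz_polyhedron \<Omega>"
  shows "\<exists>\<P>. finite \<P> \<and> (\<forall>P\<in>\<P>. open P \<and> convex P \<and> bounded P \<and> P \<subseteq> \<Omega>) \<and> negligible (\<Omega> - \<Union>\<P>)"
proof -
  obtain \<F> where F: "finite \<F>" "\<And>P. P \<in> \<F> \<Longrightarrow> polytope P" "closure \<Omega> = \<Union>\<F>"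
    using assms by (auto simp: lipschitz_polyhedron_def)
  have \<Omega>: "open \<Omega>" "lipschitz_boundary \<Omega>" using assms by (auto simp: lipschitz_polyhedron_def)
  show ?thesis
  proof (intro exI conjI ballI)
    show "finite (interior ` \<F>)" using F(1) by simp
    fix P assume "P \<in> interior ` \<F>"
    then obtain S where S: "S \<in> \<F>" "P = interior S" by blast
    have "interior S \<subseteq> interior (closure \<Omega>)" using S F(3) by (intro interior_mono) auto
    then show "P \<subseteq> \<Omega>" using S(2) interior_closure_lipschitz[OF \<Omega>] by simp
    show "open P" "convex P" "bounded P"
      using S F(2)[OF S(1)]
      by (auto intro: convex_interior polytope_imp_convex bounded_subset[OF polytope_imp_bounded interior_subset])
  next
    have "negligible (\<Union>(frontier ` \<F>))"
      using F(1,2) by (intro negligible_Union) (auto intro: negligible_convex_frontier polytope_imp_convex)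
    moreover have "\<Omega> - \<Union>(interior ` \<F>) \<subseteq> \<Union>(frontier ` \<F>)"
    proof
      fix x assume x: "x \<in> \<Omega> - \<Union>(interior ` \<F>)"
      then have "x \<in> \<Union>\<F>" using F(3) closure_subset by blast
      then obtain S where "S \<in> \<F>" "x \<in> S" by blast
      with x show "x \<in> \<Union>(frontier ` \<F>)"
        using closure_subset by (auto simp: frontier_def)
    qed
    ultimately show "negligible (\<Omega> - \<Union>(interior ` \<F>))" by (rule negligible_subset)
  qed
qed

text \<open>The integral over \<open>P\<close> is replaced by its coordinates, which are inner
  products of \<open>v\<close> with fixed elements and hence continuous in \<open>v\<close>. The
  constant joins the gradient factor \<open>8 * d\<^sup>2\<close> with the \<open>1 / p\<close> that
  comes from dividing \<open>convex_poincare\<close> by \<open>p\<close>.\<close>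

lemma convex_poincare_finite_rank:
  assumes P: "open P" "convex P" "bounded P" "P \<subseteq> \<Omega>"
  shows "\<exists>C\<ge>0. \<forall>v A f. is_vgrad \<Omega> v A \<longrightarrow> sq_integrable f \<longrightarrow> v = l2_class f \<longrightarrow>
    (norm (l2_class (\<lambda>x. indicator P x *\<^sub>R f x)))\<^sup>2
      \<le> C * ((norm A)\<^sup>2 + (\<Sum>b\<in>Basis. (v \<bullet> l2_class (\<lambda>x. indicator P x *\<^sub>R b))\<^sup>2))"
proof (cases "P = {}")
  case True
  then show ?thesis by (intro exI[of _ 0]) (simp add: l2_class_zero)
next
  case False
  have [measurable]: "P \<in> sets borel" using P(1) by simp
  obtain R where R: "\<And>x. x \<in> P \<Longrightarrow> norm x \<le> R" using P(3) by (auto simp: bounded_iff)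
  define d where "d = 2 * \<bar>R\<bar>"
  have d: "norm (x - y) \<le> d" if "x \<in> P" "y \<in> P" for x y
    using norm_triangle_ineq4[of x y] R[OF that(1)] R[OF that(2)] by (simp add: d_def)
  have d0: "0 \<le> d" by (simp add: d_def)
  define p where "p = measure lborel P"
  have "0 < p"
  proof -
    have "emeasure lborel P \<noteq> 0"
      using open_not_negligible[OF P(1) False] by (auto simp: negligible_iff_emeasure0)
    moreover have "emeasure lborel P < \<infinity>" using P(3) by (rule emeasure_bounded_finite)
    ultimately show ?thesis by (simp add: p_def measure_def enn2real_positive_iff less_top zero_less_iff_neq_zero)
  qed
  have *: "(norm (l2_class (\<lambda>x. indicator P x *\<^sub>R f x)))\<^sup>2
      \<le> (8 * d\<^sup>2 + 1 / p) * ((norm A)\<^sup>2 + (\<Sum>b\<in>Basis. (v \<bullet> l2_class (\<lambda>x. indicator P x *\<^sub>R b))\<^sup>2))"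
    if A: "is_vgrad \<Omega> v A" and f: "sq_integrable f" "v = l2_class f" for v A f
  proof -
    let ?m = "\<integral>x. indicator P x *\<^sub>R f x \<partial>lborel" and ?S = "\<Sum>b\<in>Basis. (v \<bullet> l2_class (\<lambda>x. indicator P x *\<^sub>R b))\<^sup>2"
    let ?N = "(norm (l2_class (\<lambda>x. indicator P x *\<^sub>R f x)))\<^sup>2"
    have mb: "?m \<bullet> b = v \<bullet> l2_class (\<lambda>x. indicator P x *\<^sub>R b)" for b
    proof -
      have "?m \<bullet> b = (\<integral>x. (indicator P x *\<^sub>R f x) \<bullet> b \<partial>lborel)"
        by (rule integral_inner_left[symmetric]) (rule integrable_bounded_support[OF f(1) P(3)], measurable)
      also have "\<dots> = v \<bullet> l2_class (\<lambda>x. indicator P x *\<^sub>R b)"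
        using f P(3) by (simp add: inner_l2_class sq_integrable_indicator)
      finally show ?thesis .
    qed
    have "(norm ?m)\<^sup>2 = (\<Sum>b\<in>Basis. (?m \<bullet> b) * (?m \<bullet> b))"
      by (simp only: power2_norm_eq_inner euclidean_inner[of ?m ?m])
    also have "\<dots> = ?S" by (simp only: mb power2_eq_square)
    finally have "p * ?N \<le> ?S + p * (8 * d\<^sup>2 * (norm A)\<^sup>2)"
      using convex_poincare[OF A P d d0 f] by (simp add: p_def)
    then have "?N \<le> ?S / p + 8 * d\<^sup>2 * (norm A)\<^sup>2"
      using \<open>0 < p\<close> by (simp add: field_simps)
    also have "\<dots> \<le> (8 * d\<^sup>2 + 1 / p) * ((norm A)\<^sup>2 + ?S)"
    proof -
      have "0 \<le> ?S" by (intro sum_nonneg) simp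
      then have "0 \<le> 8 * d\<^sup>2 * ?S + (norm A)\<^sup>2 / p" using \<open>0 < p\<close> by simp
      then show ?thesis by (simp add: algebra_simps)
    qed
    finally show ?thesis .
  qed
  show ?thesis
    using * \<open>0 < p\<close> by (intro exI[of _ "8 * d\<^sup>2 + 1 / p"]) auto
qed

text \<open>Integrals over different pieces are not compared with each other: all of them stay on
  the right-hand side, indexed by piece and basis vector. Overlapping pieces only enlarge the sum of
  the squared norms over the pieces.\<close>

lemma polyhedron_poincare_finite_rank:
  assumes "lipschitz_polyhedron \<Omega>"
  shows "\<exists>(J :: (space set \<times> space) set) (e :: _ \<Rightarrow> vector_field) C. finite J \<and> 0 \<le> C \<and>
    (\<forall>v A. is_vgrad \<Omega> v A \<longrightarrow> (norm v)\<^sup>2 \<le> C * ((norm A)\<^sup>2 + (\<Sum>j\<in>J. (v \<bullet> e j)\<^sup>2)))"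
proof -
  obtain \<P> where \<P>: "finite \<P>" "\<And>P. P \<in> \<P> \<Longrightarrow> open P \<and> convex P \<and> bounded P \<and> P \<subseteq> \<Omega>"
    "negligible (\<Omega> - \<Union>\<P>)"
    using polyhedron_convex_cover[OF assms] by blast
  define e :: "space set \<times> space \<Rightarrow> vector_field" where
    "e = (\<lambda>(P, b). l2_class (\<lambda>x. indicator P x *\<^sub>R b))"
  define J :: "(space set \<times> space) set" where "J = \<P> \<times> Basis"
  define Q where "Q P C \<longleftrightarrow> 0 \<le> C \<and> (\<forall>v A f. is_vgrad \<Omega> v A \<longrightarrow> sq_integrable f \<longrightarrow> v = l2_class f \<longrightarrow>
    (norm (l2_class (\<lambda>x. indicator P x *\<^sub>R f x)))\<^sup>2
      \<le> C * ((norm A)\<^sup>2 + (\<Sum>b\<in>Basis. (v \<bullet> l2_class (\<lambda>x. indicator P x *\<^sub>R b))\<^sup>2)))" for P C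
  have "\<exists>C. Q P C" if "P \<in> \<P>" for P
    unfolding Q_def using convex_poincare_finite_rank[of P \<Omega>] \<P>(2)[OF that] by blast
  then obtain c where cQ: "\<And>P. P \<in> \<P> \<Longrightarrow> Q P (c P)" by metis
  have c: "\<And>P. P \<in> \<P> \<Longrightarrow> 0 \<le> c P"
    "\<And>P v A f. P \<in> \<P> \<Longrightarrow> is_vgrad \<Omega> v A \<Longrightarrow> sq_integrable f \<Longrightarrow> v = l2_class f \<Longrightarrow>
      (norm (l2_class (\<lambda>x. indicator P x *\<^sub>R f x)))\<^sup>2
        \<le> c P * ((norm A)\<^sup>2 + (\<Sum>b\<in>Basis. (v \<bullet> l2_class (\<lambda>x. indicator P x *\<^sub>R b))\<^sup>2))"
    using cQ unfolding Q_def by blast+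
  have "(norm v)\<^sup>2 \<le> (\<Sum>P\<in>\<P>. c P) * ((norm A)\<^sup>2 + (\<Sum>j\<in>J. (v \<bullet> e j)\<^sup>2))" if A: "is_vgrad \<Omega> v A" for v A
  proof -
    have "v \<in> L2 \<Omega>" using A by (simp add: is_vgrad_def)
    then obtain f where f: "sq_integrable f" "\<And>x. x \<notin> \<Omega> \<Longrightarrow> f x = 0" "v = l2_class f"
      by (rule L2E) blast
    have [measurable]: "f \<in> borel_measurable borel" using f(1) by (rule sq_integrable_imp_borel)
    have if2: "integrable lborel (\<lambda>x. (norm (f x))\<^sup>2)" using f(1) by (simp add: sq_integrable_def)
    have sqP: "sq_integrable (\<lambda>x. indicator P x *\<^sub>R f x)" if "P \<in> \<P>" for P
    proof (rule sq_integrable_dominated[OF _ if2])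
      have [measurable]: "P \<in> sets borel" using \<P>(2)[OF that] by auto
      show "(\<lambda>x. indicator P x *\<^sub>R f x) \<in> borel_measurable lborel" by measurable
    qed (auto simp: indicator_def)
    have sqPi: "integrable lborel (\<lambda>x. (norm (indicator P x *\<^sub>R f x))\<^sup>2)" if "P \<in> \<P>" for P
      using sqP[OF that] unfolding sq_integrable_def by (rule conjunct2)
    have "\<Omega> - \<Union>\<P> \<in> sets borel"
      using assms \<P>(2) by (intro sets.Diff borel_open open_Union) (auto simp: lipschitz_polyhedron_def)
    then have "\<Omega> - \<Union>\<P> \<in> null_sets lborel"
      using \<P>(3) by (simp add: negligible_iff_null_sets null_sets_completion_iff)
    then have "AE x in lborel. x \<notin> \<Omega> - \<Union>\<P>" by (rule AE_not_in)
    then have ae: "AE x in lborel. (norm (f x))\<^sup>2 \<le> (\<Sum>P\<in>\<P>. (norm (indicator P x *\<^sub>R f x))\<^sup>2)"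
    proof eventually_elim
      fix x assume x: "x \<notin> \<Omega> - \<Union>\<P>"
      show "(norm (f x))\<^sup>2 \<le> (\<Sum>P\<in>\<P>. (norm (indicator P x *\<^sub>R f x))\<^sup>2)"
      proof (cases "x \<in> \<Omega>")
        case True
        with x obtain P where "P \<in> \<P>" "x \<in> P" by blast
        then show ?thesis
          using member_le_sum[of P \<P> "\<lambda>P. (norm (indicator P x *\<^sub>R f x))\<^sup>2"] \<P>(1) by simp
      qed (simp add: f(2) sum_nonneg)
    qed
    have "(norm v)\<^sup>2 = (\<integral>x. (norm (f x))\<^sup>2 \<partial>lborel)" unfolding f(3) by (rule norm_l2_class_sq[OF f(1)])
    also have "\<dots> \<le> (\<integral>x. (\<Sum>P\<in>\<P>. (norm (indicator P x *\<^sub>R f x))\<^sup>2) \<partial>lborel)"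
      by (intro integral_mono_AE if2 ae Bochner_Integration.integrable_sum sqPi)
    also have "\<dots> = (\<Sum>P\<in>\<P>. (norm (l2_class (\<lambda>x. indicator P x *\<^sub>R f x)))\<^sup>2)"
    proof -
      have "(\<integral>x. (\<Sum>P\<in>\<P>. (norm (indicator P x *\<^sub>R f x))\<^sup>2) \<partial>lborel)
          = (\<Sum>P\<in>\<P>. (\<integral>x. (norm (indicator P x *\<^sub>R f x))\<^sup>2 \<partial>lborel))"
        by (rule Bochner_Integration.integral_sum[OF sqPi])
      also have "\<dots> = (\<Sum>P\<in>\<P>. (norm (l2_class (\<lambda>x. indicator P x *\<^sub>R f x)))\<^sup>2)"
        by (intro sum.cong refl norm_l2_class_sq[symmetric] sqP)
      finally show ?thesis .
    qed
    also have "\<dots> \<le> (\<Sum>P\<in>\<P>. c P * ((norm A)\<^sup>2 + (\<Sum>j\<in>J. (v \<bullet> e j)\<^sup>2)))"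
    proof (rule sum_mono)
      fix P assume P: "P \<in> \<P>"
      have "(\<Sum>b\<in>Basis. (v \<bullet> l2_class (\<lambda>x. indicator P x *\<^sub>R b))\<^sup>2) = (\<Sum>j\<in>{P} \<times> Basis. (v \<bullet> e j)\<^sup>2)"
      proof -
        have "{P} \<times> Basis = Pair P ` (Basis :: space set)" by auto
        then show ?thesis by (simp add: sum.reindex inj_on_def e_def)
      qed
      also have "\<dots> \<le> (\<Sum>j\<in>J. (v \<bullet> e j)\<^sup>2)"
        unfolding J_def using P \<P>(1) by (intro sum_mono2) auto
      finally show "(norm (l2_class (\<lambda>x. indicator P x *\<^sub>R f x)))\<^sup>2 \<le> c P * ((norm A)\<^sup>2 + (\<Sum>j\<in>J. (v \<bullet> e j)\<^sup>2))"
        using c(2)[OF P A f(1,3)] c(1)[OF P] by (meson add_left_mono mult_left_mono order_trans)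
    qed
    finally show ?thesis by (simp add: sum_distrib_right)
  qed
  moreover have "finite J" using \<P>(1) by (simp add: J_def)
  moreover have "0 \<le> (\<Sum>P\<in>\<P>. c P)" using c(1) by (intro sum_nonneg)
  ultimately show ?thesis by blast
qed

section \<open>Compactness: an estimate modulo the kernel from finitely many functionals\<close>

lemma simultaneous_convergent_subsequence:
  fixes a :: "'i \<Rightarrow> nat \<Rightarrow> real"
  assumes "finite J" "\<And>j. j \<in> J \<Longrightarrow> bounded (range (a j))"
  shows "\<exists>r. strict_mono r \<and> (\<forall>j\<in>J. convergent (\<lambda>n. a j (r n)))"
  using assms
proof (induction J)
  case empty
  show ?case by (rule exI[of _ id]) (simp add: strict_mono_def)
next
  case (insert i J)
  then obtain r where r: "strict_mono r" "\<forall>j\<in>J. convergent (\<lambda>n. a j (r n))" by auto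
  have "bounded (range (\<lambda>n. a i (r n)))"
    using insert.prems[of i] by (rule bounded_subset) auto
  then obtain l s where s: "strict_mono s" "((\<lambda>n. a i (r n)) \<circ> s) \<longlonglongrightarrow> l"
    using bounded_imp_convergent_subsequence by blast
  show ?case
  proof (intro exI conjI ballI)
    show "strict_mono (r \<circ> s)" using r(1) s(1) by (rule strict_mono_o)
    fix j assume j: "j \<in> insert i J"
    show "convergent (\<lambda>n. a j ((r \<circ> s) n))"
    proof (cases "j = i")
      case True then show ?thesis using s(2) by (auto simp: comp_def intro: convergentI)
    next
      case False
      then have "convergent ((\<lambda>n. a j (r n)) \<circ> s)"
        using j r(2) by (intro convergent_subseq_convergent s(1)) auto
      then show ?thesis by (simp add: comp_def)
    qed
  qed
qed

text \<open>An argument of Peetre and Tartar.  The elements \<open>k\<close> with \<open>(k, 0) \<in> W\<close> take the place of the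
  functions with vanishing gradient.\<close>

lemma poincare_modulo_kernel:
  fixes W :: "('a::{real_inner, banach} \<times> 'b::real_normed_vector) set"
  assumes W: "subspace W" "closed W" and J: "finite J"
    and est: "\<And>u A. (u, A) \<in> W \<Longrightarrow> (norm u)\<^sup>2 \<le> c * ((norm A)\<^sup>2 + (\<Sum>j\<in>J. (u \<bullet> e j)\<^sup>2))" "0 \<le> c"
  shows "\<exists>C>0. \<forall>(u, A)\<in>W. \<exists>k. (k, 0) \<in> W \<and> norm (u - k) \<le> C * norm A"
proof (rule ccontr)
  assume contr: "\<not> ?thesis"
  define K where "K = {k. (k, 0) \<in> W}"
  \<comment> \<open>Failure of every constant \<open>real (Suc n)\<close> produces a sequence whose
    second components are small compared with the distance of the first ones from
    \<open>K\<close>.\<close>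
  have "\<forall>n. \<exists>u A. (u, A) \<in> W \<and> (\<forall>k\<in>K. norm (u - k) > real (Suc n) * norm A)"
  proof
    fix n
    have "\<not> (\<forall>(u, A)\<in>W. \<exists>k. (k, 0) \<in> W \<and> norm (u - k) \<le> real (Suc n) * norm A)"
    proof
      assume h: "\<forall>(u, A)\<in>W. \<exists>k. (k, 0) \<in> W \<and> norm (u - k) \<le> real (Suc n) * norm A"
      have "\<exists>C>0. \<forall>(u, A)\<in>W. \<exists>k. (k, 0) \<in> W \<and> norm (u - k) \<le> C * norm A"
        by (intro exI[of _ "real (Suc n)"] conjI h) simp
      with contr show False by contradiction
    qed
    then obtain u A where "(u, A) \<in> W" "\<And>k. (k, 0) \<in> W \<Longrightarrow> \<not> norm (u - k) \<le> real (Suc n) * norm A"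
      by blast
    then show "\<exists>u A. (u, A) \<in> W \<and> (\<forall>k\<in>K. norm (u - k) > real (Suc n) * norm A)"
      by (intro exI[of _ u] exI[of _ A]) (auto simp only: K_def not_le mem_Collect_eq)
  qed
  then obtain u A where uA: "\<And>n. (u n, A n) \<in> W"
    "\<And>n k. k \<in> K \<Longrightarrow> norm (u n - k) > real (Suc n) * norm (A n)"
    by metis
  have "0 \<in> K" using subspace_0[OF W(1)] by (simp add: K_def zero_prod_def)
  have "closed K"
  proof -
    have "K = (\<lambda>k. (k, 0)) -` W" by (auto simp: K_def)
    then show ?thesis using W(2) by (simp add: closed_vimage continuous_on_Pair continuous_on_id continuous_on_const)
  qed
  have dpos: "0 < infdist (u n) K" for n
  proof -
    have "u n \<notin> K"
    proof
      assume "u n \<in> K"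
      from uA(2)[OF this, of n] have "real (Suc n) * norm (A n) < 0" by simp
      moreover have "0 \<le> real (Suc n) * norm (A n)" by (intro mult_nonneg_nonneg) auto
      ultimately show False by linarith
    qed
    then show ?thesis
      using \<open>closed K\<close> \<open>0 \<in> K\<close> infdist_nonneg[of "u n" K] in_closed_iff_infdist_zero[of K "u n"] by force
  qed
  \<comment> \<open>An approximation that is best up to the factor 2 takes the place of a projection
    onto \<open>K\<close>; the factor reappears as the separation 1/2 in \<open>far\<close>.\<close>
  have "\<exists>k\<in>K. norm (u n - k) < 2 * infdist (u n) K" for n
  proof -
    have ne: "K \<noteq> {}" using \<open>0 \<in> K\<close> by blast
    have "infdist (u n) K < 2 * infdist (u n) K" using dpos[of n] by simp
    then have "Inf (dist (u n) ` K) < 2 * infdist (u n) K"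
      by (simp only: infdist_notempty[OF ne, symmetric])
    then obtain s where "s \<in> dist (u n) ` K" "s < 2 * infdist (u n) K"
      using cInf_lessD[of "dist (u n) ` K"] ne by blast
    then show ?thesis by (auto simp: dist_norm)
  qed
  then obtain k where k: "\<And>n. k n \<in> K" "\<And>n. norm (u n - k n) < 2 * infdist (u n) K" by metis
  define t where "t n = norm (u n - k n)" for n
  have t0: "0 < t n" for n
    using less_le_trans[OF dpos infdist_le[OF k(1)]] unfolding t_def dist_norm .
  define v where "v n = (u n - k n) /\<^sub>R t n" for n
  define B where "B n = A n /\<^sub>R t n" for n
  have vB: "(v n, B n) \<in> W" for n
  proof -
    have "(u n, A n) - (k n, 0) \<in> W" using W(1) uA(1) k(1) by (intro subspace_diff) (auto simp: K_def)
    then have "(1 / t n) *\<^sub>R ((u n, A n) - (k n, 0)) \<in> W" by (rule subspace_scale[OF W(1)])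
    then show ?thesis by (simp add: v_def B_def inverse_eq_divide)
  qed
  have nv: "norm (v n) = 1" for n using t0[of n] by (simp add: v_def t_def)
  have nB: "norm (B n) < 1 / real (Suc n)" for n
    using uA(2)[OF k(1), of n n] t0[of n] by (simp add: B_def t_def field_simps)
  have far: "1/2 < norm (v n - z)" if "z \<in> K" for n z
  proof -
    have "(k n, 0) + t n *\<^sub>R (z, 0) \<in> W"
      using W(1) k(1) that by (intro subspace_add subspace_scale) (auto simp: K_def)
    then have "k n + t n *\<^sub>R z \<in> K" by (simp add: K_def)
    then have "infdist (u n) K \<le> norm (u n - (k n + t n *\<^sub>R z))"
      using infdist_le by (metis dist_norm)
    also have "u n - (k n + t n *\<^sub>R z) = t n *\<^sub>R (v n - z)"
      using t0[of n] by (simp add: v_def algebra_simps)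
    finally have "infdist (u n) K \<le> t n * norm (v n - z)" using t0[of n] by simp
    moreover have "t n < 2 * infdist (u n) K" using k(2) by (simp add: t_def)
    ultimately have "t n * 1 < t n * (2 * norm (v n - z))" by simp
    then show ?thesis using t0[of n] by (subst (asm) mult_less_cancel_left_pos) auto
  qed
  have "bounded (range (\<lambda>n. v n \<bullet> e j))" for j
    unfolding bounded_iff
  proof (intro exI ballI)
    fix x assume "x \<in> range (\<lambda>n. v n \<bullet> e j)"
    then show "norm x \<le> norm (e j)" using Cauchy_Schwarz_ineq2[of "v _" "e j"] by (auto simp: nv)
  qed
  then obtain r where r: "strict_mono r" "\<forall>j\<in>J. convergent (\<lambda>n. v (r n) \<bullet> e j)"
    using simultaneous_convergent_subsequence[OF J, of "\<lambda>j n. v n \<bullet> e j"] by blast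
  have B0: "B \<longlonglongrightarrow> 0"
    by (rule Lim_null_comparison[OF _ LIMSEQ_inverse_real_of_nat])
      (use nB in \<open>auto intro!: always_eventually less_imp_le simp: inverse_eq_divide\<close>)
  then have Br0: "(\<lambda>n. B (r n)) \<longlonglongrightarrow> 0" using LIMSEQ_subseq_LIMSEQ[OF _ r(1)] by (auto simp: comp_def)
  \<comment> \<open>\<open>W\<close> is a subspace, so \<open>est\<close> applies to differences of
    the normalised sequence: the second components tend to 0, and the finitely many functionals
    converge along \<open>r\<close>.\<close>
  have Cau: "Cauchy (\<lambda>n. v (r n))"
  proof -
    have CB: "Cauchy (\<lambda>n. B (r n))" using Br0 by (intro LIMSEQ_imp_Cauchy)
    have CJ: "Cauchy (\<lambda>n. v (r n) \<bullet> e j)" if "j \<in> J" for j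
      using r(2) that by (auto intro: convergent_Cauchy)
    show ?thesis
      unfolding Cauchy_iff
    proof (intro allI impI)
      fix \<epsilon> :: real assume "0 < \<epsilon>"
      \<comment> \<open>The excess of 1 over \<open>c * (1 + real (card J))\<close> makes the final
        inequality strict.\<close>
      define m where "m = 1 + c * (1 + real (card J))"
      have m: "0 < m" using est(2) by (simp add: m_def add_pos_nonneg)
      define \<delta> where "\<delta> = sqrt (\<epsilon>\<^sup>2 / m)"
      have \<delta>: "0 < \<delta>" "\<delta>\<^sup>2 = \<epsilon>\<^sup>2 / m" using m \<open>0 < \<epsilon>\<close> by (auto simp: \<delta>_def)
      obtain N0 where N0: "\<And>p q. N0 \<le> p \<Longrightarrow> N0 \<le> q \<Longrightarrow> norm (B (r p) - B (r q)) < \<delta>"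
        using CB \<delta>(1) unfolding Cauchy_iff by metis
      have "\<forall>j\<in>J. \<exists>N. \<forall>p\<ge>N. \<forall>q\<ge>N. norm (v (r p) \<bullet> e j - v (r q) \<bullet> e j) < \<delta>"
        using CJ \<delta>(1) unfolding Cauchy_iff by metis
      then obtain N where N: "\<And>j p q. j \<in> J \<Longrightarrow> N j \<le> p \<Longrightarrow> N j \<le> q \<Longrightarrow> norm (v (r p) \<bullet> e j - v (r q) \<bullet> e j) < \<delta>"
        by metis
      show "\<exists>M. \<forall>p\<ge>M. \<forall>q\<ge>M. norm (v (r p) - v (r q)) < \<epsilon>"
      proof (intro exI[of _ "N0 + sum N J"] allI impI)
        fix p q assume pq: "N0 + sum N J \<le> p" "N0 + sum N J \<le> q"
        have "(v (r p), B (r p)) - (v (r q), B (r q)) \<in> W" by (intro subspace_diff W(1) vB)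
        then have "(v (r p) - v (r q), B (r p) - B (r q)) \<in> W" by simp
        from est(1)[OF this]
        have "(norm (v (r p) - v (r q)))\<^sup>2
            \<le> c * ((norm (B (r p) - B (r q)))\<^sup>2 + (\<Sum>j\<in>J. ((v (r p) - v (r q)) \<bullet> e j)\<^sup>2))" .
        also have "\<dots> \<le> c * (\<delta>\<^sup>2 + (\<Sum>j\<in>J. \<delta>\<^sup>2))"
        proof (intro mult_left_mono add_mono sum_mono est(2))
          show "(norm (B (r p) - B (r q)))\<^sup>2 \<le> \<delta>\<^sup>2"
            using N0[of p q] pq by (intro power_mono) auto
          fix j assume j: "j \<in> J"
          have "N j \<le> sum N J" using j J by (intro member_le_sum) auto
          then have "\<bar>(v (r p) - v (r q)) \<bullet> e j\<bar> \<le> \<delta>"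
            using N[OF j, of p q] pq by (simp add: inner_diff_left)
          then show "((v (r p) - v (r q)) \<bullet> e j)\<^sup>2 \<le> \<delta>\<^sup>2"
            using \<delta>(1) by (simp add: abs_le_square_iff[symmetric])
        qed
        also have "\<dots> = (m - 1) * \<delta>\<^sup>2" by (simp add: m_def algebra_simps)
        also have "\<dots> < m * \<delta>\<^sup>2" using \<delta>(1) by simp
        also have "\<dots> = \<epsilon>\<^sup>2" using m by (simp add: \<delta>(2))
        finally show "norm (v (r p) - v (r q)) < \<epsilon>"
          using \<open>0 < \<epsilon>\<close> by (simp add: power_less_imp_less_base)
      qed
    qed
  qed
  then obtain z where z: "(\<lambda>n. v (r n)) \<longlonglongrightarrow> z"
    using Cauchy_convergent convergent_def by blast
  \<comment> \<open>The limit belongs to \<open>K\<close>, although every member of the sequence has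
    distance at least 1/2 from \<open>K\<close>.\<close>
  have "(\<lambda>n. (v (r n), B (r n))) \<longlonglongrightarrow> (z, 0)" by (intro tendsto_Pair z Br0)
  then have "(z, 0) \<in> W" by (rule closed_sequentially[OF W(2), rotated]) (rule vB)
  then have "z \<in> K" by (simp add: K_def)
  have "(\<lambda>n. norm (v (r n) - z)) \<longlonglongrightarrow> 0" using z by (simp add: LIM_zero tendsto_norm_zero)
  then have "(1/2::real) \<le> 0"
    by (rule LIMSEQ_le_const) (use far[OF \<open>z \<in> K\<close>] less_imp_le in blast)
  then show False by simp
qed

section \<open>Weak divergence and trace of the gradient\<close>

text \<open>The value is computed from a chosen representative; for bounded linear \<open>h\<close>,
  the case that occurs below, \<open>l2_map_class\<close> shows that the choice does not
  matter.\<close>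

definition l2_map :: "('b::euclidean_space \<Rightarrow> 'c::euclidean_space) \<Rightarrow> ('a::euclidean_space, 'b) l2 \<Rightarrow> ('a, 'c) l2" where
  "l2_map h u = l2_class (\<lambda>x. h (rep_l2 u x))"

lemma sq_integrable_linear:
  assumes "bounded_linear h" "sq_integrable f"
  shows "sq_integrable (\<lambda>x. h (f x))"
proof (rule sq_integrable_dominated)
  have [measurable]: "f \<in> borel_measurable borel" "h \<in> borel_measurable borel"
    using assms by (auto intro: sq_integrable_imp_borel borel_measurable_continuous_onI linear_continuous_on)
  show "(\<lambda>x. h (f x)) \<in> borel_measurable lborel" by measurable
  show "integrable lborel (\<lambda>x. (onorm h)\<^sup>2 * (norm (f x))\<^sup>2)" using assms(2) by (simp add: sq_integrable_def)
  show "(norm (h (f x)))\<^sup>2 \<le> (onorm h)\<^sup>2 * (norm (f x))\<^sup>2" for x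
    using power_mono[OF onorm[OF assms(1), of "f x"], of 2] by (simp add: power_mult_distrib)
qed

lemma l2_map_class:
  assumes "bounded_linear h" "sq_integrable f"
  shows "l2_map h (l2_class f) = l2_class (\<lambda>x. h (f x))"
proof -
  have "l2_class (rep_l2 (l2_class f)) = l2_class f" by simp
  then have "AE x in lborel. rep_l2 (l2_class f) x = f x"
    using l2_class_eq_iff[OF sq_integrable_rep assms(2), of "l2_class f"] by simp
  then have "AE x in lborel. h (rep_l2 (l2_class f) x) = h (f x)" by eventually_elim simp
  then show ?thesis
    unfolding l2_map_def
    by (rule l2_class_eq_iff[OF sq_integrable_linear[OF assms(1) sq_integrable_rep] sq_integrable_linear[OF assms],
          THEN iffD2])
qed

lemma bounded_linear_l2_map:
  fixes h :: "'b::euclidean_space \<Rightarrow> 'c::euclidean_space"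
  assumes "bounded_linear h"
  shows "bounded_linear (l2_map h :: ('a::euclidean_space, 'b) l2 \<Rightarrow> _)"
proof (rule bounded_linear_intro)
  have lin: "linear h" using assms by (rule bounded_linear.linear)
  fix u v :: "('a, 'b) l2" and r :: real
  obtain f where f: "sq_integrable f" "u = l2_class f" by (rule l2_class_cases)
  obtain g where g: "sq_integrable g" "v = l2_class g" by (rule l2_class_cases)
  have sq: "sq_integrable (\<lambda>x. h (f x))" "sq_integrable (\<lambda>x. h (g x))"
    using f g by (auto intro: sq_integrable_linear[OF assms])
  show "l2_map h (u + v) = l2_map h u + l2_map h v"
    unfolding f g l2_map_class[OF assms f(1)] l2_map_class[OF assms g(1)]
      l2_class_add[OF f(1) g(1), symmetric] l2_map_class[OF assms sq_integrable_add[OF f(1) g(1)]]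
    by (simp add: linear_add[OF lin] l2_class_add sq)
  show "l2_map h (r *\<^sub>R u) = r *\<^sub>R l2_map h u"
    unfolding f l2_map_class[OF assms f(1)]
      l2_class_scaleR[OF f(1), symmetric] l2_map_class[OF assms sq_integrable_scaleR[OF f(1)]]
    by (simp add: linear_scale[OF lin] l2_class_scaleR sq)
  have "(norm (l2_map h u))\<^sup>2 = (\<integral>x. (norm (h (f x)))\<^sup>2 \<partial>lborel)"
    unfolding f l2_map_class[OF assms f(1)] by (rule norm_l2_class_sq[OF sq(1)])
  also have "\<dots> \<le> (\<integral>x. (onorm h)\<^sup>2 * (norm (f x))\<^sup>2 \<partial>lborel)"
  proof (rule integral_mono)
    show "(norm (h (f x)))\<^sup>2 \<le> (onorm h)\<^sup>2 * (norm (f x))\<^sup>2" for x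
      using power_mono[OF onorm[OF assms(1), of "f x"], of 2] by (simp add: power_mult_distrib)
  qed (use sq(1) f(1) in \<open>auto simp: sq_integrable_def\<close>)
  also have "\<dots> = (norm u * onorm h)\<^sup>2"
    by (simp add: f norm_l2_class_sq power_mult_distrib)
  finally show "norm (l2_map h u) \<le> norm u * onorm h"
    by (rule power2_le_imp_le) (simp add: onorm_pos_le[OF assms])
qed

lemma subspace_L2: "subspace (L2 S :: ('a::euclidean_space, 'b::euclidean_space) l2 set)"
proof (rule subspaceI)
  show "0 \<in> (L2 S :: ('a, 'b) l2 set)" using L2I[of "\<lambda>x. 0" S] by (simp add: l2_class_zero)
  fix u v :: "('a, 'b) l2" and c assume u: "u \<in> L2 S"
  obtain f where f: "sq_integrable f" "\<And>x. x \<notin> S \<Longrightarrow> f x = 0" "u = l2_class f" using L2E[OF u] by metis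
  show "c *\<^sub>R u \<in> L2 S"
    using f L2I[OF sq_integrable_scaleR[OF f(1), of c], of S] by (simp add: l2_class_scaleR)
  assume v: "v \<in> L2 S"
  obtain g where g: "sq_integrable g" "\<And>x. x \<notin> S \<Longrightarrow> g x = 0" "v = l2_class g" using L2E[OF v] by metis
  show "u + v \<in> L2 S"
    using f g L2I[OF sq_integrable_add[OF f(1) g(1)], of S] by (simp add: l2_class_add)
qed

lemma is_vgrad_unique:
  assumes "open \<Omega>" "is_vgrad \<Omega> v A" "is_vgrad \<Omega> v B"
  shows "A = B"
proof -
  have "A - B = 0"
    using assms by (intro L2_eq_0_by_test_functions[OF assms(1)] subspace_diff[OF subspace_L2])
      (auto simp: is_vgrad_def inner_diff_left l2_restrict_test)
  then show ?thesis by simp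
qed

lemma is_div_unique:
  assumes "open \<Omega>" "is_div \<Omega> v d" "is_div \<Omega> v e"
  shows "d = e"
proof -
  have "d - e = 0"
    using assms by (intro L2_eq_0_by_test_functions[OF assms(1)] subspace_diff[OF subspace_L2])
      (auto simp: is_div_def inner_diff_left l2_restrict_test)
  then show ?thesis by simp
qed

lemma is_vgrad_vgrad:
  assumes "open \<Omega>" "v \<in> VH1 \<Omega>"
  shows "is_vgrad \<Omega> v (vgrad \<Omega> v)"
  using assms unfolding VH1_def vgrad_def by (auto intro: theI' is_vgrad_unique)

lemma subspace_is_vgrad: "subspace {(v, A). is_vgrad \<Omega> v A}"
proof (rule subspaceI)
  show "0 \<in> {(v, A). is_vgrad \<Omega> v A}"
    by (simp add: zero_prod_def is_vgrad_def subspace_0[OF subspace_L2])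
qed (auto simp: is_vgrad_def inner_add_left intro: subspace_add[OF subspace_L2] subspace_scale[OF subspace_L2])

definition mat_trace :: "real ^ 3 ^ 3 \<Rightarrow> real" where
  "mat_trace M = (\<Sum>i\<in>UNIV. M $ i $ i)"

lemma bounded_linear_mat_trace: "bounded_linear mat_trace"
proof -
  have "linear mat_trace"
    by (rule linearI) (simp_all add: mat_trace_def sum.distrib sum_distrib_left)
  then show ?thesis by (simp add: linear_conv_bounded_linear)
qed

text \<open>Test the weak gradient with \<open>\<phi>\<close> times the identity matrix: the
  divergence of this matrix field by rows is the gradient of \<open>\<phi>\<close>.\<close>

lemma is_div_mat_trace:
  assumes "is_vgrad \<Omega> v A"
  shows "is_div \<Omega> v (l2_map mat_trace A)"
  unfolding is_div_def
proof (intro conjI ballI)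
  show "v \<in> L2 \<Omega>" using assms by (simp add: is_vgrad_def)
  have "A \<in> L2 \<Omega>" using assms by (simp add: is_vgrad_def)
  then obtain F where F: "sq_integrable F" "\<And>x. x \<notin> \<Omega> \<Longrightarrow> F x = 0" "A = l2_class F" using L2E by metis
  have sqF: "sq_integrable (\<lambda>x. mat_trace (F x))"
    by (rule sq_integrable_linear[OF bounded_linear_mat_trace F(1)])
  have tr: "l2_map mat_trace A = l2_class (\<lambda>x. mat_trace (F x))"
    unfolding F(3) by (rule l2_map_class[OF bounded_linear_mat_trace F(1)])
  show "l2_map mat_trace A \<in> L2 \<Omega>"
    unfolding tr by (rule L2I[OF sqF]) (simp add: F(2) mat_trace_def)
  fix \<phi> :: "space \<Rightarrow> real" assume \<phi>: "\<phi> \<in> test_functions \<Omega>"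
  define \<Phi> :: "space \<Rightarrow> real ^ 3 ^ 3" where "\<Phi> = (\<lambda>x. \<phi> x *\<^sub>R mat 1)"
  note sm = test_functions_smooth[OF \<phi>]
  have \<Phi>: "\<Phi> \<in> test_functions \<Omega>"
    by (rule test_functions_combine[OF \<phi> \<phi>]) (auto simp: \<Phi>_def intro!: smooth_scaleR smooth_const sm)
  have "row_div_fun \<Phi> x = grad_fun \<phi> x" for x
  proof -
    have hd: "((\<lambda>y. \<Phi> y $ i) has_derivative (\<lambda>h. frechet_derivative \<phi> (at x) h *\<^sub>R axis i 1)) (at x)" for i
    proof -
      have "(\<lambda>y. \<Phi> y $ i) = (\<lambda>y. \<phi> y *\<^sub>R axis i 1)"
        by (auto simp: \<Phi>_def fun_eq_iff vec_eq_iff mat_def axis_def)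
      then show ?thesis
        using has_derivative_scaleR_left[OF smooth_has_derivative[OF sm], of "axis i 1 :: space"] by simp
    qed
    have "pd j (\<lambda>y. \<Phi> y $ i) x $ j = (if i = j then pd j \<phi> x else 0)" for i j
      by (subst pd_eq[OF hd]) (simp add: axis_def pd_def)
    then show ?thesis by (simp add: row_div_fun_def div_fun_def grad_fun_def vec_eq_iff)
  qed
  then have rd: "row_div_fun \<Phi> = grad_fun \<phi>" by blast
  have "l2_map mat_trace A \<bullet> l2_restrict \<Omega> \<phi> = (\<integral>x. mat_trace (F x) \<bullet> \<phi> x \<partial>lborel)"
    by (simp add: tr l2_restrict_test[OF \<phi>] inner_l2_class sqF sq_integrable_test[OF \<phi>])
  also have "\<dots> = (\<integral>x. F x \<bullet> \<Phi> x \<partial>lborel)"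
  proof -
    have "mat_trace M = M \<bullet> mat 1" for M
      by (simp add: mat_trace_def inner_vec_def mat_def if_distrib cong: if_cong)
    then show ?thesis by (simp add: \<Phi>_def mult.commute)
  qed
  also have "\<dots> = A \<bullet> l2_restrict \<Omega> \<Phi>"
    by (simp add: F(3) l2_restrict_test[OF \<Phi>] inner_l2_class F(1) sq_integrable_test[OF \<Phi>])
  also have "\<dots> = - (v \<bullet> l2_restrict \<Omega> (grad_fun \<phi>))"
    using assms \<Phi> by (simp add: is_vgrad_def rd)
  finally show "l2_map mat_trace A \<bullet> l2_restrict \<Omega> \<phi> = - (v \<bullet> l2_restrict \<Omega> (grad_fun \<phi>))" .
qed

text \<open>This makes the divergence a bounded linear function of the gradient alone. Hence it
  tends to 0 whenever the gradient does, and it commutes with integrals and weak derivatives in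
  time.\<close>

lemma wdiv_eq_trace:
  assumes "open \<Omega>" "v \<in> VH1 \<Omega>"
  shows "wdiv \<Omega> v = l2_map mat_trace (vgrad \<Omega> v)"
  unfolding wdiv_def
  using is_div_mat_trace[OF is_vgrad_vgrad[OF assms]] is_div_unique[OF assms(1)] by blast

lemma wdiv_L2:
  assumes "open \<Omega>" "v \<in> VH1 \<Omega>"
  shows "wdiv \<Omega> v \<in> L2 \<Omega>"
  using is_div_mat_trace[OF is_vgrad_vgrad[OF assms]] by (simp add: wdiv_eq_trace[OF assms] is_div_def)

text \<open>The inequality with finitely many functionals holds on the span, because the pairs of a
  field and its weak gradient form a subspace, and it survives limits. On the closed span the
  compactness argument applies whatever \<open>S\<close> is, in particular for a set given by a
  trace condition.\<close>

lemma closure_span_poincare: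
  assumes "lipschitz_polyhedron \<Omega>" "S \<subseteq> VH1 \<Omega>"
  defines "W \<equiv> closure (span ((\<lambda>v. (v, vgrad \<Omega> v)) ` S))"
  shows "\<exists>C>0. \<forall>(u, A)\<in>W. \<exists>k. (k, 0) \<in> W \<and> norm (u - k) \<le> C * norm A"
proof -
  obtain J :: "(space set \<times> space) set" and e :: "space set \<times> space \<Rightarrow> vector_field" and c where
    J: "finite J" "0 \<le> c"
    "\<And>v A. is_vgrad \<Omega> v A \<Longrightarrow> (norm v)\<^sup>2 \<le> c * ((norm A)\<^sup>2 + (\<Sum>j\<in>J. (v \<bullet> e j)\<^sup>2))"
    using polyhedron_poincare_finite_rank[OF assms(1)] by blast
  have op: "open \<Omega>" using assms(1) by (simp add: lipschitz_polyhedron_def)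
  have W: "subspace W" "closed W" unfolding W_def by (auto intro: subspace_closure_normed subspace_span)
  show ?thesis
  proof (rule poincare_modulo_kernel[OF W J(1) _ J(2)])
    fix u A assume "(u, A) \<in> W"
    then obtain x where x: "\<And>n. x n \<in> span ((\<lambda>v. (v, vgrad \<Omega> v)) ` S)" "x \<longlonglongrightarrow> (u, A)"
      unfolding W_def closure_sequential by blast
    have "span ((\<lambda>v. (v, vgrad \<Omega> v)) ` S) \<subseteq> {(v, A). is_vgrad \<Omega> v A}"
      using assms(2) by (intro span_minimal subspace_is_vgrad) (auto intro: is_vgrad_vgrad[OF op])
    then have "(norm (fst (x n)))\<^sup>2 \<le> c * ((norm (snd (x n)))\<^sup>2 + (\<Sum>j\<in>J. (fst (x n) \<bullet> e j)\<^sup>2))" for n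
      using J(3)[of "fst (x n)" "snd (x n)"] x(1)[of n] by (auto simp: case_prod_beta)
    moreover have "(\<lambda>n. fst (x n)) \<longlonglongrightarrow> u" "(\<lambda>n. snd (x n)) \<longlonglongrightarrow> A"
      using tendsto_fst[OF x(2)] tendsto_snd[OF x(2)] by auto
    ultimately show "(norm u)\<^sup>2 \<le> c * ((norm A)\<^sup>2 + (\<Sum>j\<in>J. (u \<bullet> e j)\<^sup>2))"
      by (intro LIMSEQ_le[of "\<lambda>n. (norm (fst (x n)))\<^sup>2" _
            "\<lambda>n. c * ((norm (snd (x n)))\<^sup>2 + (\<Sum>j\<in>J. (fst (x n) \<bullet> e j)\<^sup>2))"] tendsto_intros) auto
  qed
qed

section \<open>Weak derivatives in time\<close>

text \<open>The step is the antiderivative of a bump on the unit interval, divided by the total mass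
  \<open>Q 1\<close>.\<close>

lemma smooth_step:
  "\<exists>R R' :: real \<Rightarrow> real. smooth R \<and> continuous_on UNIV R' \<and> (\<forall>x. (R has_real_derivative R' x) (at x)) \<and>
    (\<forall>x\<le>0. R x = 0) \<and> (\<forall>x\<ge>1. R x = 1) \<and> (\<forall>x. 0 \<le> R x \<and> R x \<le> 1) \<and>
    (\<forall>x. 0 \<le> R' x) \<and> (\<forall>x. x \<notin> {0..1} \<longrightarrow> R' x = 0)"
proof -
  define \<rho> :: "real \<Rightarrow> real" where "\<rho> = box_bump 0 1"
  have sm: "smooth \<rho>" unfolding \<rho>_def by (rule smooth_box_bump)
  have cont: "continuous_on S \<rho>" for S using sm by (rule smooth_continuous)
  have \<rho>0: "0 \<le> \<rho> x" for x unfolding \<rho>_def by (rule box_bump_bounds)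
  have \<rho>z: "\<rho> x = 0 \<longleftrightarrow> x \<notin> {0<..<1}" for x unfolding \<rho>_def by (simp add: box_bump_eq_0_iff)
  \<comment> \<open>Starting at -1 places the point 0 in the interior of the interval of
    integration, so that the derivative obtained there is two-sided.\<close>
  define Q where "Q x = integral {-1..x} \<rho>" for x
  have Qneg: "Q x = 0" if "x \<le> 0" for x
  proof -
    have "integral {-1..x} \<rho> = integral {-1..x} (\<lambda>x. 0)"
      by (rule integral_cong) (use that in \<open>simp add: \<rho>z\<close>)
    then show ?thesis by (simp add: Q_def)
  qed
  have deriv: "(Q has_real_derivative \<rho> x) (at x)" for x
  proof (cases "x < 0")
    case True
    have "\<rho> x = 0" using True \<rho>z[of x] by simp
    then have "((\<lambda>x. 0) has_real_derivative \<rho> x) (at x)" by simp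
    then show ?thesis
      by (rule has_field_derivative_transform_within_open[OF _ open_lessThan[of 0]]) (use True Qneg in auto)
  next
    case False
    have "(Q has_real_derivative \<rho> x) (at x within {-1..x + 1})"
      unfolding Q_def[abs_def] by (rule integral_has_real_derivative[OF cont]) (use False in auto)
    moreover have "x \<in> interior {-1..x + 1}" using False by simp
    ultimately show ?thesis by (simp only: at_within_interior)
  qed
  have mono: "Q x \<le> Q y" if "x \<le> y" for x y
  proof (rule DERIV_nonneg_imp_nondecreasing[OF that])
    show "\<exists>y. (Q has_real_derivative y) (at z) \<and> 0 \<le> y" for z
      using deriv \<rho>0 by blast
  qed
  have Qbig: "Q x = Q 1" if "1 \<le> x" for x
  proof (rule antisym[OF _ mono[OF that]])
    have "\<exists>y. (Q has_real_derivative y) (at z) \<and> y \<le> 0" if "1 \<le> z" for z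
      using deriv[of z] \<rho>z[of z] that by auto
    then show "Q x \<le> Q 1" by (intro DERIV_nonpos_imp_nonincreasing[OF that])
  qed
  have pos: "0 < Q 1"
  proof -
    have "Q 1 \<noteq> 0"
    proof
      assume "Q 1 = 0"
      then have "\<forall>x\<in>{-1..1}. \<rho> x = 0"
        using integral_eq_0_iff[of "-1" 1 \<rho>] cont \<rho>0 by (auto simp: Q_def)
      then have "\<rho> (1/2) = 0" by auto
      then show False by (simp add: \<rho>z)
    qed
    then show ?thesis using mono[of 0 1] Qneg[of 0] by simp
  qed
  have bd: "0 \<le> Q x" "Q x \<le> Q 1" for x
    using mono[of 0 x] Qneg[of x] mono[of x 1] Qbig[of x] Qneg[of 0] pos by (cases "x \<le> 0"; cases "x \<le> 1"; force)+
  have smQ: "smooth Q"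
    unfolding smooth_def
  proof
    fix k
    have "C_k k \<rho>" using sm by (simp add: smooth_def)
    then show "C_k k Q" by (rule C_k_Suc_imp[OF C_k_antiderivative[OF deriv]])
  qed
  show ?thesis
  proof (intro exI conjI allI impI)
    show "smooth (\<lambda>x. Q x * inverse (Q 1))" by (intro smooth_mult smQ smooth_const)
    show "continuous_on UNIV (\<lambda>x. \<rho> x * inverse (Q 1))" by (intro continuous_intros cont)
    show "((\<lambda>x. Q x * inverse (Q 1)) has_real_derivative \<rho> x * inverse (Q 1)) (at x)" for x
      by (intro DERIV_cmult_right deriv)
    show "Q x * inverse (Q 1) = 0" if "x \<le> 0" for x using Qneg[OF that] by simp
    show "Q x * inverse (Q 1) = 1" if "1 \<le> x" for x using Qbig[OF that] pos by simp
    show "0 \<le> Q x * inverse (Q 1)" for x using bd(1)[of x] pos by simp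
    show "Q x * inverse (Q 1) \<le> 1" for x using bd(2)[of x] pos by (simp add: divide_inverse[symmetric])
    show "0 \<le> \<rho> x * inverse (Q 1)" for x using \<rho>0[of x] pos by simp
    show "\<rho> x * inverse (Q 1) = 0" if "x \<notin> {0..1}" for x
    proof -
      have "x \<notin> {0<..<1}" using that by auto
      then have "\<rho> x = 0" using \<rho>z by blast
      then show ?thesis by simp
    qed
  qed
qed

section \<open>Integrals over the time interval\<close>

lemma continuous_integrable_lebesgue_on:
  fixes h :: "real \<Rightarrow> 'h::{banach, second_countable_topology}"
  assumes "continuous_on {0..T} h"
  shows "h \<in> borel_measurable (lebesgue_on {0<..<T})" "integrable (lebesgue_on {0<..<T}) h"
proof -
  interpret finite_measure "lebesgue_on {0<..<T}"
    by (rule finite_measure_lebesgue_on) simp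
  show m: "h \<in> borel_measurable (lebesgue_on {0<..<T})"
    by (rule continuous_imp_measurable_on_sets_lebesgue) (auto intro: continuous_on_subset[OF assms])
  have "bounded (h ` {0..T})" by (intro compact_imp_bounded compact_continuous_image assms) simp
  then obtain B where "\<And>x. x \<in> {0..T} \<Longrightarrow> norm (h x) \<le> B" unfolding bounded_iff by blast
  then show "integrable (lebesgue_on {0<..<T}) h"
    by (intro integrable_const_bound[where B = B] m) (auto intro!: AE_I2 simp: space_restrict_space)
qed

lemma lebesgue_on_integral_derivative:
  assumes "0 \<le> T" "\<And>x. (F has_real_derivative k x) (at x)" "continuous_on UNIV k"
  shows "(\<integral>x. k x \<partial>lebesgue_on {0<..<T}) = F T - F 0"
proof -
  have [measurable]: "k \<in> borel_measurable borel" by (rule borel_measurable_continuous_onI[OF assms(3)])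
  have "(\<integral>x. k x \<partial>lebesgue_on {0<..<T}) = (\<integral>x. indicator {0<..<T} x *\<^sub>R k x \<partial>lebesgue)"
    by (rule integral_restrict_space) simp
  also have "\<dots> = (\<integral>x. indicator {0<..<T} x *\<^sub>R k x \<partial>lborel)"
    by (rule integral_completion) measurable
  also have "\<dots> = (\<integral>x. indicator {0..T} x *\<^sub>R k x \<partial>lborel)"
  proof (rule integral_cong_AE)
    have "AE x in lborel. x \<noteq> 0 \<and> x \<noteq> T" by (auto intro: AE_lborel_singleton)
    then show "AE x in lborel. indicator {0<..<T} x *\<^sub>R k x = indicator {0..T} x *\<^sub>R k x"
      by eventually_elim (auto simp: indicator_def)
  qed measurable
  also have "\<dots> = F T - F 0"
  proof (rule integral_FTC_atLeastAtMost[OF assms(1)])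
    show "continuous_on {0..T} k" by (rule continuous_on_subset[OF assms(3)]) simp
    show "(F has_vector_derivative k x) (at x within {0..T})" for x
      using assms(2)[of x] by (simp add: has_real_derivative_iff_has_vector_derivative has_vector_derivative_at_within)
  qed
  finally show ?thesis .
qed

lemma L2_timeD:
  assumes "g \<in> L2_time T X"
  shows "g \<in> borel_measurable (lebesgue_on {0<..<T})" "integrable (lebesgue_on {0<..<T}) (\<lambda>t. (norm (g t))\<^sup>2)"
    "integrable (lebesgue_on {0<..<T}) g" "AE t in lebesgue_on {0<..<T}. g t \<in> X"
proof -
  interpret finite_measure "lebesgue_on {0<..<T}"
    by (rule finite_measure_lebesgue_on) simp
  show m: "g \<in> borel_measurable (lebesgue_on {0<..<T})" "integrable (lebesgue_on {0<..<T}) (\<lambda>t. (norm (g t))\<^sup>2)"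
    "AE t in lebesgue_on {0<..<T}. g t \<in> X"
    using assms by (auto simp: L2_time_def)
  show "integrable (lebesgue_on {0<..<T}) g"
  proof (rule Bochner_Integration.integrable_bound[OF _ m(1)])
    show "integrable (lebesgue_on {0<..<T}) (\<lambda>t. 1 + (norm (g t))\<^sup>2)"
      using m(2) by auto
    have "norm (g t) \<le> 1 + (norm (g t))\<^sup>2" for t
      using sum_squares_bound[of "norm (g t)" 1] by (smt (verit) norm_ge_zero one_power2)
    then show "AE t in lebesgue_on {0<..<T}. norm (g t) \<le> norm (1 + (norm (g t))\<^sup>2)" by (intro AE_I2) auto
  qed
qed

text \<open>The upper limit sits in an indicator, so that all integrals are taken over one measure
  on \<open>{0<..<T}\<close>: continuity in \<open>t\<close> becomes dominated convergence, and
  Fubini is applied to a fixed product measure.\<close>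

definition tint :: "real \<Rightarrow> real \<Rightarrow> (real \<Rightarrow> 'h::{banach, second_countable_topology}) \<Rightarrow> 'h" where
  "tint T t g = (\<integral>s. indicator {..t} s *\<^sub>R g s \<partial>lebesgue_on {0<..<T})"

lemma AE_lebesgue_on_neq: "AE x in lebesgue_on {0<..<T}. x \<noteq> (t::real)"
proof -
  have "AE x in lborel. x \<noteq> t" by (rule AE_lborel_singleton)
  then have "AE x in lebesgue. x \<noteq> t" by (rule AE_completion)
  then show ?thesis by (subst AE_restrict_space_iff) (auto elim: eventually_mono)
qed

lemma tint_0: "tint T 0 g = 0"
proof -
  have "tint T 0 g = (\<integral>s. 0 \<partial>lebesgue_on {0<..<T})"
    unfolding tint_def by (rule Bochner_Integration.integral_cong) (auto simp: space_restrict_space)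
  then show ?thesis by simp
qed

lemma integrable_tint:
  fixes g :: "real \<Rightarrow> 'h::{banach, second_countable_topology}"
  assumes g: "integrable (lebesgue_on {0<..<T}) g"
  shows "integrable (lebesgue_on {0<..<T}) (\<lambda>s. indicator {..t} s *\<^sub>R g s)"
proof (rule Bochner_Integration.integrable_bound[OF g])
  have "(indicator {..t} :: real \<Rightarrow> real) \<in> borel_measurable (lebesgue_on {0<..<T})"
    by (intro measurable_restrict_space1 borel_measurable_indicator) simp
  then show "(\<lambda>s. indicator {..t} s *\<^sub>R g s) \<in> borel_measurable (lebesgue_on {0<..<T})"
    using g by (intro borel_measurable_scaleR) auto
qed (auto simp: indicator_def)

lemma continuous_tint:
  assumes "integrable (lebesgue_on {0<..<T}) g"
  shows "continuous_on S (\<lambda>t. tint T t g)"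
proof (rule continuous_on_sequentiallyI)
  fix u :: "nat \<Rightarrow> real" and a assume u: "u \<longlonglongrightarrow> a"
  show "(\<lambda>n. tint T (u n) g) \<longlonglongrightarrow> tint T a g"
    unfolding tint_def
  proof (rule integral_dominated_convergence[where w = "\<lambda>s. norm (g s)"])
    show "AE s in lebesgue_on {0<..<T}. (\<lambda>n. indicator {..u n} s *\<^sub>R g s) \<longlonglongrightarrow> indicator {..a} s *\<^sub>R g s"
      using AE_lebesgue_on_neq[of a]
    proof eventually_elim
      fix s assume "s \<noteq> a"
      then consider "s < a" | "a < s" by linarith
      then show "(\<lambda>n. indicator {..u n} s *\<^sub>R g s) \<longlonglongrightarrow> indicator {..a} s *\<^sub>R g s"
      proof cases
        case 1
        have "\<forall>\<^sub>F n in sequentially. indicator {..a} s *\<^sub>R g s = indicator {..u n} s *\<^sub>R g s"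
          using order_tendstoD(1)[OF u 1] by eventually_elim (use 1 in simp)
        then show ?thesis by (rule Lim_transform_eventually[OF tendsto_const])
      next
        case 2
        have "\<forall>\<^sub>F n in sequentially. indicator {..a} s *\<^sub>R g s = indicator {..u n} s *\<^sub>R g s"
          using order_tendstoD(2)[OF u 2] by eventually_elim (use 2 in simp)
        then show ?thesis by (rule Lim_transform_eventually[OF tendsto_const])
      qed
    qed
    show "AE s in lebesgue_on {0<..<T}. norm (indicator {..u n} s *\<^sub>R g s) \<le> norm (g s)" for n
      by (auto simp: indicator_def)
  qed (use assms in \<open>auto intro!: borel_measurable_integrable integrable_tint\<close>)
qed

text \<open>The weak derivative is tested with smooth plateaus that rise at \<open>s\<close> and
  fall at \<open>t\<close>. Their derivatives are differences of two approximate identities, which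
  recover values of the continuous \<open>f\<close>, while the plateaus themselves tend to the
  indicator of the half-open interval from \<open>s\<close> to \<open>t\<close>.\<close>

theorem weak_derivative_integral:
  fixes f g :: "real \<Rightarrow> 'h::{banach, second_countable_topology}"
  assumes T: "0 < T" and f: "continuous_on {0..T} f"
    and g: "integrable (lebesgue_on {0<..<T}) g" and fg: "is_time_deriv T f g"
    and t: "t \<in> {0..T}"
  shows "f t = f 0 + tint T t g"
proof -
  let ?M = "lebesgue_on {0<..<T}"
  obtain R R' :: "real \<Rightarrow> real" where R: "smooth R" "continuous_on UNIV R'"
    "\<And>x. (R has_real_derivative R' x) (at x)" "\<And>x. x \<le> 0 \<Longrightarrow> R x = 0" "\<And>x. 1 \<le> x \<Longrightarrow> R x = 1"
    "\<And>x. 0 \<le> R x" "\<And>x. R x \<le> 1" "\<And>x. 0 \<le> R' x" "\<And>x. x \<notin> {0..1} \<Longrightarrow> R' x = 0"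
    using smooth_step by metis
  \<comment> \<open>A kernel to the right of its centre: it is supported in
    \<open>{s..s + 1 / real (Suc n)}\<close> and has mass 1 as soon as this interval fits between 0
    and \<open>T\<close>.\<close>
  define k where "k n s x = real (Suc n) * R' (real (Suc n) * (x - s))" for n s x
  have kd: "((\<lambda>x. R (real (Suc n) * (x - s))) has_real_derivative k n s x) (at x)" for n s x
    unfolding k_def
    by (rule DERIV_chain2[THEN DERIV_cong, OF R(3)]) (auto intro!: derivative_eq_intros)
  have kc: "continuous_on S (k n s)" for n s S
    unfolding k_def[abs_def] by (intro continuous_intros continuous_on_compose2[OF R(2)]) auto
  have k0: "0 \<le> k n s x" for n s x by (simp add: k_def R(8))
  have kz: "k n s x = 0" if "x \<notin> {s..s + 1 / real (Suc n)}" for n s x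
  proof -
    have "real (Suc n) * (x - s) \<notin> {0..1}"
      using that by (auto simp: field_simps zero_le_mult_iff simp del: of_nat_Suc)
    then show ?thesis by (simp add: k_def R(9) del: of_nat_Suc)
  qed
  have ki: "integrable ?M (\<lambda>x. k n s x *\<^sub>R f x)" for n s
    by (intro continuous_integrable_lebesgue_on continuous_on_scaleR kc f)
  have small: "\<forall>\<^sub>F n in sequentially. 1 / real (Suc n) < e" if "0 < e" for e
    using order_tendstoD(2)[OF LIMSEQ_inverse_real_of_nat that] by (simp add: inverse_eq_divide)
  have klim: "(\<lambda>n. \<integral>x. k n s x *\<^sub>R f x \<partial>?M) \<longlonglongrightarrow> f s" if s: "0 \<le> s" "s < T" for s
  proof (rule tendstoI)
    fix e :: real assume e: "0 < e"
    obtain d where d: "0 < d" "\<And>x. x \<in> {0..T} \<Longrightarrow> dist x s < d \<Longrightarrow> dist (f x) (f s) < e / 2"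
      using f s e unfolding continuous_on_iff by (metis atLeastAtMost_iff half_gt_zero less_imp_le)
    have "0 < min d (T - s)" using d s by simp
    from small[OF this] show "\<forall>\<^sub>F n in sequentially. dist (\<integral>x. k n s x *\<^sub>R f x \<partial>?M) (f s) < e"
    proof eventually_elim
      fix n assume n: "1 / real (Suc n) < min d (T - s)"
      have kint: "integrable ?M (k n s)" by (intro continuous_integrable_lebesgue_on kc)
      have "(\<integral>x. k n s x \<partial>?M) = R (real (Suc n) * (T - s)) - R (real (Suc n) * (0 - s))"
        using T by (intro lebesgue_on_integral_derivative kd kc) simp
      moreover have "1 \<le> real (Suc n) * (T - s)" using n by (simp add: field_simps)
      ultimately have k1: "(\<integral>x. k n s x \<partial>?M) = 1" using s by (simp add: R(4,5) mult_nonneg_nonneg)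
      have "(\<integral>x. k n s x *\<^sub>R f x \<partial>?M) - f s = (\<integral>x. k n s x *\<^sub>R f x \<partial>?M) - (\<integral>x. k n s x *\<^sub>R f s \<partial>?M)"
        using kint by (simp add: k1)
      also have "\<dots> = (\<integral>x. k n s x *\<^sub>R (f x - f s) \<partial>?M)"
        using ki kint by (simp add: scaleR_diff_right)
      finally have eq: "(\<integral>x. k n s x *\<^sub>R f x \<partial>?M) - f s = (\<integral>x. k n s x *\<^sub>R (f x - f s) \<partial>?M)" .
      have "norm ((\<integral>x. k n s x *\<^sub>R f x \<partial>?M) - f s) \<le> (\<integral>x. norm (k n s x *\<^sub>R (f x - f s)) \<partial>?M)"
        unfolding eq by (rule integral_norm_bound)
      also have "\<dots> \<le> (\<integral>x. k n s x * (e / 2) \<partial>?M)"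
      proof (rule integral_mono)
        show "integrable ?M (\<lambda>x. norm (k n s x *\<^sub>R (f x - f s)))"
          by (intro integrable_norm continuous_integrable_lebesgue_on continuous_intros kc f)
        show "integrable ?M (\<lambda>x. k n s x * (e / 2))" using kint by simp
        fix x assume "x \<in> space ?M"
        then have x: "x \<in> {0..T}" by (simp add: space_restrict_space)
        show "norm (k n s x *\<^sub>R (f x - f s)) \<le> k n s x * (e / 2)"
        proof (cases "x \<in> {s..s + 1 / real (Suc n)}")
          case True
          then have "dist x s < d" using n by (simp add: dist_real_def)
          then have "norm (f x - f s) \<le> e / 2" using d(2)[OF x] by (simp add: dist_norm)
          from mult_left_mono[OF this k0[of n s x]] show ?thesis
            by (simp only: norm_scaleR abs_of_nonneg[OF k0])
        qed (simp add: kz)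
      qed
      also have "\<dots> = e / 2" by (simp add: k1)
      finally show "dist (\<integral>x. k n s x *\<^sub>R f x \<partial>?M) (f s) < e" using e by (simp add: dist_norm)
    qed
  qed

  have diff: "f t - f s = tint T t g - tint T s g" if st: "0 < s" "s < t" "t < T" for s t
  proof -
    define \<phi> where "\<phi> n x = R (real (Suc n) * (x - s)) - R (real (Suc n) * (x - t))" for n x
    have smR: "smooth (\<lambda>x. R (real (Suc n) * (x - s)))" for n s
      using smooth_affine[OF bounded_linear_mult_right R(1), of "- (real (Suc n) * s)" "real (Suc n)"]
      by (simp add: algebra_simps)
    have d\<phi>: "deriv (\<phi> n) x = k n s x - k n t x" for n x
      unfolding \<phi>_def by (intro DERIV_imp_deriv DERIV_diff kd)
    \<comment> \<open>The falling edge occupies \<open>{t..t + 1 / real (Suc n)}\<close>, so the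
      plateau is guaranteed to be a test function only for large \<open>n\<close>.\<close>
    have Tt: "0 < T - t" using st by simp
    have test: "\<forall>\<^sub>F n in sequentially. \<phi> n \<in> test_functions {0<..<T}"
      using small[OF Tt]
    proof eventually_elim
      fix n assume n: "1 / real (Suc n) < T - t"
      show "\<phi> n \<in> test_functions {0<..<T}"
      proof (rule test_functions_supported[of _ "{s..t + 1 / real (Suc n)}"])
        show "smooth (\<phi> n)" unfolding \<phi>_def[abs_def] by (intro smooth_diff smR)
        fix x assume "x \<notin> {s..t + 1 / real (Suc n)}"
        then consider "x < s" | "t + 1 / real (Suc n) < x" by fastforce
        then show "\<phi> n x = 0"
        proof cases
          case 1
          then have "real (Suc n) * (x - s) \<le> 0" "real (Suc n) * (x - t) \<le> 0"
            using st by (auto intro!: mult_nonneg_nonpos)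
          then show ?thesis by (simp only: \<phi>_def R(4))
        next
          case 2
          then have "1 \<le> real (Suc n) * (x - t)" by (simp add: field_simps)
          moreover have "real (Suc n) * (x - t) \<le> real (Suc n) * (x - s)"
            using st by (intro mult_left_mono) auto
          ultimately have "1 \<le> real (Suc n) * (x - t)" "1 \<le> real (Suc n) * (x - s)" by linarith+
          then show ?thesis by (simp only: \<phi>_def R(5))
        qed
      qed (use st n in auto)
    qed
    have l1: "(\<lambda>n. (\<integral>x. k n s x *\<^sub>R f x \<partial>?M) - (\<integral>x. k n t x *\<^sub>R f x \<partial>?M)) \<longlonglongrightarrow> f s - f t"
      using st by (intro tendsto_diff klim) auto
    have l2: "(\<lambda>n. - (\<integral>x. \<phi> n x *\<^sub>R g x \<partial>?M)) \<longlonglongrightarrow> - (\<integral>x. (indicator {..t} x - indicator {..s} x) *\<^sub>R g x \<partial>?M)"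
    proof (intro tendsto_minus integral_dominated_convergence[where w = "\<lambda>x. norm (g x)"])
      show "AE x in ?M. (\<lambda>n. \<phi> n x *\<^sub>R g x) \<longlonglongrightarrow> (indicator {..t} x - indicator {..s} x) *\<^sub>R g x"
      proof (intro AE_I2 tendsto_scaleR tendsto_const)
        fix x
        have lim: "(\<lambda>n. R (real (Suc n) * (x - r))) \<longlonglongrightarrow> 1 - indicator {..r} x" for r
        proof (cases "x \<le> r")
          case True
          then have "R (real (Suc n) * (x - r)) = 0" for n by (intro R(4)) (auto intro!: mult_nonneg_nonpos)
          with True show ?thesis by simp
        next
          case False
          then have xr: "0 < x - r" by simp
          have "\<forall>\<^sub>F n in sequentially. 1 - indicator {..r} x = R (real (Suc n) * (x - r))"
            using small[OF xr]
          proof eventually_elim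
            fix n assume "1 / real (Suc n) < x - r"
            then have "1 \<le> real (Suc n) * (x - r)" by (simp add: field_simps)
            then show "1 - indicator {..r} x = R (real (Suc n) * (x - r))" using R(5) xr by simp
          qed
          then show ?thesis by (rule Lim_transform_eventually[OF tendsto_const])
        qed
        show "(\<lambda>n. \<phi> n x) \<longlonglongrightarrow> indicator {..t} x - indicator {..s} x"
          using tendsto_diff[OF lim[of s] lim[of t]] by (simp add: \<phi>_def)
      qed
      have "\<bar>\<phi> n x\<bar> \<le> 1" for n x
        using R(6,7)[of "real (Suc n) * (x - s)"] R(6,7)[of "real (Suc n) * (x - t)"] unfolding \<phi>_def by linarith
      then show "AE x in ?M. norm (\<phi> n x *\<^sub>R g x) \<le> norm (g x)" for n
        by (intro AE_I2) (simp add: mult_left_le_one_le)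
      have "\<phi> n \<in> borel_measurable ?M" for n
        unfolding \<phi>_def by (intro continuous_integrable_lebesgue_on continuous_intros smooth_continuous smR)
      then show "(\<lambda>x. \<phi> n x *\<^sub>R g x) \<in> borel_measurable ?M" for n
        using g by (intro borel_measurable_scaleR) auto
      have "(\<lambda>x. indicator {..t} x *\<^sub>R g x - indicator {..s} x *\<^sub>R g x) \<in> borel_measurable ?M"
        using integrable_tint[OF g] by (intro borel_measurable_diff borel_measurable_integrable)
      then show "(\<lambda>x. (indicator {..t} x - indicator {..s} x) *\<^sub>R g x) \<in> borel_measurable ?M"
        by (simp add: scaleR_diff_left)
    qed (use g in auto)
    have ev: "\<forall>\<^sub>F n in sequentially. - (\<integral>x. \<phi> n x *\<^sub>R g x \<partial>?M)
        = (\<integral>x. k n s x *\<^sub>R f x \<partial>?M) - (\<integral>x. k n t x *\<^sub>R f x \<partial>?M)"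
      using test
    proof eventually_elim
      fix n assume "\<phi> n \<in> test_functions {0<..<T}"
      then have "(\<integral>x. deriv (\<phi> n) x *\<^sub>R f x \<partial>?M) = - (\<integral>x. \<phi> n x *\<^sub>R g x \<partial>?M)"
        using fg unfolding is_time_deriv_def by blast
      then have "- (\<integral>x. \<phi> n x *\<^sub>R g x \<partial>?M) = (\<integral>x. (k n s x - k n t x) *\<^sub>R f x \<partial>?M)"
        by (simp only: d\<phi>)
      also have "\<dots> = (\<integral>x. k n s x *\<^sub>R f x \<partial>?M) - (\<integral>x. k n t x *\<^sub>R f x \<partial>?M)"
        using ki by (simp add: scaleR_diff_left)
      finally show "- (\<integral>x. \<phi> n x *\<^sub>R g x \<partial>?M) = (\<integral>x. k n s x *\<^sub>R f x \<partial>?M) - (\<integral>x. k n t x *\<^sub>R f x \<partial>?M)" .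
    qed
    have "f s - f t = - (\<integral>x. (indicator {..t} x - indicator {..s} x) *\<^sub>R g x \<partial>?M)"
      by (rule LIMSEQ_unique[OF l1 Lim_transform_eventually[OF l2 ev]])
    also have "(\<integral>x. (indicator {..t} x - indicator {..s} x) *\<^sub>R g x \<partial>?M) = tint T t g - tint T s g"
      using integrable_tint[OF g] by (simp add: tint_def scaleR_diff_left)
    finally show ?thesis by (simp add: algebra_simps)
  qed

  \<comment> \<open>By \<open>diff\<close> this function is constant on the open interval, and it is
    continuous on the closed one, so the identity reaches both end points.\<close>
  define D where "D t = f t - tint T t g" for t
  have Dc: "continuous_on (closure {0<..<T}) D"
    using T unfolding D_def by (simp add: f continuous_tint[OF g] continuous_on_diff)
  have "D x = D (T / 2)" if "x \<in> {0<..<T}" for x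
  proof (cases x "T / 2" rule: linorder_cases)
    case less
    then show ?thesis using diff[of x "T / 2"] that T by (simp add: D_def algebra_simps)
  next
    case greater
    then show ?thesis using diff[of "T / 2" x] that T by (simp add: D_def algebra_simps)
  next
    case equal
    then show ?thesis by (simp only:)
  qed
  then have "D x = D (T / 2)" if "x \<in> closure {0<..<T}" for x
    using continuous_constant_on_closure[OF Dc _ that] by blast
  from this[of t] this[of 0] have "D t = D 0" using t T by (simp add: closure_greaterThanLessThan)
  then have "f t - tint T t g = f 0" by (simp only: D_def tint_0 diff_zero)
  then show ?thesis by (simp only: diff_eq_eq)
qed

section \<open>Integration by parts in time\<close>

lemma integrable_inner_continuous:
  fixes a g :: "real \<Rightarrow> 'h::{real_inner, banach, second_countable_topology}"
  assumes a: "integrable (lebesgue_on {0<..<T}) a" and g: "continuous_on {0..T} g"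
  shows "integrable (lebesgue_on {0<..<T}) (\<lambda>s. a s \<bullet> g s)"
proof -
  have "bounded (g ` {0..T})" by (intro compact_imp_bounded compact_continuous_image g) simp
  then obtain B where B: "\<And>x. x \<in> {0..T} \<Longrightarrow> norm (g x) \<le> B" unfolding bounded_iff by blast
  show ?thesis
  proof (rule Bochner_Integration.integrable_bound)
    show "integrable (lebesgue_on {0<..<T}) (\<lambda>s. norm (a s) * B)" using a by simp
    show "(\<lambda>s. a s \<bullet> g s) \<in> borel_measurable (lebesgue_on {0<..<T})"
      using a continuous_integrable_lebesgue_on(1)[OF g] by (intro borel_measurable_inner) auto
    show "AE s in lebesgue_on {0<..<T}. norm (a s \<bullet> g s) \<le> norm (norm (a s) * B)"
    proof (rule AE_I2)
      fix s assume "s \<in> space (lebesgue_on {0<..<T})"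
      then have "norm (g s) \<le> B" by (intro B) (simp add: space_restrict_space)
      have "\<bar>a s \<bullet> g s\<bar> \<le> norm (a s) * norm (g s)" by (rule Cauchy_Schwarz_ineq2)
      also have "\<dots> \<le> norm (a s) * B" using \<open>norm (g s) \<le> B\<close> by (rule mult_left_mono) simp
      also have "\<dots> \<le> norm (norm (a s) * B)" by simp
      finally show "norm (a s \<bullet> g s) \<le> norm (norm (a s) * B)" by simp
    qed
  qed
qed

lemma tint_add:
  assumes "integrable (lebesgue_on {0<..<T}) a" "integrable (lebesgue_on {0<..<T}) b"
  shows "tint T t (\<lambda>s. a s + b s) = tint T t a + tint T t b"
  unfolding tint_def scaleR_add_right by (intro Bochner_Integration.integral_add integrable_tint assms)

lemma tint_bounded_linear:
  assumes "bounded_linear h" "integrable (lebesgue_on {0<..<T}) a"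
  shows "tint T t (\<lambda>s. h (a s)) = h (tint T t a)"
proof -
  have "tint T t (\<lambda>s. h (a s)) = (\<integral>s. h (indicator {..t} s *\<^sub>R a s) \<partial>lebesgue_on {0<..<T})"
    unfolding tint_def by (simp add: linear_scale[OF bounded_linear.linear[OF assms(1)]])
  also have "\<dots> = h (tint T t a)"
    unfolding tint_def by (rule integral_bounded_linear[OF assms(1) integrable_tint[OF assms(2)]])
  finally show ?thesis .
qed

text \<open>The inner product of the two integrals up to \<open>t\<close> is an integral over a
  square, and the triangles on either side of the diagonal produce the two terms on the left. The
  hypotheses are integral representations, so the theorem can be applied to one function with two
  formally different derivatives.\<close>

theorem inner_integration_by_parts:
  fixes f g f' g' :: "real \<Rightarrow> 'h::{real_inner, banach, second_countable_topology}"
  assumes int: "integrable (lebesgue_on {0<..<T}) f'" "integrable (lebesgue_on {0<..<T}) g'"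
    and f: "\<forall>t\<in>{0..T}. f t = f 0 + tint T t f'"
    and g: "\<forall>t\<in>{0..T}. g t = g 0 + tint T t g'"
    and t: "t \<in> {0..T}"
  shows "tint T t (\<lambda>s. f' s \<bullet> g s) + tint T t (\<lambda>s. f s \<bullet> g' s) = f t \<bullet> g t - f 0 \<bullet> g 0"
proof -
  define M where "M = lebesgue_on {0<..<T}"
  interpret finite_measure M unfolding M_def by (rule finite_measure_lebesgue_on) simp
  interpret MM: pair_sigma_finite M M by unfold_locales
  have id[measurable]: "(\<lambda>x. x) \<in> borel_measurable M"
    unfolding M_def by (intro measurable_restrict_space1 measurable_completion) simp
  have intM: "integrable M f'" "integrable M g'" using int by (simp_all add: M_def)
  then have [measurable]: "f' \<in> borel_measurable M" "g' \<in> borel_measurable M" by auto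
  define P where "P s r = indicator {..t} s * indicator {..t} r * (f' s \<bullet> g' r)" for s r
  have [measurable]: "(\<lambda>(s, r). P s r) \<in> borel_measurable (M \<Otimes>\<^sub>M M)"
    unfolding P_def by measurable
  have iP: "integrable (M \<Otimes>\<^sub>M M) (\<lambda>(s, r). c s r * P s r)"
    if c: "(\<lambda>(s, r). c s r) \<in> borel_measurable (M \<Otimes>\<^sub>M M)" "\<And>s r. \<bar>c s r\<bar> \<le> (1::real)" for c
  proof (rule Bochner_Integration.integrable_bound)
    show "integrable (M \<Otimes>\<^sub>M M) (\<lambda>(s, r). norm (f' s) * norm (g' r))"
    proof (rule MM.Fubini_integrable)
      show "integrable M (\<lambda>s. \<integral>r. norm (case (s, r) of (s, r) \<Rightarrow> norm (f' s) * norm (g' r)) \<partial>M)"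
        using intM by simp
      show "AE s in M. integrable M (\<lambda>r. case (s, r) of (s, r) \<Rightarrow> norm (f' s) * norm (g' r))"
        using intM by simp
    qed measurable
    show "(\<lambda>(s, r). c s r * P s r) \<in> borel_measurable (M \<Otimes>\<^sub>M M)"
      using c(1) by measurable
    have "norm (c s r * P s r) \<le> norm (norm (f' s) * norm (g' r))" for s r
    proof -
      have "\<bar>c s r\<bar> * \<bar>P s r\<bar> \<le> 1 * (norm (f' s) * norm (g' r))"
        by (intro mult_mono c(2)) (auto simp: P_def indicator_def Cauchy_Schwarz_ineq2)
      then show ?thesis by (simp add: abs_mult)
    qed
    then show "AE x in M \<Otimes>\<^sub>M M. norm (case x of (s, r) \<Rightarrow> c s r * P s r)
        \<le> norm (case x of (s, r) \<Rightarrow> norm (f' s) * norm (g' r))" by auto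
  qed
  \<comment> \<open>These select the two closed triangles. Both contain the diagonal, which meets
    every slice in a single point and so has no weight.\<close>
  define lo up where "lo s r = (if r \<le> s then 1 else 0 :: real)" and "up s r = (if s \<le> r then 1 else 0 :: real)"
    for s r :: real
  have [measurable]: "(\<lambda>(s, r). lo s r) \<in> borel_measurable (M \<Otimes>\<^sub>M M)"
    "(\<lambda>(s, r). up s r) \<in> borel_measurable (M \<Otimes>\<^sub>M M)"
    unfolding lo_def up_def by measurable
  have ilo: "integrable (M \<Otimes>\<^sub>M M) (\<lambda>(s, r). lo s r * P s r)"
    and iup: "integrable (M \<Otimes>\<^sub>M M) (\<lambda>(s, r). up s r * P s r)"
    by (rule iP, measurable, simp add: lo_def up_def)+
  have ig: "integrable M (\<lambda>r. indicator {..s} r *\<^sub>R g' r)" "integrable M (\<lambda>r. indicator {..s} r *\<^sub>R f' r)" for s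
    using integrable_tint int by (auto simp: M_def)
  have tM: "tint T s h = (\<integral>r. indicator {..s} r *\<^sub>R h r \<partial>M)" for s and h :: "real \<Rightarrow> 'k::{banach, second_countable_topology}"
    by (simp add: tint_def M_def)

  have X: "tint T t (\<lambda>s. f' s \<bullet> g s) = tint T t f' \<bullet> g 0 + (\<integral>s. \<integral>r. lo s r * P s r \<partial>M \<partial>M)"
  proof -
    have "tint T t (\<lambda>s. f' s \<bullet> g s)
        = (\<integral>s. (indicator {..t} s *\<^sub>R f' s) \<bullet> g 0 + (\<integral>r. lo s r * P s r \<partial>M) \<partial>M)"
      unfolding tM
    proof (rule Bochner_Integration.integral_cong[OF refl])
      fix s assume "s \<in> space M"
      then have s: "s \<in> {0..T}" by (simp add: M_def space_restrict_space)
      have "(\<integral>r. lo s r * P s r \<partial>M) = (\<integral>r. (indicator {..t} s *\<^sub>R f' s) \<bullet> (indicator {..s} r *\<^sub>R g' r) \<partial>M)"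
        by (intro Bochner_Integration.integral_cong refl) (auto simp: lo_def P_def indicator_def)
      also have "\<dots> = (indicator {..t} s *\<^sub>R f' s) \<bullet> tint T s g'"
        unfolding tM by (intro integral_inner_right ig)
      finally show "indicator {..t} s *\<^sub>R (f' s \<bullet> g s)
          = (indicator {..t} s *\<^sub>R f' s) \<bullet> g 0 + (\<integral>r. lo s r * P s r \<partial>M)"
        by (simp add: bspec[OF g s] inner_add_right distrib_left)
    qed
    also have "\<dots> = (\<integral>s. (indicator {..t} s *\<^sub>R f' s) \<bullet> g 0 \<partial>M) + (\<integral>s. \<integral>r. lo s r * P s r \<partial>M \<partial>M)"
      by (intro Bochner_Integration.integral_add integrable_inner_left ig MM.integrable_fst ilo)
    also have "(\<integral>s. (indicator {..t} s *\<^sub>R f' s) \<bullet> g 0 \<partial>M) = tint T t f' \<bullet> g 0"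
      unfolding tM by (intro integral_inner_left ig)
    finally show ?thesis .
  qed
  have Y: "tint T t (\<lambda>s. f s \<bullet> g' s) = f 0 \<bullet> tint T t g' + (\<integral>r. \<integral>s. up s r * P s r \<partial>M \<partial>M)"
  proof -
    have "tint T t (\<lambda>s. f s \<bullet> g' s)
        = (\<integral>r. f 0 \<bullet> (indicator {..t} r *\<^sub>R g' r) + (\<integral>s. up s r * P s r \<partial>M) \<partial>M)"
      unfolding tM
    proof (rule Bochner_Integration.integral_cong[OF refl])
      fix r assume "r \<in> space M"
      then have r: "r \<in> {0..T}" by (simp add: M_def space_restrict_space)
      have "(\<integral>s. up s r * P s r \<partial>M) = (\<integral>s. (indicator {..r} s *\<^sub>R f' s) \<bullet> (indicator {..t} r *\<^sub>R g' r) \<partial>M)"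
        by (intro Bochner_Integration.integral_cong refl) (auto simp: up_def P_def indicator_def)
      also have "\<dots> = tint T r f' \<bullet> (indicator {..t} r *\<^sub>R g' r)"
        unfolding tM by (intro integral_inner_left ig)
      finally show "indicator {..t} r *\<^sub>R (f r \<bullet> g' r)
          = f 0 \<bullet> (indicator {..t} r *\<^sub>R g' r) + (\<integral>s. up s r * P s r \<partial>M)"
        by (simp add: bspec[OF f r] inner_add_left distrib_left)
    qed
    also have "\<dots> = (\<integral>r. f 0 \<bullet> (indicator {..t} r *\<^sub>R g' r) \<partial>M) + (\<integral>r. \<integral>s. up s r * P s r \<partial>M \<partial>M)"
      by (intro Bochner_Integration.integral_add integrable_inner_right ig MM.integrable_snd iup)
    also have "(\<integral>r. f 0 \<bullet> (indicator {..t} r *\<^sub>R g' r) \<partial>M) = f 0 \<bullet> tint T t g'"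
      unfolding tM by (intro integral_inner_right ig)
    finally show ?thesis .
  qed
  have "(\<integral>s. \<integral>r. lo s r * P s r \<partial>M \<partial>M) + (\<integral>r. \<integral>s. up s r * P s r \<partial>M \<partial>M)
      = (\<integral>s. \<integral>r. lo s r * P s r \<partial>M \<partial>M) + (\<integral>s. \<integral>r. up s r * P s r \<partial>M \<partial>M)"
    by (simp only: MM.Fubini_integral[OF iup])
  also have "\<dots> = (\<integral>s. (\<integral>r. lo s r * P s r \<partial>M) + (\<integral>r. up s r * P s r \<partial>M) \<partial>M)"
    by (intro Bochner_Integration.integral_add[symmetric] MM.integrable_fst ilo iup)
  also have "\<dots> = (\<integral>s. (indicator {..t} s *\<^sub>R f' s) \<bullet> tint T t g' \<partial>M)"
  proof (rule Bochner_Integration.integral_cong[OF refl])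
    fix s
    have iPs: "integrable M (\<lambda>r. P s r)"
    proof -
      have "P s r = (indicator {..t} s *\<^sub>R f' s) \<bullet> (indicator {..t} r *\<^sub>R g' r)" for r
        by (simp add: P_def)
      then show ?thesis by (simp only:) (intro integrable_inner_right ig)
    qed
    have ils: "integrable M (\<lambda>r. lo s r * P s r)" "integrable M (\<lambda>r. up s r * P s r)"
      using iPs by (auto intro!: Bochner_Integration.integrable_bound[OF iPs] simp: lo_def up_def)
    have "(\<integral>r. lo s r * P s r \<partial>M) + (\<integral>r. up s r * P s r \<partial>M) = (\<integral>r. lo s r * P s r + up s r * P s r \<partial>M)"
      by (intro Bochner_Integration.integral_add[symmetric] ils)
    also have "\<dots> = (\<integral>r. P s r \<partial>M)"
    proof (rule integral_cong_AE)
      show "AE r in M. lo s r * P s r + up s r * P s r = P s r"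
        using AE_lebesgue_on_neq[where t = s and T = T] unfolding M_def[symmetric]
        by eventually_elim (auto simp: lo_def up_def)
    qed (use iPs ils in auto)
    also have "\<dots> = (\<integral>r. (indicator {..t} s *\<^sub>R f' s) \<bullet> (indicator {..t} r *\<^sub>R g' r) \<partial>M)"
      by (intro Bochner_Integration.integral_cong refl) (simp add: P_def)
    also have "\<dots> = (indicator {..t} s *\<^sub>R f' s) \<bullet> tint T t g'"
      unfolding tM by (intro integral_inner_right ig)
    finally show "(\<integral>r. lo s r * P s r \<partial>M) + (\<integral>r. up s r * P s r \<partial>M)
        = (indicator {..t} s *\<^sub>R f' s) \<bullet> tint T t g'" .
  qed
  also have "\<dots> = tint T t f' \<bullet> tint T t g'"
    unfolding tM by (intro integral_inner_left ig)
  finally show ?thesis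
    unfolding X Y bspec[OF f t] bspec[OF g t] by (simp add: inner_add_left inner_add_right)
qed

section \<open>Weak derivatives under linear maps and on orthogonal complements\<close>

lemma test_functions_deriv:
  fixes \<phi> :: "real \<Rightarrow> real"
  assumes "\<phi> \<in> test_functions S"
  shows "continuous_on A (deriv \<phi>)"
proof -
  have sm: "smooth \<phi>" using assms by (rule test_functions_smooth)
  have "deriv \<phi> x = frechet_derivative \<phi> (at x) 1" for x
  proof (rule DERIV_imp_deriv)
    have "linear (frechet_derivative \<phi> (at x))"
      using smooth_has_derivative[OF sm] by (rule has_derivative_linear)
    from linear_scale[OF this, of _ 1]
    have "frechet_derivative \<phi> (at x) = (*) (frechet_derivative \<phi> (at x) 1)"
      by (intro ext) (metis mult.commute mult.right_neutral real_scaleR_def)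
    then show "(\<phi> has_real_derivative frechet_derivative \<phi> (at x) 1) (at x)"
      using smooth_has_derivative[OF sm, of x] by (simp add: has_field_derivative_def)
  qed
  then have eq: "deriv \<phi> = (\<lambda>x. frechet_derivative \<phi> (at x) 1)" by (rule ext)
  show ?thesis unfolding eq by (rule smooth_continuous[OF smooth_frechet_derivative[OF sm]])
qed

lemma is_time_deriv_bounded_linear:
  assumes h: "bounded_linear h" and f: "continuous_on {0..T} f"
    and g: "integrable (lebesgue_on {0<..<T}) g" and fg: "is_time_deriv T f g"
  shows "is_time_deriv T (\<lambda>t. h (f t)) (\<lambda>t. h (g t))"
  unfolding is_time_deriv_def
proof
  fix \<phi> :: "real \<Rightarrow> real" assume \<phi>: "\<phi> \<in> test_functions {0<..<T}"
  let ?M = "lebesgue_on {0<..<T}"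
  have c\<phi>: "continuous_on A \<phi>" for A using \<phi> by (intro smooth_continuous test_functions_smooth)
  have i1: "integrable ?M (\<lambda>t. deriv \<phi> t *\<^sub>R f t)"
    by (intro continuous_integrable_lebesgue_on continuous_on_scaleR test_functions_deriv[OF \<phi>] f)
  have i2: "integrable ?M (\<lambda>t. \<phi> t *\<^sub>R g t)"
  proof -
    have "bounded (\<phi> ` {0..T})" by (intro compact_imp_bounded compact_continuous_image c\<phi>) simp
    then obtain B where B: "\<And>x. x \<in> {0..T} \<Longrightarrow> norm (\<phi> x) \<le> B" unfolding bounded_iff by blast
    show ?thesis
    proof (rule Bochner_Integration.integrable_bound)
      show "integrable ?M (\<lambda>t. B * norm (g t))" using g by simp
      show "(\<lambda>t. \<phi> t *\<^sub>R g t) \<in> borel_measurable ?M"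
        by (intro borel_measurable_scaleR continuous_integrable_lebesgue_on(1)[OF c\<phi>]
            borel_measurable_integrable[OF g])
      have "norm (\<phi> t *\<^sub>R g t) \<le> norm (B * norm (g t))" if "t \<in> {0<..<T}" for t
      proof -
        have "\<bar>\<phi> t\<bar> \<le> \<bar>B\<bar>" using B[of t] that by auto
        then show ?thesis by (simp add: abs_mult mult_right_mono)
      qed
      then show "AE t in ?M. norm (\<phi> t *\<^sub>R g t) \<le> norm (B * norm (g t))"
        by (intro AE_I2) (simp add: space_restrict_space)
    qed
  qed
  have hs: "h (c *\<^sub>R x) = c *\<^sub>R h x" and hm: "h (- x) = - h x" for c x
    using bounded_linear.linear[OF h] linear_scale linear_neg by blast+
  have "(\<integral>t. deriv \<phi> t *\<^sub>R h (f t) \<partial>?M) = h (\<integral>t. deriv \<phi> t *\<^sub>R f t \<partial>?M)"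
    using integral_bounded_linear[OF h i1] by (simp add: hs)
  also have "\<dots> = - h (\<integral>t. \<phi> t *\<^sub>R g t \<partial>?M)"
    using fg \<phi> by (simp add: is_time_deriv_def hm)
  also have "h (\<integral>t. \<phi> t *\<^sub>R g t \<partial>?M) = (\<integral>t. \<phi> t *\<^sub>R h (g t) \<partial>?M)"
    using integral_bounded_linear[OF h i2] by (simp add: hs)
  finally show "(\<integral>t. deriv \<phi> t *\<^sub>R h (f t) \<partial>?M) = - (\<integral>t. \<phi> t *\<^sub>R h (g t) \<partial>?M)" .
qed

lemma L2_time_bounded_linear:
  fixes g :: "real \<Rightarrow> 'h::{banach, second_countable_topology}" and h :: "'h \<Rightarrow> 'k::{banach, second_countable_topology}"
  assumes h: "bounded_linear h" and g: "g \<in> L2_time T X"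
  shows "(\<lambda>t. h (g t)) \<in> L2_time T UNIV"
  unfolding L2_time_def
proof (intro CollectI conjI)
  have hm: "h \<in> borel_measurable borel" by (intro borel_measurable_continuous_onI linear_continuous_on h)
  show m: "(\<lambda>t. h (g t)) \<in> borel_measurable (lebesgue_on {0<..<T})"
    by (rule measurable_compose[OF L2_timeD(1)[OF g] hm])
  show "integrable (lebesgue_on {0<..<T}) (\<lambda>t. (norm (h (g t)))\<^sup>2)"
  proof (rule Bochner_Integration.integrable_bound)
    show "integrable (lebesgue_on {0<..<T}) (\<lambda>t. (onorm h)\<^sup>2 * (norm (g t))\<^sup>2)"
      using L2_timeD(2)[OF g] by simp
    show "(\<lambda>t. (norm (h (g t)))\<^sup>2) \<in> borel_measurable (lebesgue_on {0<..<T})" using m by measurable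
    have "(norm (h (g t)))\<^sup>2 \<le> (onorm h)\<^sup>2 * (norm (g t))\<^sup>2" for t
      using power_mono[OF onorm[OF h, of "g t"], of 2] by (simp add: power_mult_distrib)
    then show "AE t in lebesgue_on {0<..<T}. norm ((norm (h (g t)))\<^sup>2) \<le> norm ((onorm h)\<^sup>2 * (norm (g t))\<^sup>2)"
      by (intro AE_I2) simp
  qed
qed simp

text \<open>Density of test functions is formulated for Borel functions on the line, whereas
  functions of time are Lebesgue measurable on an interval. A Borel function that agrees almost
  everywhere with the extension of \<open>r\<close> by zero connects the two.\<close>

lemma real_orthogonal_test_functions_AE:
  fixes r :: "real \<Rightarrow> real"
  assumes r: "r \<in> L2_time T UNIV"
    and 0: "\<And>\<phi>. \<phi> \<in> test_functions {0<..<T} \<Longrightarrow> (\<integral>t. \<phi> t *\<^sub>R r t \<partial>lebesgue_on {0<..<T}) = 0"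
  shows "AE t in lebesgue_on {0<..<T}. r t = 0"
proof -
  let ?S = "{0<..<T}"
  have "(\<lambda>t. indicator ?S t *\<^sub>R r t) \<in> borel_measurable lebesgue"
    using L2_timeD(1)[OF r] by (subst (asm) borel_measurable_restrict_space_iff) auto
  then obtain r0 where r0: "r0 \<in> borel_measurable lborel" "AE t in lborel. indicator ?S t *\<^sub>R r t = r0 t"
    using completion_ex_borel_measurable_real by blast
  define q where "q t = indicator ?S t * r0 t" for t
  have [measurable]: "q \<in> borel_measurable borel" using r0(1) unfolding q_def by simp
  have q: "AE t in lebesgue. indicator ?S t *\<^sub>R r t = q t"
  proof (rule AE_completion)
    show "AE t in lborel. indicator ?S t *\<^sub>R r t = q t"
      using r0(2)
    proof eventually_elim
      fix t assume "indicator ?S t *\<^sub>R r t = r0 t"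
      from this[symmetric] show "indicator ?S t *\<^sub>R r t = q t" by (simp add: q_def indicator_def)
    qed
  qed
  have sq: "sq_integrable q"
    unfolding sq_integrable_def
  proof
    have "integrable lebesgue (\<lambda>t. indicator ?S t *\<^sub>R (norm (r t))\<^sup>2)"
      using L2_timeD(2)[OF r] by (subst (asm) integrable_restrict_space) auto
    then have "integrable lebesgue (\<lambda>t. (norm (q t))\<^sup>2)"
    proof (rule integrable_cong_AE_imp)
      show "AE t in lebesgue. indicator ?S t *\<^sub>R (norm (r t))\<^sup>2 = (norm (q t))\<^sup>2"
        using q
      proof eventually_elim
        fix t assume "indicator ?S t *\<^sub>R r t = q t"
        from this[symmetric] show "indicator ?S t *\<^sub>R (norm (r t))\<^sup>2 = (norm (q t))\<^sup>2"
          by (simp add: indicator_def)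
      qed
      have "q \<in> borel_measurable lebesgue" by (rule measurable_completion) simp
      then show "(\<lambda>t. (norm (q t))\<^sup>2) \<in> borel_measurable lebesgue" by measurable
    qed
    then show "integrable lborel (\<lambda>t. (norm (q t))\<^sup>2)"
      using integrable_completion[of "\<lambda>t. (norm (q t))\<^sup>2" lborel] by simp
  qed simp
  have "l2_class q = 0"
  proof (rule L2_eq_0_by_test_functions[of ?S])
    show "l2_class q \<in> L2 ?S" by (rule L2I[OF sq]) (simp add: q_def)
    fix \<phi> :: "real \<Rightarrow> real" assume \<phi>: "\<phi> \<in> test_functions ?S"
    have [measurable]: "\<phi> \<in> borel_measurable borel"
      by (intro borel_measurable_continuous_onI smooth_continuous test_functions_smooth[OF \<phi>])
    have "l2_class q \<bullet> l2_class \<phi> = (\<integral>t. q t \<bullet> \<phi> t \<partial>lborel)"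
      by (rule inner_l2_class[OF sq sq_integrable_test[OF \<phi>]])
    also have "\<dots> = (\<integral>t. q t \<bullet> \<phi> t \<partial>lebesgue)"
      by (rule integral_completion[symmetric]) simp
    also have "\<dots> = (\<integral>t. indicator ?S t *\<^sub>R (\<phi> t *\<^sub>R r t) \<partial>lebesgue)"
    proof (rule integral_cong_AE)
      show "AE t in lebesgue. q t \<bullet> \<phi> t = indicator ?S t *\<^sub>R (\<phi> t *\<^sub>R r t)"
        using q
      proof eventually_elim
        fix t assume "indicator ?S t *\<^sub>R r t = q t"
        from this[symmetric] show "q t \<bullet> \<phi> t = indicator ?S t *\<^sub>R (\<phi> t *\<^sub>R r t)"
          by (simp add: indicator_def)
      qed
      show "(\<lambda>t. q t \<bullet> \<phi> t) \<in> borel_measurable lebesgue" by (rule measurable_completion) simp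
      have "(\<lambda>t. \<phi> t *\<^sub>R r t) \<in> borel_measurable (lebesgue_on ?S)"
        by (intro borel_measurable_scaleR L2_timeD(1)[OF r]
            continuous_integrable_lebesgue_on(1)[OF smooth_continuous[OF test_functions_smooth[OF \<phi>]]])
      then show "(\<lambda>t. indicator ?S t *\<^sub>R (\<phi> t *\<^sub>R r t)) \<in> borel_measurable lebesgue"
        by (subst (asm) borel_measurable_restrict_space_iff) auto
    qed
    also have "\<dots> = (\<integral>t. \<phi> t *\<^sub>R r t \<partial>lebesgue_on ?S)"
      by (rule integral_restrict_space[symmetric]) simp
    also have "\<dots> = 0" by (rule 0[OF \<phi>])
    finally show "l2_class q \<bullet> l2_class \<phi> = 0" .
  qed simp
  then have "AE t in lborel. q t = 0"
    using l2_class_eq_iff[OF sq sq_integrable_zero] by (simp add: l2_class_zero)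
  then have "AE t in lebesgue. q t = 0" by (rule AE_completion)
  with q have "AE t in lebesgue. t \<in> ?S \<longrightarrow> r t = 0"
  proof eventually_elim
    fix t assume "indicator ?S t *\<^sub>R r t = q t" "q t = 0"
    then show "t \<in> ?S \<longrightarrow> r t = 0" by (simp add: indicator_def split: if_splits)
  qed
  then show ?thesis by (subst AE_restrict_space_iff) auto
qed

text \<open>Applied to \<open>k\<close> in the kernel of the gradient: a source orthogonal to
  \<open>k\<close> at all times passes this on to its time derivative. The exceptional null set
  depends on \<open>k\<close>; \<open>AE_orthogonal_all\<close> removes the dependence.\<close>

lemma weak_derivative_orthogonal:
  fixes f g :: "real \<Rightarrow> 'h::{real_inner, banach, second_countable_topology}"
  assumes f: "continuous_on {0..T} f" and g: "g \<in> L2_time T X" and fg: "is_time_deriv T f g"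
    and k: "\<And>t. t \<in> {0<..<T} \<Longrightarrow> f t \<bullet> k = 0"
  shows "AE t in lebesgue_on {0<..<T}. g t \<bullet> k = 0"
proof (rule real_orthogonal_test_functions_AE)
  show "(\<lambda>t. g t \<bullet> k) \<in> L2_time T UNIV"
    by (rule L2_time_bounded_linear[OF bounded_linear_inner_left g])
  fix \<phi> :: "real \<Rightarrow> real" assume \<phi>: "\<phi> \<in> test_functions {0<..<T}"
  have "is_time_deriv T (\<lambda>t. f t \<bullet> k) (\<lambda>t. g t \<bullet> k)"
    by (rule is_time_deriv_bounded_linear[OF bounded_linear_inner_left f L2_timeD(3)[OF g] fg])
  then have "(\<integral>t. \<phi> t *\<^sub>R (g t \<bullet> k) \<partial>lebesgue_on {0<..<T})
      = - (\<integral>t. deriv \<phi> t *\<^sub>R (f t \<bullet> k) \<partial>lebesgue_on {0<..<T})"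
    using \<phi> by (simp add: is_time_deriv_def)
  also have "(\<integral>t. deriv \<phi> t *\<^sub>R (f t \<bullet> k) \<partial>lebesgue_on {0<..<T}) = (\<integral>t. 0 \<partial>lebesgue_on {0<..<T})"
    by (rule Bochner_Integration.integral_cong) (auto simp: space_restrict_space k)
  finally show "(\<integral>t. \<phi> t *\<^sub>R (g t \<bullet> k) \<partial>lebesgue_on {0<..<T}) = 0" by simp
qed

text \<open>Cauchy-Schwarz, obtained by integrating the square of \<open>norm (g s)\<close> minus
  its mean \<open>m / T\<close>.\<close>

lemma L2_time_norm_L1:
  assumes "0 < T" "g \<in> L2_time T X"
  shows "(\<integral>s. norm (g s) \<partial>lebesgue_on {0<..<T}) \<le> sqrt T * L2_time_norm T g"
proof -
  let ?M = "lebesgue_on {0<..<T}"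
  interpret finite_measure ?M by (rule finite_measure_lebesgue_on) simp
  define m where "m = (\<integral>s. norm (g s) \<partial>?M)"
  define q where "q = (\<integral>s. (norm (g s))\<^sup>2 \<partial>?M)"
  have i: "integrable ?M (\<lambda>s. norm (g s))" "integrable ?M (\<lambda>s. (norm (g s))\<^sup>2)"
    using L2_timeD[OF assms(2)] by auto
  have meas: "measure ?M (space ?M) = T"
    using assms(1) by (simp add: measure_restrict_space space_restrict_space)
  have "0 \<le> (\<integral>s. (norm (g s) - m / T)\<^sup>2 \<partial>?M)" by simp
  also have "\<dots> = (\<integral>s. (norm (g s))\<^sup>2 - 2 * (m / T) * norm (g s) + (m / T)\<^sup>2 \<partial>?M)"
    by (simp add: power2_diff algebra_simps)
  also have "\<dots> = q - 2 * (m / T) * m + (m / T)\<^sup>2 * T"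
    using i meas by (simp add: q_def m_def)
  also have "\<dots> = q - m\<^sup>2 / T" using assms(1) by (simp add: field_simps power2_eq_square)
  finally have "m\<^sup>2 \<le> T * q" using assms(1) by (simp add: field_simps)
  then have "m \<le> sqrt (T * q)" by (rule real_le_rsqrt)
  then show ?thesis by (simp add: m_def q_def L2_time_norm_def real_sqrt_mult)
qed

lemma dt_works:
  assumes "\<exists>g. g \<in> L2_time T UNIV \<and> is_time_deriv T f g"
  shows "dt T f \<in> L2_time T UNIV" "is_time_deriv T f (dt T f)"
  using someI_ex[OF assms] by (simp_all add: dt_def)

lemma L2_time_UNIV: "g \<in> L2_time T X \<Longrightarrow> g \<in> L2_time T UNIV"
  by (simp add: L2_time_def)

lemma H1_timeD:
  assumes "f \<in> H1_time T X"
  shows "continuous_on {0..T} f" "\<And>t. t \<in> {0..T} \<Longrightarrow> f t \<in> X"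
    "dt T f \<in> L2_time T UNIV" "is_time_deriv T f (dt T f)" "f \<in> L2_time T X"
proof -
  have "\<exists>g. g \<in> L2_time T UNIV \<and> is_time_deriv T f g" using assms L2_time_UNIV by (auto simp: H1_time_def)
  from dt_works[OF this] show "dt T f \<in> L2_time T UNIV" "is_time_deriv T f (dt T f)" .
qed (use assms in \<open>auto simp: H1_time_def\<close>)

text \<open>\<open>dt T f\<close> is a choice among all weak derivatives, and its definition does
  not control its values. The last conclusion supplies a derivative \<open>d\<close> that lies in
  \<open>X\<close> almost everywhere and is mapped by \<open>h\<close> to a derivative of
  \<open>h (f t)\<close>; such a \<open>d\<close> can serve as a test function.\<close>

lemma H1_time_graphD:
  fixes h :: "'h::{banach, second_countable_topology} \<Rightarrow> 'k::{banach, second_countable_topology}"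
  assumes "f \<in> H1_time_graph T h X"
  shows "continuous_on {0..T} f" "continuous_on {0..T} (\<lambda>t. h (f t))" "\<And>t. t \<in> {0..T} \<Longrightarrow> f t \<in> X"
    "dt T f \<in> L2_time T UNIV" "is_time_deriv T f (dt T f)"
    "\<exists>d d'. d \<in> L2_time T UNIV \<and> d' \<in> L2_time T UNIV \<and> is_time_deriv T f d \<and> is_time_deriv T (\<lambda>t. h (f t)) d' \<and>
      (AE t in lebesgue_on {0<..<T}. d t \<in> X \<and> d' t = h (d t))"
proof -
  let ?F = "\<lambda>t. (f t, h (f t))"
  have F: "?F \<in> H1_time T ((\<lambda>v. (v, h v)) ` X)" using assms by (simp add: H1_time_graph_def)
  then have cF: "continuous_on {0..T} ?F" by (simp add: H1_time_def)
  from continuous_on_fst[OF cF] continuous_on_snd[OF cF]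
  show "continuous_on {0..T} f" "continuous_on {0..T} (\<lambda>t. h (f t))" by simp_all
  show "f t \<in> X" if "t \<in> {0..T}" for t using F that by (auto simp: H1_time_def)
  obtain G where G: "G \<in> L2_time T ((\<lambda>v. (v, h v)) ` X)" "is_time_deriv T ?F G"
    using F by (auto simp: H1_time_def)
  have d: "(\<lambda>t. fst (G t)) \<in> L2_time T UNIV" "(\<lambda>t. snd (G t)) \<in> L2_time T UNIV"
    by (intro L2_time_bounded_linear[OF _ G(1)] bounded_linear_fst bounded_linear_snd)+
  have d': "is_time_deriv T f (\<lambda>t. fst (G t))" "is_time_deriv T (\<lambda>t. h (f t)) (\<lambda>t. snd (G t))"
    using is_time_deriv_bounded_linear[OF bounded_linear_fst cF L2_timeD(3)[OF G(1)] G(2)]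
      is_time_deriv_bounded_linear[OF bounded_linear_snd cF L2_timeD(3)[OF G(1)] G(2)] by simp_all
  have "\<exists>g. g \<in> L2_time T UNIV \<and> is_time_deriv T f g" using d d' by blast
  from dt_works[OF this] show "dt T f \<in> L2_time T UNIV" "is_time_deriv T f (dt T f)" .
  have "AE t in lebesgue_on {0<..<T}. fst (G t) \<in> X \<and> snd (G t) = h (fst (G t))"
    using L2_timeD(4)[OF G(1)] by eventually_elim auto
  with d d' show "\<exists>d d'. d \<in> L2_time T UNIV \<and> d' \<in> L2_time T UNIV \<and> is_time_deriv T f d \<and>
      is_time_deriv T (\<lambda>t. h (f t)) d' \<and> (AE t in lebesgue_on {0<..<T}. d t \<in> X \<and> d' t = h (d t))"
    by blast
qed

text \<open>A nonzero value would persist on a nonempty open set, which is not null. This turns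
  equations valid for almost every time into equations at every time, end points included.\<close>

lemma continuous_AE_eq_0:
  fixes F :: "real \<Rightarrow> real"
  assumes "0 < T" "continuous_on {0..T} F" "AE t in lebesgue_on {0<..<T}. F t = 0" "t \<in> {0..T}"
  shows "F t = 0"
proof -
  have c: "continuous_on (closure {0<..<T}) F" using assms by simp
  have "F x = 0" if x: "x \<in> {0<..<T}" for x
  proof (rule ccontr)
    assume "F x \<noteq> 0"
    have "continuous_on {0<..<T} F" using assms(2) by (rule continuous_on_subset) auto
    then have "open ({0<..<T} \<inter> F -` (- {0}))"
      by (rule continuous_open_preimage) auto
    moreover have "{0<..<T} \<inter> F -` (- {0}) = {y \<in> {0<..<T}. F y \<noteq> 0}" by auto
    ultimately have "open {y \<in> {0<..<T}. F y \<noteq> 0}" by simp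
    moreover have "x \<in> {y \<in> {0<..<T}. F y \<noteq> 0}" using x \<open>F x \<noteq> 0\<close> by simp
    ultimately have "\<not> negligible {y \<in> {0<..<T}. F y \<noteq> 0}" using open_not_negligible by blast
    moreover have "AE y in lebesgue. y \<in> {0<..<T} \<longrightarrow> F y = 0"
      using assms(3) by (subst (asm) AE_restrict_space_iff) auto
    then have "negligible {y \<in> {0<..<T}. F y \<noteq> 0}"
      by (auto simp: negligible_iff_null_sets eventually_ae_filter intro: null_sets_completion_subset)
    ultimately show False by contradiction
  qed
  then show ?thesis
    using continuous_constant_on_closure[OF c, of 0 t] assms by simp
qed

section \<open>The energy estimate\<close>

text \<open>The equation expresses \<open>wdiv \<Omega> v \<bullet> \<xi>\<close> by
  \<open>G * (A \<bullet> vgrad \<Omega> v)\<close> and \<open>f \<bullet> v\<close>, and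
  \<open>H1_norm\<close> dominates both norms of \<open>v\<close> that arise.\<close>

lemma inf_sup_bound:
  assumes \<beta>: "0 < \<beta>"
    and infsup: "\<And>w. w \<in> sp_W \<Omega> \<Longrightarrow> \<beta> * norm w \<le> (SUP v\<in>sp_U \<Omega> \<Gamma>D - {0}. (wdiv \<Omega> v \<bullet> w) / H1_norm \<Omega> v)"
    and \<xi>: "\<xi> \<in> sp_W \<Omega>" and G: "0 < G"
    and eq: "\<And>v. v \<in> sp_U \<Omega> \<Gamma>D \<Longrightarrow> G * (A \<bullet> vgrad \<Omega> v) - \<xi> \<bullet> wdiv \<Omega> v = f \<bullet> v"
  shows "\<beta> * norm \<xi> \<le> G * norm A + norm f"
proof (cases "sp_U \<Omega> \<Gamma>D - {0} = {}")
  case True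
  \<comment> \<open>\<open>Sup {}\<close> is an unspecified real number, but a bound by any fixed number forces \<open>\<xi> = 0\<close> by scaling.\<close>
  define c where "c = Sup ({} :: real set)"
  have le: "\<beta> * norm w \<le> c" if "w \<in> sp_W \<Omega>" for w
    using infsup[OF that] by (simp only: True image_empty c_def)
  have "\<xi> = 0"
  proof (rule ccontr)
    assume "\<xi> \<noteq> 0"
    define s where "s = (\<bar>c\<bar> + 1) / (\<beta> * norm \<xi>)"
    have "s *\<^sub>R \<xi> \<in> sp_W \<Omega>" using \<xi> subspace_scale[OF subspace_L2] by (simp add: sp_W_def)
    from le[OF this] have "\<beta> * (\<bar>s\<bar> * norm \<xi>) \<le> c" by simp
    moreover have "\<beta> * (\<bar>s\<bar> * norm \<xi>) = \<bar>c\<bar> + 1"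
      using \<open>\<xi> \<noteq> 0\<close> \<beta> by (simp add: s_def abs_mult)
    ultimately show False by linarith
  qed
  then show ?thesis using G by simp
next
  case False
  have "(SUP v\<in>sp_U \<Omega> \<Gamma>D - {0}. (wdiv \<Omega> v \<bullet> \<xi>) / H1_norm \<Omega> v) \<le> G * norm A + norm f"
  proof (rule cSUP_least[OF False])
    fix v assume v: "v \<in> sp_U \<Omega> \<Gamma>D - {0}"
    define n where "n = H1_norm \<Omega> v"
    have n: "norm v \<le> n" "norm (vgrad \<Omega> v) \<le> n" unfolding n_def H1_norm_def by (auto intro!: real_le_rsqrt)
    have "0 < norm v" using v by simp
    with n have n0: "0 < n" by linarith
    have "wdiv \<Omega> v \<bullet> \<xi> = G * (A \<bullet> vgrad \<Omega> v) - f \<bullet> v"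
      using eq[of v] v by (simp add: inner_commute[of \<xi>])
    also have "\<dots> \<le> G * (norm A * norm (vgrad \<Omega> v)) + norm f * norm v"
      using norm_cauchy_schwarz[of A "vgrad \<Omega> v"] norm_cauchy_schwarz[of "- f" v] G
      by (simp add: mult_left_mono add_mono) (smt (verit) mult_left_mono)
    also have "\<dots> \<le> G * (norm A * n) + norm f * n"
      using n G by (intro add_mono mult_left_mono) auto
    finally show "(wdiv \<Omega> v \<bullet> \<xi>) / H1_norm \<Omega> v \<le> G * norm A + norm f"
      using n0 by (simp add: n_def[symmetric] divide_le_eq algebra_simps)
  qed
  with infsup[OF \<xi>] show ?thesis by linarith
qed

lemma sp_U_subset_VH1: "sp_U \<Omega> \<Gamma>D \<subseteq> VH1 \<Omega>"
  by (auto simp: sp_U_def)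

text \<open>The equation says that a bounded linear functional of the pair
  \<open>(v, vgrad \<Omega> v)\<close> vanishes, since the divergence is the trace of the second
  component. It then vanishes on the closed span of these pairs, and at \<open>(k, 0)\<close> it
  reduces to \<open>f \<bullet> k\<close> up to sign.\<close>

lemma source_orthogonal_kernel:
  assumes op: "open \<Omega>"
    and eq: "\<And>v. v \<in> sp_U \<Omega> \<Gamma>D \<Longrightarrow> G * (A \<bullet> vgrad \<Omega> v) - \<xi> \<bullet> wdiv \<Omega> v = f \<bullet> v"
    and k: "(k, 0) \<in> closure (span ((\<lambda>v. (v, vgrad \<Omega> v)) ` sp_U \<Omega> \<Gamma>D))"
  shows "f \<bullet> k = 0"
proof -
  define F where "F = (\<lambda>x. G * (A \<bullet> snd x) - \<xi> \<bullet> l2_map mat_trace (snd x) - f \<bullet> fst x)"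
  have F: "bounded_linear F"
    unfolding F_def
    by (intro bounded_linear_sub bounded_linear_const_mult bounded_linear_inner_right_comp
        bounded_linear_compose[OF bounded_linear_l2_map[OF bounded_linear_mat_trace]]
        bounded_linear_fst bounded_linear_snd)
  have "{x. F x = 0} = F -` {0}" by auto
  then have cl: "closed {x. F x = 0}"
    using linear_continuous_on[OF F, of UNIV] by (simp add: closed_vimage)
  have sub: "subspace {x. F x = 0}"
    using bounded_linear.linear[OF F] by (auto simp: subspace_def linear_0 linear_add linear_scale)
  have "(\<lambda>v. (v, vgrad \<Omega> v)) ` sp_U \<Omega> \<Gamma>D \<subseteq> {x. F x = 0}"
  proof (rule image_subsetI)
    fix v assume v: "v \<in> sp_U \<Omega> \<Gamma>D"
    have "wdiv \<Omega> v = l2_map mat_trace (vgrad \<Omega> v)"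
      using v sp_U_subset_VH1 by (intro wdiv_eq_trace[OF op]) auto
    with eq[OF v] show "(v, vgrad \<Omega> v) \<in> {x. F x = 0}" by (simp add: F_def)
  qed
  then have "closure (span ((\<lambda>v. (v, vgrad \<Omega> v)) ` sp_U \<Omega> \<Gamma>D)) \<subseteq> {x. F x = 0}"
    by (intro closure_minimal span_minimal sub cl)
  with k have "F (k, 0) = 0" by auto
  moreover have "l2_map mat_trace (0 :: matrix_field) = 0"
    by (rule linear_0[OF bounded_linear.linear[OF bounded_linear_l2_map[OF bounded_linear_mat_trace]]])
  ultimately show ?thesis by (simp add: F_def)
qed

text \<open>A countable dense subset of \<open>K\<close> reduces uncountably many null sets to
  countably many; orthogonality to a fixed vector is a closed condition.\<close>

lemma AE_orthogonal_all:
  fixes K :: "'h::{real_inner, second_countable_topology} set"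
  assumes "\<And>k. k \<in> K \<Longrightarrow> AE t in M. g t \<bullet> k = 0"
  shows "AE t in M. \<forall>k\<in>K. g t \<bullet> k = 0"
proof -
  obtain D where D: "countable D" "D \<subseteq> K" "K \<subseteq> closure D" by (rule separable)
  have "AE t in M. \<forall>k\<in>D. g t \<bullet> k = 0"
    using D(1) by (subst AE_ball_countable) (use assms D(2) in auto)
  then show ?thesis
  proof eventually_elim
    fix t assume t: "\<forall>k\<in>D. g t \<bullet> k = 0"
    have "closed {k. g t \<bullet> k = 0}" by (intro closed_Collect_eq continuous_intros)
    then have "closure D \<subseteq> {k. g t \<bullet> k = 0}" using t by (intro closure_minimal) auto
    with D(3) show "\<forall>k\<in>K. g t \<bullet> k = 0" by auto
  qed
qed

lemma tint_mult:
  fixes a :: "real \<Rightarrow> real"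
  shows "tint T t (\<lambda>s. c * a s) = c * tint T t a"
  by (simp add: tint_def mult.left_commute)

lemma tint_mono:
  fixes a b :: "real \<Rightarrow> real"
  assumes "integrable (lebesgue_on {0<..<T}) a" "integrable (lebesgue_on {0<..<T}) b"
    and "\<And>s. s \<in> {0<..<T} \<Longrightarrow> a s \<le> b s"
  shows "tint T t a \<le> tint T t b"
  unfolding tint_def
  by (intro integral_mono integrable_tint assms) (auto simp: space_restrict_space indicator_def intro: assms(3))

lemma tint_cong_AE:
  fixes a b :: "real \<Rightarrow> real"
  assumes "integrable (lebesgue_on {0<..<T}) a" "integrable (lebesgue_on {0<..<T}) b"
    and "AE s in lebesgue_on {0<..<T}. a s = b s"
  shows "tint T t a = tint T t b"
  unfolding tint_def
proof (rule integral_cong_AE)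
  show "AE s in lebesgue_on {0<..<T}. indicator {..t} s *\<^sub>R a s = indicator {..t} s *\<^sub>R b s"
    using assms(3) by eventually_elim simp
qed (intro borel_measurable_integrable integrable_tint assms)+

text \<open>A bound uniform in time on one factor, and Cauchy-Schwarz in time for the other;
  \<open>sqrt T\<close> is the norm of the constant 1 over the time interval.\<close>

lemma tint_bound:
  fixes r :: "real \<Rightarrow> real"
  assumes T: "0 < T" and r: "integrable (lebesgue_on {0<..<T}) r" and a: "a \<in> L2_time T X"
    and le: "AE s in lebesgue_on {0<..<T}. \<bar>r s\<bar> \<le> B * norm (a s)" and B: "0 \<le> B"
  shows "\<bar>tint T t r\<bar> \<le> B * sqrt T * L2_time_norm T a"
proof -
  have "\<bar>tint T t r\<bar> \<le> (\<integral>s. norm (indicator {..t} s *\<^sub>R r s) \<partial>lebesgue_on {0<..<T})"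
    unfolding tint_def using integral_norm_bound[of _ "\<lambda>s. indicator {..t} s *\<^sub>R r s"] by simp
  also have "\<dots> \<le> (\<integral>s. B * norm (a s) \<partial>lebesgue_on {0<..<T})"
  proof (rule integral_mono_AE)
    show "AE s in lebesgue_on {0<..<T}. norm (indicator {..t} s *\<^sub>R r s) \<le> B * norm (a s)"
      using le
    proof eventually_elim
      fix s assume "\<bar>r s\<bar> \<le> B * norm (a s)"
      moreover have "0 \<le> B * norm (a s)" using B by simp
      ultimately show "norm (indicator {..t} s *\<^sub>R r s) \<le> B * norm (a s)" by (simp add: indicator_def)
    qed
  qed (use integrable_tint[OF r] L2_timeD(3)[OF a] in auto)
  also have "\<dots> = B * (\<integral>s. norm (a s) \<partial>lebesgue_on {0<..<T})" by simp
  also have "\<dots> \<le> B * (sqrt T * L2_time_norm T a)"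
    by (intro mult_left_mono L2_time_norm_L1[OF T a] B)
  finally show ?thesis by (simp add: mult.assoc)
qed

lemma tint_inner_bound:
  fixes a b :: "real \<Rightarrow> 'h::{real_inner, banach, second_countable_topology}"
  assumes T: "0 < T" and a: "a \<in> L2_time T X" and b: "continuous_on {0..T} b"
    and le: "\<And>s. s \<in> {0..T} \<Longrightarrow> norm (b s) \<le> B" and B: "0 \<le> B"
  shows "tint T t (\<lambda>s. a s \<bullet> b s) \<le> B * sqrt T * L2_time_norm T a"
proof -
  have "\<bar>tint T t (\<lambda>s. a s \<bullet> b s)\<bar> \<le> B * sqrt T * L2_time_norm T a"
  proof (rule tint_bound[OF T integrable_inner_continuous[OF L2_timeD(3)[OF a] b] a _ B])
    have "\<bar>a s \<bullet> b s\<bar> \<le> B * norm (a s)" if "s \<in> {0<..<T}" for s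
      using order_trans[OF Cauchy_Schwarz_ineq2 mult_left_mono[OF le norm_ge_zero]] that
      by (simp add: mult.commute)
    then show "AE s in lebesgue_on {0<..<T}. \<bar>a s \<bullet> b s\<bar> \<le> B * norm (a s)"
      by (intro AE_I2) (simp add: space_restrict_space)
  qed
  then show ?thesis by linarith
qed

lemma L2_time_norm_nonneg: "0 \<le> L2_time_norm T a"
  by (simp add: L2_time_norm_def)

lemma H1_time_norm_ge:
  "L2_time_norm T f \<le> H1_time_norm T f" "L2_time_norm T (dt T f) \<le> H1_time_norm T f"
  by (auto simp: H1_time_norm_def intro!: real_le_rsqrt)

text \<open>Average \<open>norm (f t) \<le> norm (f s) + n1\<close> over all times \<open>s\<close>:
  the summand \<open>1 / sqrt T\<close> comes from the mean of \<open>norm (f s)\<close>, and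
  \<open>sqrt T\<close> from the integral \<open>n1\<close> of the derivative.\<close>

lemma H1_time_sup_bound:
  assumes T: "0 < T" and f: "f \<in> H1_time T X" and t: "t \<in> {0..T}"
  shows "norm (f t) \<le> (1 / sqrt T + sqrt T) * H1_time_norm T f"
proof -
  let ?M = "lebesgue_on {0<..<T}"
  interpret finite_measure ?M by (rule finite_measure_lebesgue_on) simp
  note fD = H1_timeD[OF f]
  define n1 where "n1 = (\<integral>s. norm (dt T f s) \<partial>?M)"
  note int = L2_timeD(3)[OF fD(3)]
  have rep: "f t = f 0 + tint T t (dt T f)" if "t \<in> {0..T}" for t
    by (rule weak_derivative_integral[OF T fD(1) int fD(4) that])
  have diff: "norm (f t) \<le> norm (f s) + n1" if s: "s \<in> {0..T}" for s
  proof -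
    have "f t - f s = (\<integral>r. indicator {..t} r *\<^sub>R dt T f r - indicator {..s} r *\<^sub>R dt T f r \<partial>?M)"
      unfolding rep[OF t] rep[OF s] tint_def using integrable_tint[OF int] by simp
    then have "norm (f t - f s) \<le> (\<integral>r. norm (indicator {..t} r *\<^sub>R dt T f r - indicator {..s} r *\<^sub>R dt T f r) \<partial>?M)"
      by (simp only: integral_norm_bound)
    also have "\<dots> \<le> n1"
      unfolding n1_def
    proof (rule integral_mono)
      show "integrable ?M (\<lambda>r. norm (indicator {..t} r *\<^sub>R dt T f r - indicator {..s} r *\<^sub>R dt T f r))"
        using integrable_tint[OF int] by (intro integrable_norm Bochner_Integration.integrable_diff)
    qed (use int in \<open>auto simp: indicator_def\<close>)
    finally show ?thesis using norm_triangle_ineq2[of "f t" "f s"] by linarith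
  qed
  have meas: "measure ?M (space ?M) = T"
    using T by (simp add: measure_restrict_space space_restrict_space)
  have fint: "integrable ?M (\<lambda>s. norm (f s))" using L2_timeD(3)[OF fD(5)] by simp
  have "(\<integral>s. norm (f t) \<partial>?M) \<le> (\<integral>s. norm (f s) + n1 \<partial>?M)"
    by (rule integral_mono) (use fint diff in \<open>auto simp: space_restrict_space\<close>)
  then have "T * norm (f t) \<le> (\<integral>s. norm (f s) \<partial>?M) + T * n1"
    using fint meas by simp
  also have "\<dots> \<le> sqrt T * L2_time_norm T f + T * (sqrt T * L2_time_norm T (dt T f))"
    unfolding n1_def using T by (intro add_mono mult_left_mono L2_time_norm_L1[OF T fD(5)] L2_time_norm_L1[OF T fD(3)]) auto
  also have "\<dots> \<le> sqrt T * H1_time_norm T f + T * (sqrt T * H1_time_norm T f)"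
    using T by (intro add_mono mult_left_mono H1_time_norm_ge) auto
  also have "\<dots> = T * ((1 / sqrt T + sqrt T) * H1_time_norm T f)"
  proof -
    have "T * (1 / sqrt T) = sqrt T" using T by (simp add: real_div_sqrt)
    then have "T * (1 / sqrt T) * H1_time_norm T f = sqrt T * H1_time_norm T f" by simp
    then show ?thesis by (simp only: distrib_left distrib_right mult.assoc)
  qed
  finally show ?thesis using T by simp
qed

text \<open>Links \<open>tint\<close> with the integral that occurs in the theorem; the two domains
  of integration differ at most by the points 0 and \<open>T\<close>.\<close>

lemma integral_lebesgue_on_tint:
  fixes a :: "real \<Rightarrow> real"
  assumes "continuous_on {0..T} a" "t \<in> {0..T}"
  shows "(\<integral>s. a s \<partial>lebesgue_on {0..t}) = tint T t a"
proof -
  have "(\<integral>s. a s \<partial>lebesgue_on {0..t}) = (\<integral>s. indicator {0..t} s *\<^sub>R a s \<partial>lebesgue)"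
    by (rule integral_restrict_space) simp
  also have "\<dots> = (\<integral>s. indicator {0<..<T} s *\<^sub>R (indicator {..t} s *\<^sub>R a s) \<partial>lebesgue)"
  proof (rule integral_cong_AE)
    have "AE s in lborel. s \<noteq> 0 \<and> s \<noteq> T" by (auto intro: AE_lborel_singleton)
    then have "AE s in lebesgue. s \<noteq> 0 \<and> s \<noteq> T" by (rule AE_completion)
    then show "AE s in lebesgue. indicator {0..t} s *\<^sub>R a s = indicator {0<..<T} s *\<^sub>R (indicator {..t} s *\<^sub>R a s)"
    proof eventually_elim
      fix s assume "s \<noteq> 0 \<and> s \<noteq> T"
      then show "indicator {0..t} s *\<^sub>R a s = indicator {0<..<T} s *\<^sub>R (indicator {..t} s *\<^sub>R a s)"
        using assms(2) by (auto simp: indicator_def)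
    qed
    have "a \<in> borel_measurable (lebesgue_on {0..t})"
      using assms(2) by (intro continuous_imp_measurable_on_sets_lebesgue continuous_on_subset[OF assms(1)]) auto
    then show "(\<lambda>s. indicator {0..t} s *\<^sub>R a s) \<in> borel_measurable lebesgue"
      by (subst (asm) borel_measurable_restrict_space_iff) auto
    have "(\<lambda>s. indicator {..t} s *\<^sub>R a s) \<in> borel_measurable (lebesgue_on {0<..<T})"
      by (intro borel_measurable_integrable integrable_tint continuous_integrable_lebesgue_on(2)[OF assms(1)])
    then show "(\<lambda>s. indicator {0<..<T} s *\<^sub>R (indicator {..t} s *\<^sub>R a s)) \<in> borel_measurable lebesgue"
      by (subst (asm) borel_measurable_restrict_space_iff) auto
  qed
  also have "\<dots> = tint T t a"
    unfolding tint_def by (rule integral_restrict_space[symmetric]) simp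
  finally show ?thesis .
qed

text \<open>The constant is explicit, so that its independence of \<open>lam\<close> can be read
  off. The summands of \<open>K\<close> stem from the sources \<open>h\<close>, \<open>g\<close> and
  \<open>f\<close> in this order. The last one collects two boundary terms with
  \<open>1 / sqrt T + sqrt T\<close> each and one integral with \<open>sqrt T\<close>, all from
  moving the time derivative from \<open>u\<close> to \<open>f\<close>. \<open>CP\<close> is a
  constant for \<open>W\<close> alone.\<close>

lemma energy_estimate:
  fixes \<Omega> \<Gamma>D :: "space set"
  assumes op: "open \<Omega>" and T: "0 < T"
    and par: "0 < \<epsilon>" "0 < \<sigma>" "0 < \<mu>" "0 < G" "0 < \<alpha>" "0 < \<kappa>" "0 < c0" "0 < L" "L < sqrt (\<sigma> * \<kappa>)" "0 < lam"
    and W: "W = closure (span ((\<lambda>v. (v, vgrad \<Omega> v)) ` sp_U \<Omega> \<Gamma>D))"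
    and CP: "0 < CP" "\<forall>(u, A)\<in>W. \<exists>k. (k, 0) \<in> W \<and> norm (u - k) \<le> CP * norm A"
    and f: "f \<in> H1_time T (L2 \<Omega>)" and h: "h \<in> L2_time T (L2 \<Omega>)" and g: "g \<in> L2_time T (L2 \<Omega>)"
    and reg: "regular_in_time \<Omega> \<Gamma>D T E H u \<xi> p"
    and sol: "weak_solution \<Omega> \<Gamma>D T \<epsilon> \<sigma> \<mu> G lam \<alpha> \<kappa> c0 L f h g E H u \<xi> p E0 H0 u0 \<xi>0 p0"
  defines "\<theta> \<equiv> 1 - L / sqrt (\<sigma> * \<kappa>)"
    and "S \<equiv> \<lambda>t. energy \<Omega> \<epsilon> \<mu> G lam \<alpha> c0 (E t) (H t) (u t) (\<xi> t) (p t)"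
    and "K \<equiv> sqrt T / sqrt \<epsilon> + sqrt T / sqrt c0 + CP / sqrt G * (2 / sqrt T + 3 * sqrt T)"
  shows "\<And>t. t \<in> {0..T} \<Longrightarrow> S t + \<theta> * (\<integral>s. dissipation \<Omega> \<sigma> \<kappa> (E s) (p s) \<partial>lebesgue_on {0..t})
      \<le> (2 + 12 * K\<^sup>2) * (S 0 + (H1_time_norm T f)\<^sup>2 + (L2_time_norm T h)\<^sup>2 + (L2_time_norm T g)\<^sup>2)"
    and "\<And>t v. t \<in> {0..T} \<Longrightarrow> v \<in> sp_U \<Omega> \<Gamma>D \<Longrightarrow>
      G * (vgrad \<Omega> (u t) \<bullet> vgrad \<Omega> v) - \<xi> t \<bullet> wdiv \<Omega> v = f t \<bullet> v"
proof -
  let ?M = "lebesgue_on {0<..<T}"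
  define A where "A t = vgrad \<Omega> (u t)" for t
  define N where "N t = grad \<Omega> (p t)" for t
  define tr where "tr = (l2_map mat_trace :: matrix_field \<Rightarrow> scalar_field)"
  have tr: "bounded_linear tr" unfolding tr_def by (rule bounded_linear_l2_map[OF bounded_linear_mat_trace])
  have E: "E \<in> H1_time_graph T (curl \<Omega>) (sp_E \<Omega>)" and H: "H \<in> H1_time T (sp_H \<Omega>)"
    and u: "u \<in> H1_time_graph T (vgrad \<Omega>) (sp_U \<Omega> \<Gamma>D)" and \<xi>: "\<xi> \<in> H1_time T (sp_W \<Omega>)"
    and p: "p \<in> H1_time_graph T (grad \<Omega>) (sp_P \<Omega>)"
    using reg by (simp_all add: regular_in_time_def)
  note ED = H1_time_graphD[OF E] and HD = H1_timeD[OF H] and uD = H1_time_graphD[OF u]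
    and \<xi>D = H1_timeD[OF \<xi>] and pD = H1_time_graphD[OF p] and fD = H1_timeD[OF f]
  obtain d d' where d: "d \<in> L2_time T UNIV" "d' \<in> L2_time T UNIV" "is_time_deriv T u d" "is_time_deriv T A d'"
    "AE t in ?M. d t \<in> sp_U \<Omega> \<Gamma>D \<and> d' t = vgrad \<Omega> (d t)"
    using uD(6) unfolding A_def[abs_def] by blast
  have cont: "continuous_on {0..T} E" "continuous_on {0..T} H" "continuous_on {0..T} u" "continuous_on {0..T} A"
    "continuous_on {0..T} \<xi>" "continuous_on {0..T} p" "continuous_on {0..T} N" "continuous_on {0..T} f"
    using ED(1) HD(1) uD(1,2) \<xi>D(1) pD(1,2) fD(1) by (simp_all add: A_def[abs_def] N_def[abs_def])
  have wdiv: "wdiv \<Omega> v = tr (vgrad \<Omega> v)" if "v \<in> sp_U \<Omega> \<Gamma>D" for v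
    unfolding tr_def using that sp_U_subset_VH1 by (intro wdiv_eq_trace[OF op]) auto
  have uW: "(u t, A t) \<in> W" if "t \<in> {0..T}" for t
  proof -
    have "(u t, A t) \<in> (\<lambda>v. (v, vgrad \<Omega> v)) ` sp_U \<Omega> \<Gamma>D" unfolding A_def using uD(3)[OF that] by blast
    then show ?thesis unfolding W by (meson closure_subset span_superset subsetD)
  qed

  \<comment> \<open>The weak equations at every time\<close>
  define weak_eqs where "weak_eqs t \<longleftrightarrow> (\<forall>D\<in>sp_E \<Omega>. \<forall>B\<in>sp_H \<Omega>. \<forall>v\<in>sp_U \<Omega> \<Gamma>D. \<forall>w\<in>sp_W \<Omega>. \<forall>q\<in>sp_P \<Omega>.
     \<epsilon> * (dt T E t \<bullet> D) + \<sigma> * (E t \<bullet> D) - H t \<bullet> curl \<Omega> D - L * (N t \<bullet> D) = h t \<bullet> D \<and>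
     \<mu> * (dt T H t \<bullet> B) + curl \<Omega> (E t) \<bullet> B = 0 \<and>
     G * (A t \<bullet> vgrad \<Omega> v) - \<xi> t \<bullet> wdiv \<Omega> v = f t \<bullet> v \<and>
     wdiv \<Omega> (u t) \<bullet> w + (1 / lam) * (\<xi> t \<bullet> w) - (\<alpha> / lam) * (p t \<bullet> w) = 0 \<and>
     (c0 + \<alpha>\<^sup>2 / lam) * (dt T p t \<bullet> q) - (\<alpha> / lam) * (dt T \<xi> t \<bullet> q)
       + \<kappa> * (N t \<bullet> grad \<Omega> q) - L * (E t \<bullet> grad \<Omega> q) = g t \<bullet> q)" for t
  have "AE t in lebesgue. t \<in> {0<..T} \<longrightarrow> weak_eqs t"
    using sol unfolding weak_solution_def weak_eqs_def A_def N_def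
    by (elim conjE, subst (asm) AE_restrict_space_iff) (simp, erule eventually_mono, blast)
  then have eqs: "AE t in ?M. weak_eqs t"
    by (subst AE_restrict_space_iff) (simp, erule eventually_mono, simp)
  \<comment> \<open>The equations are quantified jointly over five test functions, so extracting one
    of them takes an element of every other space: zero where the space is all of
    \<open>L2 \<Omega>\<close>, an initial value elsewhere.\<close>
  have zero: "0 \<in> sp_H \<Omega>" "0 \<in> sp_W \<Omega>" using subspace_0[OF subspace_L2] by (auto simp: sp_H_def sp_W_def)
  have nonempty: "E 0 \<in> sp_E \<Omega>" "u 0 \<in> sp_U \<Omega> \<Gamma>D" "p 0 \<in> sp_P \<Omega>"
    using ED(3)[of 0] uD(3)[of 0] pD(3)[of 0] T by auto

  show momentum: "G * (vgrad \<Omega> (u t) \<bullet> vgrad \<Omega> v) - \<xi> t \<bullet> wdiv \<Omega> v = f t \<bullet> v"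
    if t: "t \<in> {0..T}" and v: "v \<in> sp_U \<Omega> \<Gamma>D" for t v
  proof -
    have "G * (A t \<bullet> vgrad \<Omega> v) - \<xi> t \<bullet> wdiv \<Omega> v - f t \<bullet> v = 0"
    proof (rule continuous_AE_eq_0[OF T _ _ t])
      show "continuous_on {0..T} (\<lambda>t. G * (A t \<bullet> vgrad \<Omega> v) - \<xi> t \<bullet> wdiv \<Omega> v - f t \<bullet> v)"
        by (intro continuous_intros cont)
      show "AE t in ?M. G * (A t \<bullet> vgrad \<Omega> v) - \<xi> t \<bullet> wdiv \<Omega> v - f t \<bullet> v = 0"
        using eqs
      proof eventually_elim
        case (elim t)
        from this[unfolded weak_eqs_def, rule_format, OF nonempty(1) zero(1) v zero(2) nonempty(3)] show ?case by simp
      qed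
    qed
    then show ?thesis by (simp add: A_def)
  qed
  \<comment> \<open>The residual \<open>z t\<close> of the fourth equation belongs to
    \<open>sp_W\<close> and can therefore be taken as its own test function.\<close>
  have mass: "tr (A t) = (- (1 / lam)) *\<^sub>R (\<xi> t - \<alpha> *\<^sub>R p t)" if t: "t \<in> {0..T}" for t
  proof -
    define z where "z s = tr (A s) + (1 / lam) *\<^sub>R \<xi> s - (\<alpha> / lam) *\<^sub>R p s" for s
    have cz: "continuous_on {0..T} z"
      unfolding z_def by (intro continuous_intros cont bounded_linear.continuous_on[OF tr])
    have "z t \<in> sp_W \<Omega>"
    proof -
      have "wdiv \<Omega> (u t) \<in> L2 \<Omega>" using uD(3)[OF t] sp_U_subset_VH1 by (intro wdiv_L2[OF op]) auto
      then have "tr (A t) \<in> L2 \<Omega>" using wdiv[OF uD(3)[OF t]] by (simp add: A_def)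
      moreover have "\<xi> t \<in> L2 \<Omega>" using \<xi>D(2)[OF t] by (simp add: sp_W_def)
      moreover have "p t \<in> L2 \<Omega>" using pD(3)[OF t] by (auto simp: sp_P_def is_grad_def)
      ultimately show ?thesis
        unfolding z_def sp_W_def
        by (intro subspace_add[OF subspace_L2] subspace_diff[OF subspace_L2] subspace_scale[OF subspace_L2])
    qed
    have zw: "z t \<bullet> w = 0" if w: "w \<in> sp_W \<Omega>" for w
    proof (rule continuous_AE_eq_0[OF T _ _ t])
      show "continuous_on {0..T} (\<lambda>t. z t \<bullet> w)" by (intro continuous_intros cz)
      have "AE s in ?M. s \<in> {0<..<T}" by (intro AE_I2) (simp add: space_restrict_space)
      with eqs show "AE t in ?M. z t \<bullet> w = 0"
      proof eventually_elim
        case (elim s)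
        have "u s \<in> sp_U \<Omega> \<Gamma>D" using elim(2) by (intro uD(3)) auto
        from wdiv[OF this] elim(1)[unfolded weak_eqs_def, rule_format, OF nonempty(1) zero(1) nonempty(2) w nonempty(3)]
        show ?case by (simp add: z_def A_def inner_add_left inner_diff_left)
      qed
    qed
    have "z t = 0" using zw[OF \<open>z t \<in> sp_W \<Omega>\<close>] by simp
    then have "tr (A t) = (\<alpha> / lam) *\<^sub>R p t - (1 / lam) *\<^sub>R \<xi> t" by (simp add: z_def algebra_simps)
    also have "\<dots> = (- (1 / lam)) *\<^sub>R (\<xi> t - \<alpha> *\<^sub>R p t)" by (simp add: algebra_simps)
    finally show ?thesis .
  qed

  \<comment> \<open>The source, and below also its time derivative, annihilate the kernel of the
    gradient, so that inner products of either with \<open>u\<close> only see \<open>u\<close>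
    modulo this kernel.\<close>
  have orth: "f t \<bullet> k = 0" if "t \<in> {0..T}" "(k, 0) \<in> W" for t k
    using source_orthogonal_kernel[OF op momentum[OF that(1)]] that(2) W by blast
  have orth': "AE t in ?M. \<forall>k\<in>{k. (k, 0) \<in> W}. dt T f t \<bullet> k = 0"
    by (rule AE_orthogonal_all, rule weak_derivative_orthogonal[OF cont(8) fD(3,4)]) (use orth in auto)
  have poincare: "\<bar>x \<bullet> u t\<bar> \<le> CP * norm x * norm (A t)"
    if t: "t \<in> {0..T}" and x: "\<And>k. (k, 0) \<in> W \<Longrightarrow> x \<bullet> k = 0" for x t
  proof -
    obtain k where k: "(k, 0) \<in> W" "norm (u t - k) \<le> CP * norm (A t)" using bspec[OF CP(2) uW[OF t]] by auto
    have "\<bar>x \<bullet> u t\<bar> = \<bar>x \<bullet> (u t - k)\<bar>" by (simp add: inner_diff_right x[OF k(1)])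
    also have "\<dots> \<le> norm x * norm (u t - k)" by (rule Cauchy_Schwarz_ineq2)
    also have "\<dots> \<le> norm x * (CP * norm (A t))" by (intro mult_left_mono k(2)) simp
    finally show ?thesis by (simp add: mult_ac)
  qed

  \<comment> \<open>Integral representations in time\<close>
  define q where "q t = \<xi> t - \<alpha> *\<^sub>R p t" for t
  define q' where "q' t = dt T \<xi> t - \<alpha> *\<^sub>R dt T p t" for t
  have cq: "continuous_on {0..T} q" unfolding q_def by (intro continuous_intros cont)
  note L1 = L2_timeD(3)[OF ED(4)] L2_timeD(3)[OF HD(3)] L2_timeD(3)[OF d(1)] L2_timeD(3)[OF d(2)]
    L2_timeD(3)[OF \<xi>D(3)] L2_timeD(3)[OF pD(4)] L2_timeD(3)[OF fD(3)]
  have iq': "integrable ?M q'" unfolding q'_def by (intro Bochner_Integration.integrable_diff integrable_scaleR_right L1)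
  have itr: "integrable ?M (\<lambda>s. tr (d' s))" by (rule integrable_bounded_linear[OF tr L1(4)])
  note WD = weak_derivative_integral[OF T]
  have rE: "\<forall>t\<in>{0..T}. E t = E 0 + tint T t (dt T E)" using WD[OF cont(1) L1(1) ED(5)] by blast
  have rH: "\<forall>t\<in>{0..T}. H t = H 0 + tint T t (dt T H)" using WD[OF cont(2) L1(2) HD(4)] by blast
  have ru: "\<forall>t\<in>{0..T}. u t = u 0 + tint T t d" using WD[OF cont(3) L1(3) d(3)] by blast
  have rA: "\<forall>t\<in>{0..T}. A t = A 0 + tint T t d'" using WD[OF cont(4) L1(4) d(4)] by blast
  have r\<xi>: "\<forall>t\<in>{0..T}. \<xi> t = \<xi> 0 + tint T t (dt T \<xi>)" using WD[OF cont(5) L1(5) \<xi>D(4)] by blast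
  have rp: "\<forall>t\<in>{0..T}. p t = p 0 + tint T t (dt T p)" using WD[OF cont(6) L1(6) pD(5)] by blast
  have rf: "\<forall>t\<in>{0..T}. f t = f 0 + tint T t (dt T f)" using WD[OF cont(8) L1(7) fD(4)] by blast
  have rq: "\<forall>t\<in>{0..T}. q t = q 0 + tint T t q'"
  proof
    fix t assume t: "t \<in> {0..T}"
    have "tint T t q' = tint T t (dt T \<xi>) - \<alpha> *\<^sub>R tint T t (dt T p)"
      unfolding q'_def
      using tint_add[OF L1(5) integrable_scaleR_right[of "- \<alpha>", OF L1(6)], of t]
        tint_bounded_linear[OF bounded_linear_scaleR_right[of "- \<alpha>"] L1(6), of t] by simp
    then show "q t = q 0 + tint T t q'"
      unfolding q_def using bspec[OF r\<xi> t] bspec[OF rp t] by (simp add: algebra_simps)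
  qed
  have rtr1: "\<forall>t\<in>{0..T}. tr (A t) = tr (A 0) + tint T t (\<lambda>s. tr (d' s))"
    unfolding tint_bounded_linear[OF tr L1(4)] using rA linear_add[OF bounded_linear.linear[OF tr]] by metis
  have rtr2: "\<forall>t\<in>{0..T}. tr (A t) = tr (A 0) + tint T t (\<lambda>s. (- (1 / lam)) *\<^sub>R q' s)"
  proof
    fix t assume t: "t \<in> {0..T}"
    have "0 \<in> {0..T}" using T by simp
    then show "tr (A t) = tr (A 0) + tint T t (\<lambda>s. (- (1 / lam)) *\<^sub>R q' s)"
      unfolding tint_bounded_linear[OF bounded_linear_scaleR_right iq'] mass[OF t] mass[OF \<open>0 \<in> {0..T}\<close>]
        q_def[symmetric]
      using bspec[OF rq t] by (simp add: scaleR_add_right)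
  qed
  have square: "tint T t (\<lambda>s. a' s \<bullet> a s) = ((norm (a t))\<^sup>2 - (norm (a 0))\<^sup>2) / 2"
    if "integrable ?M a'" "\<forall>t\<in>{0..T}. a t = a 0 + tint T t a'" "t \<in> {0..T}"
    for a a' :: "real \<Rightarrow> 'h::{real_inner, banach, second_countable_topology}" and t
    using inner_integration_by_parts[OF that(1,1,2,2,3)]
    by (simp add: inner_commute[of "a _" "a' _"] power2_norm_eq_inner)
  \<comment> \<open>\<open>tr d'\<close> and \<open>- q' / \<lambda>\<close> are both derivatives of \<open>tr A\<close>; integrating by parts against \<open>\<xi>\<close> with either
    one shows that they are interchangeable.\<close>
  have exchange: "tint T t (\<lambda>s. \<xi> s \<bullet> tr (d' s)) = - (1 / lam) * tint T t (\<lambda>s. \<xi> s \<bullet> q' s)" if t: "t \<in> {0..T}" for t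
  proof -
    note ibp = inner_integration_by_parts[OF L1(5) _ r\<xi> _ t]
    from ibp[OF itr rtr1] ibp[OF integrable_scaleR_right[OF iq'] rtr2]
    have "tint T t (\<lambda>s. \<xi> s \<bullet> tr (d' s)) = tint T t (\<lambda>s. \<xi> s \<bullet> (- (1 / lam)) *\<^sub>R q' s)" by simp
    also have "\<dots> = - (1 / lam) * tint T t (\<lambda>s. \<xi> s \<bullet> q' s)"
      using tint_mult[of T t "- (1 / lam)"] by simp
    finally show ?thesis .
  qed

  \<comment> \<open>Dissipation and the integrated energy identity\<close>
  define r where "r = L / sqrt (\<sigma> * \<kappa>)"
  have r: "0 < r" "r < 1" "\<theta> = 1 - r"
    using par by (auto simp: r_def \<theta>_def divide_less_eq)
  define V where "V s = dissipation \<Omega> \<sigma> \<kappa> (E s) (p s)" for s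
  have V: "V s = \<sigma> * (norm (E s))\<^sup>2 + \<kappa> * (norm (N s))\<^sup>2" for s by (simp add: V_def dissipation_def N_def)
  have V0: "0 \<le> V s" for s using par by (simp add: V)
  have cV: "continuous_on {0..T} V" unfolding V by (intro continuous_intros cont)
  define R where "R s = V s - 2 * L * (E s \<bullet> N s)" for s
  have cR: "continuous_on {0..T} R" unfolding R_def by (intro continuous_intros cont cV)
  \<comment> \<open>Young's inequality with the weights \<open>sqrt \<sigma>\<close> and
    \<open>sqrt \<kappa>\<close>: relative to the weighted norms the coupling term carries exactly
    the factor \<open>r\<close>, which is less than 1.\<close>
  have RV: "\<theta> * V s \<le> R s" for s
  proof -
    have "2 * L * (E s \<bullet> N s) \<le> 2 * L * (norm (E s) * norm (N s))"
      using par norm_cauchy_schwarz[of "E s" "N s"] by simp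
    also have "\<dots> = r * (2 * (sqrt \<sigma> * norm (E s)) * (sqrt \<kappa> * norm (N s)))"
      using par by (simp add: r_def real_sqrt_mult)
    also have "\<dots> \<le> r * ((sqrt \<sigma> * norm (E s))\<^sup>2 + (sqrt \<kappa> * norm (N s))\<^sup>2)"
      using r by (intro mult_left_mono sum_squares_bound) auto
    also have "\<dots> = r * V s" using par by (simp add: V power_mult_distrib)
    finally show ?thesis by (simp add: R_def r(3) algebra_simps)
  qed
  have S: "S t = \<epsilon> * (norm (E t))\<^sup>2 + \<mu> * (norm (H t))\<^sup>2 + G * (norm (A t))\<^sup>2 + (1 / lam) * (norm (q t))\<^sup>2
      + c0 * (norm (p t))\<^sup>2" for t
    by (simp add: S_def energy_def A_def q_def)
  have cS: "continuous_on {0..T} S" unfolding S by (intro continuous_intros cont cq)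
  have S0: "0 \<le> S t" for t using par by (simp add: S)

  have ints: "integrable ?M (\<lambda>s. dt T E s \<bullet> E s)" "integrable ?M (\<lambda>s. dt T H s \<bullet> H s)" "integrable ?M (\<lambda>s. d' s \<bullet> A s)"
    "integrable ?M (\<lambda>s. q' s \<bullet> q s)" "integrable ?M (\<lambda>s. dt T p s \<bullet> p s)" "integrable ?M R"
    "integrable ?M (\<lambda>s. h s \<bullet> E s)" "integrable ?M (\<lambda>s. g s \<bullet> p s)" "integrable ?M (\<lambda>s. d s \<bullet> f s)"
    "integrable ?M (\<lambda>s. tr (d' s) \<bullet> \<xi> s)" "integrable ?M (\<lambda>s. q' s \<bullet> \<xi> s)" "integrable ?M (\<lambda>s. dt T f s \<bullet> u s)"
    by (intro integrable_inner_continuous L1 iq' itr cont cq L2_timeD(3)[OF h] L2_timeD(3)[OF g]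
        continuous_integrable_lebesgue_on(2)[OF cR])+
  \<comment> \<open>Formally half the time derivative of \<open>S\<close>.\<close>
  define e where "e s = \<epsilon> * (dt T E s \<bullet> E s) + \<mu> * (dt T H s \<bullet> H s) + G * (d' s \<bullet> A s) + (1 / lam) * (q' s \<bullet> q s)
      + c0 * (dt T p s \<bullet> p s)" for s
  have ie: "integrable ?M e" unfolding e_def by (intro Bochner_Integration.integrable_add integrable_mult_right ints)
  \<comment> \<open>The first, second, third and fifth equations tested with \<open>E s\<close>,
    \<open>H s\<close>, \<open>d s\<close> and \<open>p s\<close>; the fourth is tested with 0 here
    and enters through \<open>exchange\<close>. Since \<open>q s - \<xi> s\<close> is
    \<open>- \<alpha>\<close> times \<open>p s\<close>, completing the pressure terms to
    \<open>q' s \<bullet> q s\<close> leaves a term with \<open>\<xi> s\<close>. Together with the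
    divergence term of the third equation it cancels after integration in time.\<close>
  have pointwise: "AE s in ?M. e s + R s + - 1 * (tr (d' s) \<bullet> \<xi> s) + - (1 / lam) * (q' s \<bullet> \<xi> s)
      = h s \<bullet> E s + g s \<bullet> p s + d s \<bullet> f s"
  proof -
    have "AE s in ?M. s \<in> {0<..<T}" by (intro AE_I2) (simp add: space_restrict_space)
    with eqs d(5) show ?thesis
    proof eventually_elim
      case (elim s)
      have s: "s \<in> {0..T}" using elim(3) by auto
      have du: "d s \<in> sp_U \<Omega> \<Gamma>D" "vgrad \<Omega> (d s) = d' s" using elim(2) by auto
      have "curl \<Omega> (E s) \<bullet> H s = H s \<bullet> curl \<Omega> (E s)" by (rule inner_commute)
      with elim(1)[unfolded weak_eqs_def, rule_format, OF ED(3)[OF s] HD(2)[OF s] du(1) zero(2) pD(3)[OF s]]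
      have eq: "\<epsilon> * (dt T E s \<bullet> E s) + \<sigma> * (E s \<bullet> E s) + \<mu> * (dt T H s \<bullet> H s) - L * (N s \<bullet> E s)
          + (G * (A s \<bullet> d' s) - \<xi> s \<bullet> tr (d' s))
          + ((c0 + \<alpha>\<^sup>2 / lam) * (dt T p s \<bullet> p s) - (\<alpha> / lam) * (dt T \<xi> s \<bullet> p s)
             + \<kappa> * (N s \<bullet> N s) - L * (E s \<bullet> N s)) = h s \<bullet> E s + f s \<bullet> d s + g s \<bullet> p s"
        by (simp add: wdiv[OF du(1)] du(2) N_def[symmetric])
      have "(1 / lam) * (q' s \<bullet> q s) + - (1 / lam) * (q' s \<bullet> \<xi> s)
          = \<alpha>\<^sup>2 / lam * (dt T p s \<bullet> p s) - (\<alpha> / lam) * (dt T \<xi> s \<bullet> p s)"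
        by (simp add: q'_def q_def inner_diff_left inner_diff_right power2_eq_square algebra_simps
            diff_divide_distrib add_divide_distrib)
      with eq show ?case
        by (simp add: e_def R_def V power2_norm_eq_inner distrib_right inner_commute[of "N s" "E s"]
            inner_commute[of "A s"] inner_commute[of "\<xi> s"] inner_commute[of "f s"])
    qed
  qed

  have identity: "(S t - S 0) / 2 + tint T t R = tint T t (\<lambda>s. h s \<bullet> E s) + tint T t (\<lambda>s. g s \<bullet> p s)
      + (f t \<bullet> u t - f 0 \<bullet> u 0 - tint T t (\<lambda>s. dt T f s \<bullet> u s))" if t: "t \<in> {0..T}" for t
  proof -
    have "tint T t e = \<epsilon> * tint T t (\<lambda>s. dt T E s \<bullet> E s) + \<mu> * tint T t (\<lambda>s. dt T H s \<bullet> H s)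
        + G * tint T t (\<lambda>s. d' s \<bullet> A s) + (1 / lam) * tint T t (\<lambda>s. q' s \<bullet> q s)
        + c0 * tint T t (\<lambda>s. dt T p s \<bullet> p s)"
      unfolding e_def
      by (simp only: tint_add tint_mult ints Bochner_Integration.integrable_add integrable_mult_right)
    also have "\<dots> = (S t - S 0) / 2"
      unfolding square[OF L1(1) rE t] square[OF L1(2) rH t] square[OF L1(4) rA t]
        square[OF iq' rq t] square[OF L1(6) rp t] S
      by (simp add: algebra_simps diff_divide_distrib add_divide_distrib)
    finally have te: "tint T t e = (S t - S 0) / 2" .
    have fu: "tint T t (\<lambda>s. d s \<bullet> f s) = f t \<bullet> u t - f 0 \<bullet> u 0 - tint T t (\<lambda>s. dt T f s \<bullet> u s)"
      using inner_integration_by_parts[OF L1(7,3) rf ru t] by (simp add: inner_commute[of "f _" "d _"])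
    have ex: "- 1 * tint T t (\<lambda>s. tr (d' s) \<bullet> \<xi> s) + - (1 / lam) * tint T t (\<lambda>s. q' s \<bullet> \<xi> s) = 0"
      using exchange[OF t] by (simp add: inner_commute)
    have "tint T t (\<lambda>s. e s + R s + - 1 * (tr (d' s) \<bullet> \<xi> s) + - (1 / lam) * (q' s \<bullet> \<xi> s))
        = tint T t (\<lambda>s. h s \<bullet> E s + g s \<bullet> p s + d s \<bullet> f s)"
      by (intro tint_cong_AE pointwise Bochner_Integration.integrable_add integrable_mult_right ints ie)
    then have "tint T t e + tint T t R + - 1 * tint T t (\<lambda>s. tr (d' s) \<bullet> \<xi> s) + - (1 / lam) * tint T t (\<lambda>s. q' s \<bullet> \<xi> s)
        = tint T t (\<lambda>s. h s \<bullet> E s) + tint T t (\<lambda>s. g s \<bullet> p s) + tint T t (\<lambda>s. d s \<bullet> f s)"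
      by (simp only: tint_add tint_mult ints ie Bochner_Integration.integrable_add integrable_mult_right)
    with te fu ex show ?thesis by linarith
  qed

  \<comment> \<open>Bounds by the maximal energy, and its absorption\<close>
  obtain ts where ts: "ts \<in> {0..T}" "\<And>t. t \<in> {0..T} \<Longrightarrow> S t \<le> S ts"
    using continuous_attains_sup[OF compact_Icc _ cS] T by auto
  define X where "X = sqrt (S ts)"
  have X: "0 \<le> X" "X\<^sup>2 = S ts" using S0 by (auto simp: X_def)
  \<comment> \<open>Applied with the weights \<open>\<epsilon>\<close>, \<open>c0\<close> and
    \<open>G\<close> of the energy, none of which involves \<open>lam\<close>.\<close>
  have bnd: "norm x \<le> X / sqrt a" if "0 < a" "a * (norm x)\<^sup>2 \<le> S t" "t \<in> {0..T}" for a t and x :: "'h::real_normed_vector"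
  proof -
    have "(sqrt a * norm x)\<^sup>2 \<le> X\<^sup>2" using that ts(2)[OF that(3)] by (simp add: power_mult_distrib X(2))
    then have "sqrt a * norm x \<le> X" by (rule power2_le_imp_le) (rule X(1))
    then show ?thesis using that(1) by (simp add: field_simps)
  qed
  have bE: "norm (E t) \<le> X / sqrt \<epsilon>" and bp: "norm (p t) \<le> X / sqrt c0" and bA: "norm (A t) \<le> X / sqrt G"
    if "t \<in> {0..T}" for t
    by (rule bnd[OF _ _ that]; use par in \<open>simp add: S\<close>)+
  define nf nh ng where "nf = H1_time_norm T f" and "nh = L2_time_norm T h" and "ng = L2_time_norm T g"
  have n0: "0 \<le> nf" "0 \<le> nh" "0 \<le> ng"
    by (auto simp: nf_def nh_def ng_def H1_time_norm_def L2_time_norm_nonneg)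
  have inM: "AE s in ?M. s \<in> {0..T}" by (intro AE_I2) (simp add: space_restrict_space)
  have b1: "tint T t (\<lambda>s. h s \<bullet> E s) \<le> X / sqrt \<epsilon> * sqrt T * nh" for t
    unfolding nh_def using X(1) par bE by (intro tint_inner_bound[OF T h cont(1)]) auto
  have b2: "tint T t (\<lambda>s. g s \<bullet> p s) \<le> X / sqrt c0 * sqrt T * ng" for t
    unfolding ng_def using X(1) par bp by (intro tint_inner_bound[OF T g cont(6)]) auto
  have b3: "\<bar>tint T t (\<lambda>s. dt T f s \<bullet> u s)\<bar> \<le> CP * (X / sqrt G) * sqrt T * nf" for t
  proof -
    have "\<bar>tint T t (\<lambda>s. dt T f s \<bullet> u s)\<bar> \<le> CP * (X / sqrt G) * sqrt T * L2_time_norm T (dt T f)"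
    proof (rule tint_bound[OF T ints(12) fD(3)])
      show "AE s in ?M. \<bar>dt T f s \<bullet> u s\<bar> \<le> CP * (X / sqrt G) * norm (dt T f s)"
        using inM orth'
      proof eventually_elim
        case (elim s)
        have "\<bar>dt T f s \<bullet> u s\<bar> \<le> CP * norm (dt T f s) * norm (A s)"
          by (rule poincare[OF elim(1)]) (use elim(2) in blast)
        also have "\<dots> \<le> CP * norm (dt T f s) * (X / sqrt G)"
          using bA[OF elim(1)] CP(1) by (intro mult_left_mono) auto
        finally show ?case by (simp add: mult_ac)
      qed
    qed (use X par CP in simp)
    also have "\<dots> \<le> CP * (X / sqrt G) * sqrt T * nf"
      unfolding nf_def using X par CP T by (intro mult_left_mono H1_time_norm_ge) auto
    finally show ?thesis .
  qed
  have b4: "\<bar>f t \<bullet> u t\<bar> \<le> CP * (X / sqrt G) * ((1 / sqrt T + sqrt T) * nf)" if t: "t \<in> {0..T}" for t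
  proof -
    have "\<bar>f t \<bullet> u t\<bar> \<le> CP * norm (f t) * norm (A t)" by (rule poincare[OF t orth[OF t]])
    also have "\<dots> \<le> CP * ((1 / sqrt T + sqrt T) * nf) * (X / sqrt G)"
      unfolding nf_def using H1_time_sup_bound[OF T f t] bA[OF t] CP(1) X(1)
        order_trans[OF norm_ge_zero H1_time_sup_bound[OF T f t]]
      by (intro mult_mono mult_nonneg_nonneg[of CP]) auto
    finally show ?thesis by (simp add: mult_ac)
  qed
  define D where "D = nf + nh + ng"
  have rhs: "X / sqrt \<epsilon> * sqrt T * nh + X / sqrt c0 * sqrt T * ng
      + (2 * (CP * (X / sqrt G) * ((1 / sqrt T + sqrt T) * nf)) + CP * (X / sqrt G) * sqrt T * nf) \<le> X * K * D"
  proof -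
    define a b c where "a = sqrt T / sqrt \<epsilon>" and "b = sqrt T / sqrt c0" and "c = CP / sqrt G * (2 / sqrt T + 3 * sqrt T)"
    have abc: "0 \<le> a" "0 \<le> b" "0 \<le> c" "K = a + b + c"
      using par T CP by (auto simp: a_def b_def c_def K_def intro!: add_nonneg_nonneg mult_nonneg_nonneg)
    have "X / sqrt \<epsilon> * sqrt T * nh + X / sqrt c0 * sqrt T * ng
        + (2 * (CP * (X / sqrt G) * ((1 / sqrt T + sqrt T) * nf)) + CP * (X / sqrt G) * sqrt T * nf)
        = X * (a * nh + b * ng + c * nf)"
      by (simp add: a_def b_def c_def distrib_left distrib_right mult_ac)
    also have "\<dots> \<le> X * (K * D)"
    proof (intro mult_left_mono X)
      have "0 \<le> a * nf + a * ng + b * nf + b * nh + c * nh + c * ng"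
        using abc n0 by (intro add_nonneg_nonneg mult_nonneg_nonneg)
      then show "a * nh + b * ng + c * nf \<le> K * D"
        unfolding abc(4) D_def by (simp add: algebra_simps)
    qed
    finally show ?thesis by (simp add: mult.assoc)
  qed
  have main: "S t + 2 * (\<theta> * tint T t V) \<le> S 0 + 2 * (X * K * D)" if t: "t \<in> {0..T}" for t
  proof -
    have "\<theta> * tint T t V \<le> tint T t R"
      unfolding tint_mult[symmetric]
      by (intro tint_mono integrable_mult_right continuous_integrable_lebesgue_on(2)[OF cV]
          continuous_integrable_lebesgue_on(2)[OF cR] RV)
    moreover have "0 \<in> {0..T}" using T by simp
    \<comment> \<open>Real arithmetic in isolation: \<open>b\<close> and \<open>a\<close> stand for
      the inner product of source and displacement at the times \<open>t\<close> and 0, with the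
      common bound \<open>c4\<close>, and \<open>w\<close> for the integral left over from the
      integration by parts.\<close>
    moreover have "x + 2 * v \<le> y + 2 * z"
      if "v \<le> r" "(x - y) / 2 + r = h + g + (b - a - w)" "h \<le> c1" "g \<le> c2" "\<bar>w\<bar> \<le> c3" "\<bar>b\<bar> \<le> c4"
        "\<bar>a\<bar> \<le> c4" "c1 + c2 + (2 * c4 + c3) \<le> z" for x y v z r h g b a w c1 c2 c3 c4 :: real
      using that(1-4,8) abs_le_D2[OF that(5)] abs_le_D1[OF that(6)] abs_le_D2[OF that(7)]
      by (simp add: field_simps)
    ultimately show ?thesis
      using identity[OF t] b1[of t] b2[of t] b3[of t] b4[OF t] b4[of 0] rhs by blast
  qed
  have tV: "0 \<le> \<theta> * tint T t V" for t
    using r V0 by (auto simp: tint_def intro!: mult_nonneg_nonneg integral_nonneg)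
  \<comment> \<open>Half of \<open>X\<^sup>2\<close> on the right is absorbed by means of
    \<open>X\<^sup>2 \<le> S 0 + 2 * (X * K * D)\<close>, which is \<open>main\<close> at the time
    of the maximum with the dissipation dropped.\<close>
  have "2 * (X * K * D) \<le> X\<^sup>2 / 2 + 2 * (K * D)\<^sup>2"
    using sum_squares_bound[of X "2 * (K * D)"] by (simp add: power_mult_distrib algebra_simps)
  moreover have "X\<^sup>2 \<le> S 0 + 2 * (X * K * D)" using main[OF ts(1)] tV[of ts] X(2) by linarith
  ultimately have XKD: "2 * (X * K * D) \<le> S 0 + 4 * (K * D)\<^sup>2" by linarith
  have D2: "D\<^sup>2 \<le> 3 * (nf\<^sup>2 + nh\<^sup>2 + ng\<^sup>2)"
    using sum_squares_bound[of nf nh] sum_squares_bound[of nf ng] sum_squares_bound[of nh ng]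
    by (simp add: D_def power2_eq_square algebra_simps)

  fix t assume t: "t \<in> {0..T}"
  have "(\<integral>s. dissipation \<Omega> \<sigma> \<kappa> (E s) (p s) \<partial>lebesgue_on {0..t}) = tint T t V"
    using integral_lebesgue_on_tint[OF cV t] by (simp add: V_def)
  \<comment> \<open>One of the two copies of the dissipation in \<open>main\<close> is dropped. The
    factor 4 from the absorption and the factor 3 in \<open>D2\<close>, from squaring a sum of three
    norms, multiply to the 12 of the final constant.\<close>
  then have "S t + \<theta> * (\<integral>s. dissipation \<Omega> \<sigma> \<kappa> (E s) (p s) \<partial>lebesgue_on {0..t}) \<le> 2 * S 0 + 4 * (K\<^sup>2 * D\<^sup>2)"
    using main[OF t] tV[of t] XKD by (simp add: power_mult_distrib)
  also have "\<dots> \<le> 2 * S 0 + 4 * (K\<^sup>2 * (3 * (nf\<^sup>2 + nh\<^sup>2 + ng\<^sup>2)))"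
    using D2 by (simp add: mult_left_mono)
  also have "\<dots> \<le> (2 + 12 * K\<^sup>2) * (S 0 + nf\<^sup>2 + nh\<^sup>2 + ng\<^sup>2)"
    using S0[of 0] by (simp add: algebra_simps)
  finally show "S t + \<theta> * (\<integral>s. dissipation \<Omega> \<sigma> \<kappa> (E s) (p s) \<partial>lebesgue_on {0..t})
      \<le> (2 + 12 * K\<^sup>2) * (S 0 + (H1_time_norm T f)\<^sup>2 + (L2_time_norm T h)\<^sup>2 + (L2_time_norm T g)\<^sup>2)"
    by (simp add: nf_def nh_def ng_def)
qed

theorem theorem1:
  fixes \<Omega> \<Gamma>D \<Gamma>N :: "(real ^ 3) set"
    and T \<epsilon> \<sigma> \<mu> G \<alpha> \<kappa> c0 L :: real
  assumes "lipschitz_polyhedron \<Omega>"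
    and "boundary_decomposition \<Omega> \<Gamma>D \<Gamma>N"
    and "0 < T"
    and "0 < \<epsilon>" "0 < \<sigma>" "0 < \<mu>" "0 < G" "0 < \<alpha>" "0 < \<kappa>" "0 < c0"
    and "0 < L" "L < sqrt (\<sigma> * \<kappa>)"
    and "inf_sup_condition \<Omega> \<Gamma>D"
  shows "\<exists>C>0. \<forall>lam>0. \<forall>f h g E H u \<xi> p E0 H0 u0 \<xi>0 p0.
    f \<in> H1_time T (L2 \<Omega>) \<longrightarrow> h \<in> L2_time T (L2 \<Omega>) \<longrightarrow> g \<in> L2_time T (L2 \<Omega>) \<longrightarrow>
    regular_in_time \<Omega> \<Gamma>D T E H u \<xi> p \<longrightarrow>
    \<xi>0 = \<alpha> *\<^sub>R p0 - lam *\<^sub>R wdiv \<Omega> u0 \<longrightarrow>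
    weak_solution \<Omega> \<Gamma>D T \<epsilon> \<sigma> \<mu> G lam \<alpha> \<kappa> c0 L f h g E H u \<xi> p E0 H0 u0 \<xi>0 p0 \<longrightarrow>
    (\<forall>t\<in>{0..T}.
       energy \<Omega> \<epsilon> \<mu> G lam \<alpha> c0 (E t) (H t) (u t) (\<xi> t) (p t)
         + (1 - L / sqrt (\<sigma> * \<kappa>)) * (\<integral>s. dissipation \<Omega> \<sigma> \<kappa> (E s) (p s) \<partial>lebesgue_on {0..t})
       \<le> C * (energy \<Omega> \<epsilon> \<mu> G lam \<alpha> c0 E0 H0 u0 \<xi>0 p0
              + (H1_time_norm T f)\<^sup>2 + (L2_time_norm T h)\<^sup>2 + (L2_time_norm T g)\<^sup>2)
       \<and> norm (\<xi> t) \<le> C * (G * norm (vgrad \<Omega> (u t)) + norm (f t)))"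
proof -
  have op: "open \<Omega>" using assms(1) by (simp add: lipschitz_polyhedron_def)
  define W where "W = closure (span ((\<lambda>v. (v, vgrad \<Omega> v)) ` sp_U \<Omega> \<Gamma>D))"
  obtain CP where CP: "0 < CP" "\<forall>(u, A)\<in>W. \<exists>k. (k, 0) \<in> W \<and> norm (u - k) \<le> CP * norm A"
    using closure_span_poincare[OF assms(1) sp_U_subset_VH1] unfolding W_def by blast
  obtain \<beta> where \<beta>: "0 < \<beta>"
    "\<And>w. w \<in> sp_W \<Omega> \<Longrightarrow> \<beta> * norm w \<le> (SUP v\<in>sp_U \<Omega> \<Gamma>D - {0}. (wdiv \<Omega> v \<bullet> w) / H1_norm \<Omega> v)"
    using assms(13) unfolding inf_sup_condition_def by blast
  define K where "K = sqrt T / sqrt \<epsilon> + sqrt T / sqrt c0 + CP / sqrt G * (2 / sqrt T + 3 * sqrt T)"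
  \<comment> \<open>One constant for both claims, fixed before \<open>lam\<close>, the data and the
    solution: the energy bound takes \<open>2 + 12 * K\<^sup>2\<close>, the bound on
    \<open>\<xi>\<close> takes \<open>1 / \<beta>\<close>.\<close>
  define C where "C = 2 + 12 * K\<^sup>2 + 1 / \<beta>"
  have C: "0 < C" "2 + 12 * K\<^sup>2 \<le> C" "1 / \<beta> \<le> C"
    using \<beta>(1) by (auto simp: C_def intro: add_pos_nonneg add_nonneg_pos)
  show ?thesis
  proof (intro exI[of _ C] conjI C(1) allI impI ballI)
    fix lam :: real and f h g E H u \<xi> p E0 H0 u0 \<xi>0 p0 t
    assume lam: "0 < lam" and f: "f \<in> H1_time T (L2 \<Omega>)" and h: "h \<in> L2_time T (L2 \<Omega>)" and g: "g \<in> L2_time T (L2 \<Omega>)"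
      and reg: "regular_in_time \<Omega> \<Gamma>D T E H u \<xi> p"
      and sol: "weak_solution \<Omega> \<Gamma>D T \<epsilon> \<sigma> \<mu> G lam \<alpha> \<kappa> c0 L f h g E H u \<xi> p E0 H0 u0 \<xi>0 p0"
      and t: "t \<in> {0..T}"
    let ?data = "energy \<Omega> \<epsilon> \<mu> G lam \<alpha> c0 E0 H0 u0 \<xi>0 p0
        + (H1_time_norm T f)\<^sup>2 + (L2_time_norm T h)\<^sup>2 + (L2_time_norm T g)\<^sup>2"
    note est = energy_estimate[OF op assms(3-12) lam W_def CP f h g reg sol]
    have init: "E 0 = E0" "H 0 = H0" "u 0 = u0" "\<xi> 0 = \<xi>0" "p 0 = p0"
      using sol by (simp_all add: weak_solution_def)
    have "0 \<le> ?data"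
      using assms(4-12) lam by (auto simp: energy_def intro!: add_nonneg_nonneg)
    then have "(2 + 12 * K\<^sup>2) * ?data \<le> C * ?data" by (rule mult_right_mono[OF C(2)])
    with est(1)[OF t]
    show "energy \<Omega> \<epsilon> \<mu> G lam \<alpha> c0 (E t) (H t) (u t) (\<xi> t) (p t)
         + (1 - L / sqrt (\<sigma> * \<kappa>)) * (\<integral>s. dissipation \<Omega> \<sigma> \<kappa> (E s) (p s) \<partial>lebesgue_on {0..t})
       \<le> C * ?data"
      unfolding init K_def[symmetric] by linarith
    have "\<xi> t \<in> sp_W \<Omega>" using reg t by (auto simp: regular_in_time_def H1_time_def)
    from inf_sup_bound[OF \<beta> this assms(7) est(2)[OF t]]
    have "norm (\<xi> t) \<le> 1 / \<beta> * (G * norm (vgrad \<Omega> (u t)) + norm (f t))"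
      using \<beta>(1) by (simp add: field_simps)
    also have "\<dots> \<le> C * (G * norm (vgrad \<Omega> (u t)) + norm (f t))"
      using assms(7) by (intro mult_right_mono C(3)) auto
    finally show "norm (\<xi> t) \<le> C * (G * norm (vgrad \<Omega> (u t)) + norm (f t))" .
  qed
qed

end
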